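(* Let $0\neq m\in\mathbb{Z}$ and let $(\mathbb{Z},\mathsf{E}_1)$ be the self-similar graph with a single edge $e$ and $a|_e=a^m$. Let $\mathcal{F}$ be the fixed point algebra of the gauge action on $\mathcal{O}_{\mathbb{Z},\mathsf{E}_1}$ and let $\mathcal{F}'$ be the relative commutant of $\mathcal{F}$ in $\mathcal{O}_{\mathbb{Z},\mathsf{E}_1}$. Then $$\mathcal{F}'=\overline{\operatorname{span}}\{s_{e^p}u_{a^\ell}s_{e^q}^*: p,q\in\mathbb{N},\ m^p=m^q,\ \ell\in\mathbb{Z}\},$$ and $\mathcal{F}'$ is a Cartan subalgebra of $\mathcal{O}_{\mathbb{Z},\mathsf{E}_1}$.
   Context: Write $\mathbb{Z}=\langle a\rangle$ multiplicatively. $\mathsf{E}_1$ is the directed graph with one vertex and one edge $e$; its finite paths are $e^p$, $p\in\mathbb{N}$. In the self-similar graph $(\mathbb{Z},\mathsf{E}_1)$, $\mathbb{Z}$ acts trivially on paths and the restriction map is $a^\ell|_{e^p}=a^{\ell m^p}$. $\mathcal{O}_{\mathbb{Z},\mathsf{E}_1}$ is the universal unital C*-algebra generated by unitaries $\{u_g\}_{g\in\mathbb{Z}}$ and isometries $\{s_{e^p}\}_{p\in\mathbb{N}}$ with $u_{gh}=u_gu_h$, $s_{e^p}s_{e^q}=s_{e^{p+q}}$, $s_{e^p}s_{e^p}^*=1$, and $u_gs_{e^p}=s_{e^p}u_{g|_{e^p}}$. The gauge action $\gamma$ of $\mathbb{T}$ is $\gamma_t(s_{e^p}u_gs_{e^q}^*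 )=t^{p-q}s_{e^p}u_gs_{e^q}^*$. An abelian C*-subalgebra $\mathcal{B}$ of a C*-algebra $\mathcal{A}$ is a Cartan subalgebra if: (i) $\mathcal{B}$ contains an approximate unit of $\mathcal{A}$; (ii) $\mathcal{B}$ is a maximal abelian subalgebra (MASA); (iii) the normalizer set $\{x\in\mathcal{A}: x\mathcal{B}x^*\cup x^*\mathcal{B}x\subseteq\mathcal{B}\}$ generates $\mathcal{A}$; (iv) there is a faithful conditional expectation from $\mathcal{A}$ onto $\mathcal{B}$. *)

theory Defs
  imports "HOL-Analysis.Analysis" "HOL-Algebra.Module"
begin

section \<open>Unital C*-algebras with explicit carriers\<close>

definition complex_ring :: "complex ring" where
  "complex_ring = \<lparr>carrier = UNIV, mult = (*), one = 1, zero = 0, add = (+)\<rparr>"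

record 'a cstar = "(complex, 'a) module" +
  adj :: "'a \<Rightarrow> 'a"
  nrm :: "'a \<Rightarrow> real"

text \<open>The distance is cut off outside the carrier because \<^locale>\<open>Metric_space\<close> asks for
  nonnegativity and symmetry on the whole type.\<close>

definition cdist :: "'a cstar \<Rightarrow> 'a \<Rightarrow> 'a \<Rightarrow> real" where
  "cdist A x y = (if x \<in> carrier A \<and> y \<in> carrier A then nrm A (x \<ominus>\<^bsub>A\<^esub> y) else 0)"

abbreviation norm_topology :: "'a cstar \<Rightarrow> 'a topology" where
  "norm_topology A \<equiv> Metric_space.mtopology (carrier A) (cdist A)"

locale cstar_algebra = Module.module complex_ring A + ring A for A :: "'a cstar" (structure) +
  assumes smult_mult_left:
      "\<lbrakk>x \<in> carrier A; y \<in> carrier A\<rbrakk> \<Longrightarrow> (c \<odot> x) \<otimes> y = c \<odot> (x \<otimes> y)"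
    and smult_mult_right:
      "\<lbrakk>x \<in> carrier A; y \<in> carrier A\<rbrakk> \<Longrightarrow> x \<otimes> (c \<odot> y) = c \<odot> (x \<otimes> y)"
    and adj_closed: "x \<in> carrier A \<Longrightarrow> adj A x \<in> carrier A"
    and adj_adj: "x \<in> carrier A \<Longrightarrow> adj A (adj A x) = x"
    and adj_add: "\<lbrakk>x \<in> carrier A; y \<in> carrier A\<rbrakk> \<Longrightarrow> adj A (x \<oplus> y) = adj A x \<oplus> adj A y"
    and adj_smult: "x \<in> carrier A \<Longrightarrow> adj A (c \<odot> x) = cnj c \<odot> adj A x"
    and adj_mult: "\<lbrakk>x \<in> carrier A; y \<in> carrier A\<rbrakk> \<Longrightarrow> adj A (x \<otimes> y) = adj A y \<otimes> adj A x"
    and nrm_nonneg: "x \<in> carrier A \<Longrightarrow> 0 \<le> nrm A x"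
    and nrm_eq_0_iff: "x \<in> carrier A \<Longrightarrow> nrm A x = 0 \<longleftrightarrow> x = \<zero>"
    and nrm_triangle: "\<lbrakk>x \<in> carrier A; y \<in> carrier A\<rbrakk> \<Longrightarrow> nrm A (x \<oplus> y) \<le> nrm A x + nrm A y"
    and nrm_smult: "x \<in> carrier A \<Longrightarrow> nrm A (c \<odot> x) = cmod c * nrm A x"
    and nrm_mult: "\<lbrakk>x \<in> carrier A; y \<in> carrier A\<rbrakk> \<Longrightarrow> nrm A (x \<otimes> y) \<le> nrm A x * nrm A y"
    and cstar_identity: "x \<in> carrier A \<Longrightarrow> nrm A (adj A x \<otimes> x) = (nrm A x)\<^sup>2"
    and complete: "Metric_space.mcomplete (carrier A) (cdist A)"
begin

lemma nrm_uminus: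
  assumes "x \<in> carrier A" shows "nrm A (\<ominus> x) = nrm A x"
proof -
  have "(-1) \<oplus>\<^bsub>complex_ring\<^esub> 1 = \<zero>\<^bsub>complex_ring\<^esub>" "\<one>\<^bsub>complex_ring\<^esub> = 1"
    by (simp_all add: complex_ring_def)
  then have "(-1) \<odot> x \<oplus> x = \<zero>"
    using smult_l_distr[of "-1" 1 x] smult_one[OF assms] smult_l_null[OF assms] assms
    by (simp add: complex_ring_def)
  moreover have "(-1) \<odot> x \<in> carrier A"
    using assms by (intro smult_closed) (simp_all add: complex_ring_def)
  ultimately have "\<ominus> x = (-1) \<odot> x"
    using assms by (simp add: minus_equality)
  then show ?thesis
    using nrm_smult[OF assms, of "-1"] by simp
qed

sublocale cmetric: Metric_space "carrier A" "cdist A"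
proof
  fix x y z
  show "0 \<le> cdist A x y"
    by (simp add: cdist_def nrm_nonneg)
  show "cdist A x y = cdist A y x"
  proof (cases "x \<in> carrier A \<and> y \<in> carrier A")
    case True
    then have "\<ominus> (x \<ominus> y) = y \<ominus> x"
      by (simp add: a_minus_def minus_add a_comm)
    then show ?thesis
      using True nrm_uminus[of "x \<ominus> y"] by (simp add: cdist_def)
  qed (auto simp: cdist_def)
  show "cdist A x y = 0 \<longleftrightarrow> x = y" if "x \<in> carrier A" "y \<in> carrier A"
  proof -
    have "x \<ominus> y = \<zero> \<longleftrightarrow> x = y"
      using that minus_equality[of x "\<ominus> y"] by (auto simp: a_minus_def r_neg)
    then show ?thesis
      using that nrm_eq_0_iff[of "x \<ominus> y"] by (simp add: cdist_def)
  qed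
  show "cdist A x z \<le> cdist A x y + cdist A y z"
    if "x \<in> carrier A" "y \<in> carrier A" "z \<in> carrier A"
  proof -
    have "(x \<ominus> y) \<oplus> (y \<ominus> z) = x \<ominus> z"
      using that by (simp add: a_minus_def a_assoc) (simp add: a_assoc[symmetric] l_neg)
    then show ?thesis
      using that nrm_triangle[of "x \<ominus> y" "y \<ominus> z"] by (simp add: cdist_def)
  qed
qed

end

definition positive_element :: "'a cstar \<Rightarrow> 'a \<Rightarrow> bool" where
  "positive_element A x \<longleftrightarrow> (\<exists>y\<in>carrier A. x = adj A y \<otimes>\<^bsub>A\<^esub> y)"

definition isometry_in :: "'a cstar \<Rightarrow> 'a \<Rightarrow> bool" where
  "isometry_in A x \<longleftrightarrow> x \<in> carrier A \<and> adj A x \<otimes>\<^bsub>A\<^esub> x = \<one>\<^bsub>A\<^esub>"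

definition unitary_in :: "'a cstar \<Rightarrow> 'a \<Rightarrow> bool" where
  "unitary_in A x \<longleftrightarrow>
     x \<in> carrier A \<and> adj A x \<otimes>\<^bsub>A\<^esub> x = \<one>\<^bsub>A\<^esub> \<and> x \<otimes>\<^bsub>A\<^esub> adj A x = \<one>\<^bsub>A\<^esub>"

definition closed_span :: "'a cstar \<Rightarrow> 'a set \<Rightarrow> 'a set" where
  "closed_span A X = norm_topology A closure_of ((\<lambda>V. submodule V complex_ring A) hull X)"

text \<open>A C*-subalgebra need not contain the unit of the ambient algebra.\<close>

definition cstar_subalgebra :: "'a cstar \<Rightarrow> 'a set \<Rightarrow> bool" where
  "cstar_subalgebra A B \<longleftrightarrow>
     submodule B complex_ring A \<and>
     (\<forall>x\<in>B. \<forall>y\<in>B. x \<otimes>\<^bsub>A\<^esub> y \<in> B) \<and>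
     (\<forall>x\<in>B. adj A x \<in> B) \<and>
     closedin (norm_topology A) B"

definition cstar_generated :: "'a cstar \<Rightarrow> 'a set \<Rightarrow> 'a set" where
  "cstar_generated A X = cstar_subalgebra A hull X"

definition star_homs :: "'a cstar \<Rightarrow> 'b cstar \<Rightarrow> ('a \<Rightarrow> 'b) set" where
  "star_homs A B =
     {\<phi> \<in> ring_hom A B. (\<forall>c. \<forall>x\<in>carrier A. \<phi> (c \<odot>\<^bsub>A\<^esub> x) = c \<odot>\<^bsub>B\<^esub> \<phi> x) \<and>
                         (\<forall>x\<in>carrier A. \<phi> (adj A x) = adj B (\<phi> x))}"

definition star_autos :: "'a cstar \<Rightarrow> ('a \<Rightarrow> 'a) set" where
  "star_autos A = {\<phi> \<in> star_homs A A. bij_betw \<phi> (carrier A) (carrier A)}"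

definition relative_commutant :: "'a cstar \<Rightarrow> 'a set \<Rightarrow> 'a set" where
  "relative_commutant A F = {x \<in> carrier A. \<forall>y\<in>F. x \<otimes>\<^bsub>A\<^esub> y = y \<otimes>\<^bsub>A\<^esub> x}"


section \<open>Cartan subalgebras\<close>

definition abelian_cstar_subalgebra :: "'a cstar \<Rightarrow> 'a set \<Rightarrow> bool" where
  "abelian_cstar_subalgebra A B \<longleftrightarrow>
     cstar_subalgebra A B \<and> (\<forall>x\<in>B. \<forall>y\<in>B. x \<otimes>\<^bsub>A\<^esub> y = y \<otimes>\<^bsub>A\<^esub> x)"

definition masa :: "'a cstar \<Rightarrow> 'a set \<Rightarrow> bool" where
  "masa A B \<longleftrightarrow>
     abelian_cstar_subalgebra A B \<and> (\<forall>C. abelian_cstar_subalgebra A C \<and> B \<subseteq> C \<longrightarrow> C = B)"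

text \<open>A net of elements is represented by the filter of sets that eventually contain it;
  every proper filter arises from a net in this way.\<close>

definition contains_approximate_unit :: "'a cstar \<Rightarrow> 'a set \<Rightarrow> bool" where
  "contains_approximate_unit A B \<longleftrightarrow>
     (\<exists>net :: 'a filter. net \<noteq> bot \<and>
        (\<forall>\<^sub>F h in net. h \<in> B \<and> positive_element A h \<and> nrm A h \<le> 1) \<and>
        (\<forall>x\<in>carrier A.
           ((\<lambda>h. nrm A ((h \<otimes>\<^bsub>A\<^esub> x) \<ominus>\<^bsub>A\<^esub> x)) \<longlongrightarrow> 0) net \<and>
           ((\<lambda>h. nrm A ((x \<otimes>\<^bsub>A\<^esub> h) \<ominus>\<^bsub>A\<^esub> x)) \<longlongrightarrow> 0) net))"

definition normalizer_set :: "'a cstar \<Rightarrow> 'a set \<Rightarrow> 'a set" where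
  "normalizer_set A B =
     {x \<in> carrier A. \<forall>b\<in>B. x \<otimes>\<^bsub>A\<^esub> b \<otimes>\<^bsub>A\<^esub> adj A x \<in> B \<and> adj A x \<otimes>\<^bsub>A\<^esub> b \<otimes>\<^bsub>A\<^esub> x \<in> B}"

definition conditional_expectation :: "'a cstar \<Rightarrow> 'a set \<Rightarrow> ('a \<Rightarrow> 'a) \<Rightarrow> bool" where
  "conditional_expectation A B E \<longleftrightarrow>
     E \<in> carrier A \<rightarrow> B \<and>
     (\<forall>x\<in>carrier A. \<forall>y\<in>carrier A. E (x \<oplus>\<^bsub>A\<^esub> y) = E x \<oplus>\<^bsub>A\<^esub> E y) \<and>
     (\<forall>c. \<forall>x\<in>carrier A. E (c \<odot>\<^bsub>A\<^esub> x) = c \<odot>\<^bsub>A\<^esub> E x) \<and>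
     (\<forall>b\<in>B. E b = b) \<and>
     (\<forall>x\<in>carrier A. nrm A (E x) \<le> nrm A x) \<and>
     (\<forall>x\<in>carrier A. positive_element A x \<longrightarrow> positive_element A (E x)) \<and>
     (\<forall>x\<in>carrier A. \<forall>b\<in>B. E (b \<otimes>\<^bsub>A\<^esub> x) = b \<otimes>\<^bsub>A\<^esub> E x \<and> E (x \<otimes>\<^bsub>A\<^esub> b) = E x \<otimes>\<^bsub>A\<^esub> b)"

definition faithful_map :: "'a cstar \<Rightarrow> ('a \<Rightarrow> 'a) \<Rightarrow> bool" where
  "faithful_map A E \<longleftrightarrow>
     (\<forall>x\<in>carrier A. positive_element A x \<and> E x = \<zero>\<^bsub>A\<^esub> \<longrightarrow> x = \<zero>\<^bsub>A\<^esub>)"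

definition cartan_subalgebra :: "'a cstar \<Rightarrow> 'a set \<Rightarrow> bool" where
  "cartan_subalgebra A B \<longleftrightarrow>
     abelian_cstar_subalgebra A B \<and>
     contains_approximate_unit A B \<and>
     masa A B \<and>
     cstar_generated A (normalizer_set A B) = carrier A \<and>
     (\<exists>E. conditional_expectation A B E \<and> faithful_map A E)"


section \<open>The C*-algebra of the self-similar graph with one vertex and one edge\<close>

text \<open>The group element written multiplicatively as the \<open>l\<close>-th power of the generator is
  represented by \<open>l :: int\<close>, and the path consisting of \<open>p\<close> copies of the edge by \<open>p :: nat\<close>.\<close>

definition restriction :: "int \<Rightarrow> int \<Rightarrow> nat \<Rightarrow> int" where
  "restriction m l p = l * m ^ p"

definition OZE1_relations :: "int \<Rightarrow> 'a cstar \<Rightarrow> (int \<Rightarrow> 'a) \<Rightarrow> (nat \<Rightarrow> 'a) \<Rightarrow> bool" where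
  "OZE1_relations m A u s \<longleftrightarrow>
     (\<forall>g. unitary_in A (u g)) \<and>
     (\<forall>p. isometry_in A (s p)) \<and>
     (\<forall>g h. u (g + h) = u g \<otimes>\<^bsub>A\<^esub> u h) \<and>
     (\<forall>p q. s p \<otimes>\<^bsub>A\<^esub> s q = s (p + q)) \<and>
     (\<forall>p. s p \<otimes>\<^bsub>A\<^esub> adj A (s p) = \<one>\<^bsub>A\<^esub>) \<and>
     (\<forall>g p. u g \<otimes>\<^bsub>A\<^esub> s p = s p \<otimes>\<^bsub>A\<^esub> u (restriction m g p))"

text \<open>
  The target of a universal property cannot range over all types inside a definition. It ranges
  here over all unital C*-algebras whose elements are functions from complex sequences to complex
  sequences. This is no restriction: a target may be replaced by the C*-subalgebra generated by
  the countably many elements satisfying the relations, which is separable, hence *-isomorphic to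
  an algebra of operators on \<open>\<ell>\<^sup>2(\<nat>)\<close>, and such operators (extended by zero) are functions of this
  type. The *-homomorphism is unique because the generators generate.
\<close>

type_synonym seq_map = "(nat \<Rightarrow> complex) \<Rightarrow> (nat \<Rightarrow> complex)"

definition is_OZE1 :: "int \<Rightarrow> 'a cstar \<Rightarrow> (int \<Rightarrow> 'a) \<Rightarrow> (nat \<Rightarrow> 'a) \<Rightarrow> bool" where
  "is_OZE1 m A u s \<longleftrightarrow>
     cstar_algebra A \<and>
     OZE1_relations m A u s \<and>
     cstar_generated A (range u \<union> range s) = carrier A \<and>
     (\<forall>(B :: seq_map cstar) v t. cstar_algebra B \<and> OZE1_relations m B v t \<longrightarrow>
        (\<exists>\<phi>\<in>star_homs A B. (\<forall>g. \<phi> (u g) = v g) \<and> (\<forall>p. \<phi> (s p) = t p)))"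

definition spanning_element ::
    "'a cstar \<Rightarrow> (int \<Rightarrow> 'a) \<Rightarrow> (nat \<Rightarrow> 'a) \<Rightarrow> nat \<Rightarrow> int \<Rightarrow> nat \<Rightarrow> 'a" where
  "spanning_element A u s p g q = s p \<otimes>\<^bsub>A\<^esub> u g \<otimes>\<^bsub>A\<^esub> adj A (s q)"

text \<open>The circle group is the set of complex numbers of modulus one; the values of \<open>\<gamma>\<close> at other
  numbers are irrelevant. The formula determines each \<open>\<gamma> z\<close> on the carrier, since the
  elements it mentions span a dense subspace.\<close>

definition gauge_action ::
    "'a cstar \<Rightarrow> (int \<Rightarrow> 'a) \<Rightarrow> (nat \<Rightarrow> 'a) \<Rightarrow> (complex \<Rightarrow> 'a \<Rightarrow> 'a) \<Rightarrow> bool" where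
  "gauge_action A u s \<gamma> \<longleftrightarrow>
     (\<forall>z. cmod z = 1 \<longrightarrow> \<gamma> z \<in> star_autos A \<and>
        (\<forall>p g q. \<gamma> z (spanning_element A u s p g q)
           = (z powi (int p - int q)) \<odot>\<^bsub>A\<^esub> spanning_element A u s p g q))"

definition fixed_point_algebra :: "'a cstar \<Rightarrow> (complex \<Rightarrow> 'a \<Rightarrow> 'a) \<Rightarrow> 'a set" where
  "fixed_point_algebra A \<gamma> = {x \<in> carrier A. \<forall>z. cmod z = 1 \<longrightarrow> \<gamma> z x = x}"

end

theory Submission
  imports Defs
begin

text \<open>The elements \<open>s\<^sub>p u\<^sub>l s\<^sub>q\<^sup>*\<close> span a dense subalgebra, graded by \<open>p - q\<close>, and
  averaging the gauge action over \<open>k\<close>-th roots of unity (over the circle, as a limit, if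
  \<open>k = 0\<close>) gives a faithful conditional expectation \<open>E\<^sub>k\<close> onto the closed span of the elements
  whose degree is a multiple of \<open>k\<close>. Let \<open>k\<close> be 1, 2 or 0 according to whether \<open>m\<close> is 1, -1 or
  neither, so that \<open>m\<^sup>p = m\<^sup>q\<close> iff \<open>k\<close> divides \<open>p - q\<close>; the fixed points of the \<open>k\<close>-th roots
  of unity form an abelian algebra that contains \<open>\<F>\<close> and hence lies in \<open>\<F>'\<close>. Conversely, let
  \<open>x\<close> commute with \<open>\<F>\<close> and let \<open>w = s\<^sub>p u\<^sub>l s\<^sub>q\<^sup>*\<close> have degree not divisible by \<open>k\<close>. The
  coefficient \<open>f = E\<^sub>0(x w)\<close> lies in \<open>\<F>\<close> and satisfies \<open>f u\<^sub>K = f\<close> with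
  \<open>K = m\<^sup>p - m\<^sup>q \<noteq> 0\<close>. On \<open>\<F>\<close>, approximated by Laurent polynomials in conjugates of
  \<open>u\<^sub>1\<close>, the norm is controlled by the values at \<open>N\<close>-th roots of unity for large \<open>N\<close> coprime to
  \<open>m K\<close>, which the universal property realises by representations on \<open>\<complex>\<^sup>N\<close>; this forces
  \<open>f = 0\<close>. So \<open>x - E\<^sub>k(x)\<close> has no nonzero coefficient and vanishes by faithfulness of \<open>E\<^sub>0\<close>.\<close>

section \<open>C*-algebras as a type class\<close>

text \<open>The data are purely algebraic: automorphisms come without continuity. Everything
  analytic is drawn from the C*-identity: positivity is a norm bound, square roots are power series,
  and star homomorphisms turn out to be contractive. Averages over finite groups of roots of unity
  replace an integral, and their limit exists because it is eventually constant on the spanning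
  elements.

  The obstacle in the commutant is to exclude \<open>f * U K = f\<close> with
  \<open>f \<noteq> 0\<close>. Read as a function on the circle, such an \<open>f\<close> is killed
  by \<open>z ^ K - 1\<close>, so it vanishes off the \<open>K\<close>-th roots of unity and, by
  continuity, everywhere. But the relations alone do not make the algebra large enough for this
  picture (the zero algebra satisfies them), so the universal property must supply representations.
  Matrices suffice because roots of unity are dense in the circle. \<open>N\<close> coprime to
  \<open>m\<close> makes multiplication by \<open>m\<close> a permutation modulo \<open>N\<close>;
  \<open>N\<close> coprime to \<open>K\<close> leaves 1 as the only \<open>N\<close>-th root of
  unity at which \<open>z ^ K = 1\<close>, and the value there is bounded through a neighbouring
  root.\<close>

text \<open>The axiom \<^term>\<open>(0::'a::zero_neq_one) \<noteq> 1\<close> is left out, so that the zero algebra is an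
  instance.\<close>

class cstar_type = real_normed_algebra + monoid_mult + banach +
  fixes scaleC :: "complex \<Rightarrow> 'a \<Rightarrow> 'a" (infixr "*\<^sub>C" 75)
    and star :: "'a \<Rightarrow> 'a"
  assumes scaleC_add_right: "c *\<^sub>C (x + y) = c *\<^sub>C x + c *\<^sub>C y"
    and scaleC_add_left: "(c + d) *\<^sub>C x = c *\<^sub>C x + d *\<^sub>C x"
    and scaleC_scaleC [simp]: "c *\<^sub>C d *\<^sub>C x = (c * d) *\<^sub>C x"
    and scaleR_scaleC: "r *\<^sub>R x = complex_of_real r *\<^sub>C x"
    and mult_scaleC_left [simp]: "(c *\<^sub>C x) * y = c *\<^sub>C (x * y)"
    and mult_scaleC_right [simp]: "x * (c *\<^sub>C y) = c *\<^sub>C (x * y)"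
    and norm_scaleC [simp]: "norm (c *\<^sub>C x) = cmod c * norm x"
    and star_star [simp]: "star (star x) = x"
    and star_add: "star (x + y) = star x + star y"
    and star_scaleC [simp]: "star (c *\<^sub>C x) = cnj c *\<^sub>C star x"
    and star_mult: "star (x * y) = star y * star x"
    and norm_star_mult: "norm (star x * x) = (norm x)\<^sup>2"

lemma scaleC_one [simp]: "1 *\<^sub>C x = x"
  using scaleR_scaleC[of 1 x] by simp

lemma scaleC_zero_left [simp]: "0 *\<^sub>C x = 0"
  using scaleR_scaleC[of 0 x] by simp

lemma scaleC_zero_right [simp]: "c *\<^sub>C 0 = 0"
  using scaleC_add_right[of c 0 0] by simp

lemma scaleC_minus_left: "(- c) *\<^sub>C x = - (c *\<^sub>C x)"
  using scaleC_add_left[of c "- c" x] by (simp add: eq_neg_iff_add_eq_0 add.commute)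

lemma scaleC_minus_right: "c *\<^sub>C (- x) = - (c *\<^sub>C x)"
  using scaleC_add_right[of c x "- x"] by (simp add: eq_neg_iff_add_eq_0 add.commute)

lemma scaleC_diff_right: "c *\<^sub>C (x - y) = c *\<^sub>C x - c *\<^sub>C y"
  using scaleC_add_right[of c x "- y"] by (simp add: scaleC_minus_right)

lemma scaleC_sum_right: "c *\<^sub>C (\<Sum>i\<in>I. f i) = (\<Sum>i\<in>I. c *\<^sub>C f i)"
  by (induction I rule: infinite_finite_induct) (auto simp: scaleC_add_right)

lemma scaleC_sum_left: "(\<Sum>i\<in>I. f i) *\<^sub>C x = (\<Sum>i\<in>I. f i *\<^sub>C x)"
  by (induction I rule: infinite_finite_induct) (auto simp: scaleC_add_left)

lemma star_zero [simp]: "star 0 = 0"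
  using star_add[of 0 0] by simp

lemma star_minus: "star (- x) = - star x"
  using star_add[of x "- x"] by (simp add: eq_neg_iff_add_eq_0 add.commute)

lemma star_diff: "star (x - y) = star x - star y"
  using star_add[of x "- y"] by (simp add: star_minus)

lemma star_scaleR [simp]: "star (r *\<^sub>R x) = r *\<^sub>R star x"
  by (simp add: scaleR_scaleC)

lemma star_one [simp]: "star 1 = 1"
  using star_mult[of 1 "star 1"] by simp

lemma star_sum: "star (\<Sum>i\<in>I. f i) = (\<Sum>i\<in>I. star (f i))"
  by (induction I rule: infinite_finite_induct) (auto simp: star_add)

lemma star_power: "star (x ^ n) = star x ^ n"
  by (induction n) (auto simp: star_mult power_commutes)

lemma norm_star [simp]: "norm (star x) = norm (x::'a::cstar_type)"
proof -
  have le: "norm y \<le> norm (star y)" for y :: 'a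
  proof (cases "norm y = 0")
    case False
    have "norm y * norm y \<le> norm (star y) * norm y"
      using norm_mult_ineq[of "star y" y] by (simp add: norm_star_mult power2_eq_square)
    then show ?thesis
      using False by (simp add: mult_le_cancel_right)
  qed simp
  show ?thesis
    using le[of x] le[of "star x"] by simp
qed

lemma norm_mult_star: "norm (x * star x) = (norm (x::'a::cstar_type))\<^sup>2"
  using norm_star_mult[of "star x"] by simp

text \<open>The norm of 1 solves \<open>t * t = t\<close>, so it is 0 or 1; the value 0 occurs in
  the zero algebra.\<close>

lemma norm_one_le: "norm (1::'a::cstar_type) \<le> 1"
proof -
  have "norm (1::'a) * norm (1::'a) = norm (1::'a)"
    using norm_star_mult[of "1::'a"] by (simp add: power2_eq_square)
  then show ?thesis
    by (metis mult_cancel_right1 norm_zero order_refl zero_le_one norm_eq_zero)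
qed

lemma norm_scaleR_one_le: "norm (t *\<^sub>R (1::'a::cstar_type)) \<le> \<bar>t\<bar>"
  using norm_one_le[where 'a='a] mult_left_mono[of "norm (1::'a)" 1 "\<bar>t\<bar>"] by simp

lemma norm_selfadjoint_square:
  "star h = h \<Longrightarrow> norm (h * h) = (norm (h::'a::cstar_type))\<^sup>2"
  using norm_star_mult[of h] by simp

lemma norm_isometry_le: "star x * x = (1::'a::cstar_type) \<Longrightarrow> norm x \<le> 1"
  using norm_star_mult[of x] norm_one_le[where 'a='a] abs_square_le_1[of "norm x"] by simp

lemma norm_power_le: "norm (x ^ Suc n) \<le> norm (x::'a::cstar_type) ^ Suc n"
proof (induction n)
  case (Suc n)
  have "norm (x ^ Suc (Suc n)) \<le> norm x * norm (x ^ Suc n)"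
    using norm_mult_ineq[of x "x ^ Suc n"] by simp
  also have "\<dots> \<le> norm x * norm x ^ Suc n"
    by (rule mult_left_mono[OF Suc]) simp
  finally show ?case by simp
qed simp

lemma norm_power_le': "norm (x ^ n) \<le> norm (x::'a::cstar_type) ^ n"
proof (cases n)
  case 0
  then show ?thesis using norm_one_le[where 'a='a] by simp
next
  case (Suc k)
  then show ?thesis using norm_power_le[of x k] by (simp only:)
qed

lemma bounded_linear_star: "bounded_linear (star :: 'a \<Rightarrow> 'a::cstar_type)"
  by (rule bounded_linear_intro[where K=1]) (auto simp: star_add)

lemma bounded_linear_scaleC: "bounded_linear (\<lambda>x::'a::cstar_type. c *\<^sub>C x)"
  by (rule bounded_linear_intro[where K="cmod c"])
     (auto simp: scaleC_add_right scaleR_scaleC mult.commute)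

text \<open>Each use of the C*-identity doubles the exponent. This stands in for the spectral radius
  formula and is why later estimates run along powers of two.\<close>

lemma power_selfadjoint_norm:
  assumes "star h = (h::'a::cstar_type)"
  shows "norm (h ^ (2 ^ n)) = norm h ^ (2 ^ n)"
proof (induction n)
  case (Suc n)
  have "h ^ (2 ^ Suc n) = h ^ (2 ^ n) * h ^ (2 ^ n)"
    by (simp add: power_add[symmetric] mult_2)
  then have "norm (h ^ (2 ^ Suc n)) = (norm (h ^ (2 ^ n)))\<^sup>2"
    using norm_selfadjoint_square[of "h ^ (2 ^ n)"] assms by (simp add: star_power)
  then show ?case
    using Suc by (simp add: power_mult[symmetric] mult.commute)
qed simp

section \<open>Square roots\<close>

text \<open>The Taylor coefficients of \<open>sqrt (1 - x)\<close> at 0.\<close>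

definition sqrt_coeff :: "nat \<Rightarrow> real" where
  "sqrt_coeff n = ((1/2) gchoose n) * (-1) ^ n"

lemma sqrt_coeff_0 [simp]: "sqrt_coeff 0 = 1"
  by (simp add: sqrt_coeff_def)

text \<open>Up to the factorial, the coefficient is the product (-1/2)(1/2)(3/2)..., in which only
  the leading factor is negative.\<close>

lemma sqrt_coeff_nonpos: 
  assumes "n > 0" shows "sqrt_coeff n \<le> 0"
proof -
  obtain k where n: "n = Suc k" using assms by (cases n) auto
  have "sqrt_coeff n = pochhammer (-1/2) n / fact n"
    by (simp add: sqrt_coeff_def gbinomial_pochhammer power_add[symmetric] mult.assoc
      flip: power_mult_distrib)
  moreover have "pochhammer (-1/2::real) n = (-1/2) * pochhammer (1/2) k"
    using n by (simp add: pochhammer_rec)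
  moreover have "pochhammer (1/2::real) k \<ge> 0"
    by (rule pochhammer_nonneg) simp
  ultimately show ?thesis
    by (simp add: divide_nonpos_nonneg)
qed

text \<open>The partial sums are the Taylor coefficients of \<open>sqrt (1 - x) / (1 - x)\<close>,
  the inverse square root of \<open>1 - x\<close>.\<close>

lemma sqrt_coeff_partial_sum: "(\<Sum>n\<le>N. sqrt_coeff n) \<ge> 0"
proof -
  have "(\<Sum>n\<le>N. sqrt_coeff n) = (-1) ^ N * ((1/2 - 1) gchoose N)"
    unfolding sqrt_coeff_def by (rule gbinomial_sum_lower_neg)
  also have "\<dots> = pochhammer (1/2) N / fact N"
    by (simp add: gbinomial_pochhammer)
  also have "\<dots> \<ge> 0"
    by (intro divide_nonneg_nonneg pochhammer_nonneg) auto
  finally show ?thesis .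
qed

text \<open>By the signs of the coefficients, the sum is 1 minus a partial sum of
  \<open>sqrt_coeff\<close>. It gives convergence up to the boundary \<open>norm x = 1\<close>, and
  the exact bound 1 makes the square root positive.\<close>

lemma sqrt_coeff_abs_sum: "(\<Sum>n<N. \<bar>sqrt_coeff (Suc n)\<bar>) \<le> 1"
proof -
  have "(\<Sum>n<N. \<bar>sqrt_coeff (Suc n)\<bar>) = - (\<Sum>n<N. sqrt_coeff (Suc n))"
    by (subst sum_negf[symmetric]) (intro sum.cong, auto intro!: abs_of_nonpos sqrt_coeff_nonpos)
  also have "(\<Sum>n<N. sqrt_coeff (Suc n)) = (\<Sum>n\<le>N. sqrt_coeff n) - 1"
    by (simp add: sum.atMost_shift)
  also have "- \<dots> \<le> 1"
    using sqrt_coeff_partial_sum[of N] by simp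
  finally show ?thesis .
qed

lemma sqrt_coeff_Suc_summable: "summable (\<lambda>n. \<bar>sqrt_coeff (Suc n)\<bar>)"
  by (rule summableI_nonneg_bounded[where x=1]) (use sqrt_coeff_abs_sum in auto)

lemma sqrt_coeff_summable: "summable (\<lambda>n. \<bar>sqrt_coeff n\<bar>)"
  using sqrt_coeff_Suc_summable summable_Suc_iff[of "\<lambda>n. \<bar>sqrt_coeff n\<bar>"] by simp

text \<open>Vandermonde's identity for 1/2 + 1/2 = 1: the Cauchy square of the series is
  \<open>1 - x\<close>.\<close>

lemma sqrt_coeff_convolution:
  "(\<Sum>i\<le>n. sqrt_coeff i * sqrt_coeff (n - i)) = (if n = 0 then 1 else if n = 1 then -1 else 0)"
proof -
  have "(\<Sum>i\<le>n. sqrt_coeff i * sqrt_coeff (n - i)) 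
      = (\<Sum>i\<le>n. ((1/2) gchoose i) * ((1/2) gchoose (n - i)) * (-1) ^ n)"
    by (intro sum.cong refl) (auto simp: sqrt_coeff_def simp flip: power_add)
  also have "\<dots> = ((1/2 + 1/2) gchoose n) * (-1) ^ n"
    by (simp only: sum_distrib_right[symmetric] atMost_atLeast0 gbinomial_Vandermonde)
  also have "((1/2 + 1/2) gchoose n) = real (1 choose n)"
    by (simp add: binomial_gbinomial)
  finally show ?thesis
    by (cases n) (auto simp: binomial_eq_0)
qed

text \<open>The square root of \<open>1 - x\<close>, meaningful for
  \<open>norm x \<le> 1\<close>.\<close>

definition sqrt_series :: "'a \<Rightarrow> 'a::cstar_type" where
  "sqrt_series x = (\<Sum>n. sqrt_coeff n *\<^sub>R x ^ n)"

context
  fixes x :: "'a::cstar_type"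
  assumes x: "norm x \<le> 1"
begin

lemma sqrt_series_norm_term: "norm (sqrt_coeff n *\<^sub>R x ^ n) \<le> \<bar>sqrt_coeff n\<bar>"
proof -
  have "norm (x ^ n) \<le> 1"
    using norm_power_le'[of x n] x by (meson norm_ge_zero order_trans power_le_one)
  then show ?thesis
    using mult_left_mono[of "norm (x ^ n)" 1 "\<bar>sqrt_coeff n\<bar>"] by simp
qed

lemma sqrt_series_summable_norm: "summable (\<lambda>n. norm (sqrt_coeff n *\<^sub>R x ^ n))"
  by (rule summable_norm_comparison_test[OF _ sqrt_coeff_summable])
     (use sqrt_series_norm_term in auto)

lemma sqrt_series_sums: "(\<lambda>n. sqrt_coeff n *\<^sub>R x ^ n) sums sqrt_series x"
  unfolding sqrt_series_def
  by (rule summable_sums[OF summable_norm_cancel[OF sqrt_series_summable_norm]])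

lemma sqrt_series_square: "sqrt_series x * sqrt_series x = 1 - x"
proof -
  have "(\<lambda>k. \<Sum>i\<le>k. (sqrt_coeff i *\<^sub>R x ^ i) * (sqrt_coeff (k - i) *\<^sub>R x ^ (k - i)))
      sums (sqrt_series x * sqrt_series x)"
    unfolding sqrt_series_def
    by (rule Cauchy_product_sums) (use sqrt_series_summable_norm in auto)
  moreover have "(\<Sum>i\<le>k. (sqrt_coeff i *\<^sub>R x ^ i) * (sqrt_coeff (k - i) *\<^sub>R x ^ (k - i)))
      = (if k = 0 then 1 else if k = 1 then - x else 0)" for k
  proof -
    have "(\<Sum>i\<le>k. (sqrt_coeff i *\<^sub>R x ^ i) * (sqrt_coeff (k - i) *\<^sub>R x ^ (k - i)))
        = (\<Sum>i\<le>k. sqrt_coeff i * sqrt_coeff (k - i)) *\<^sub>R x ^ k"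
      unfolding scaleR_sum_left by (intro sum.cong refl) (auto simp flip: power_add)
    then show ?thesis
      by (simp add: sqrt_coeff_convolution)
  qed
  ultimately have "(\<lambda>k. if k = 0 then 1 else if k = 1 then - x else 0)
      sums (sqrt_series x * sqrt_series x)"
    by simp
  moreover have "(\<lambda>k::nat. if k = 0 then 1 else if k = 1 then - x else 0) sums (1 - x)"
    using sums_finite[of "{0,1::nat}" "\<lambda>k. if k = 0 then 1 else if k = 1 then - x else 0"] by simp
  ultimately show ?thesis
    using sums_unique2 by blast
qed

lemma star_sqrt_series:
  assumes "star x = x" shows "star (sqrt_series x) = sqrt_series x"
proof -
  have "(\<lambda>n. star (sqrt_coeff n *\<^sub>R x ^ n)) sums star (sqrt_series x)"
    by (rule bounded_linear.sums[OF bounded_linear_star sqrt_series_sums])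
  then show ?thesis
    using sqrt_series_sums assms by (simp add: star_power sums_iff)
qed

lemma sqrt_series_commute:
  assumes "z * x = x * z" shows "z * sqrt_series x = sqrt_series x * z"
proof -
  have "z * x ^ n = x ^ n * z" for n
    by (induction n) (auto simp: mult.assoc assms power_commutes simp flip: mult.assoc[of z])
  then show ?thesis
    using sums_mult[OF sqrt_series_sums, of z] sums_mult2[OF sqrt_series_sums, of z]
    by (simp add: sums_iff)
qed

text \<open>This is the norm bound in the definition of positivity, with
  \<open>t = 1\<close>.\<close>

lemma norm_one_minus_sqrt_series: "norm (1 - sqrt_series x) \<le> 1"
proof -
  have *: "(\<lambda>n. sqrt_coeff (Suc n) *\<^sub>R x ^ Suc n) sums (sqrt_series x - 1)"
    using sqrt_series_sums sums_Suc_iff[of "\<lambda>n. sqrt_coeff n *\<^sub>R x ^ n" "sqrt_series x - 1"] by simp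
  have s: "summable (\<lambda>n. norm (sqrt_coeff (Suc n) *\<^sub>R x ^ Suc n))"
    using sqrt_series_summable_norm
    by (subst summable_Suc_iff)
  have "norm (sqrt_series x - 1) \<le> (\<Sum>n. norm (sqrt_coeff (Suc n) *\<^sub>R x ^ Suc n))"
    using summable_norm[OF s] * by (simp only: sums_iff)
  also have "\<dots> \<le> (\<Sum>n. \<bar>sqrt_coeff (Suc n)\<bar>)"
    by (rule suminf_le[OF sqrt_series_norm_term s sqrt_coeff_Suc_summable])
  also have "\<dots> \<le> 1"
    by (rule suminf_le_const[OF sqrt_coeff_Suc_summable]) (use sqrt_coeff_abs_sum in auto)
  finally show ?thesis
    by (simp add: norm_minus_commute)
qed

end

section \<open>Positive elements\<close>

text \<open>Positivity of a self-adjoint element is expressed without the spectrum: the spectrum of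
  \<open>h\<close> lies in \<open>[0, 2t]\<close> iff \<open>t - h\<close> has norm at most \<open>t\<close>.\<close>

definition npos :: "'a::cstar_type \<Rightarrow> bool" where
  "npos h \<longleftrightarrow> star h = h \<and> (\<exists>t\<ge>0. norm (t *\<^sub>R 1 - h) \<le> t)"

lemma nposD: "npos h \<Longrightarrow> star h = h"
  by (simp add: npos_def)

lemma nposI: "star h = h \<Longrightarrow> t \<ge> 0 \<Longrightarrow> norm (t *\<^sub>R 1 - h) \<le> t \<Longrightarrow> npos h"
  by (auto simp: npos_def)

text \<open>The triangle inequality, with the two witnesses added. For elements of the form
  \<open>star a * a\<close> the same closure property would be hard; the norm formulation makes it
  immediate.\<close>

lemma npos_add:
  assumes "npos h" "npos g" shows "npos (h + g)"
proof -
  from assms obtain s t where st: "s \<ge> 0" "norm (s *\<^sub>R 1 - h) \<le> s" "t \<ge> 0" "norm (t *\<^sub>R 1 - g) \<le> t"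
    by (auto simp: npos_def)
  have "norm ((s + t) *\<^sub>R 1 - (h + g)) \<le> norm (s *\<^sub>R 1 - h) + norm (t *\<^sub>R 1 - g)"
    using norm_triangle_ineq[of "s *\<^sub>R 1 - h" "t *\<^sub>R 1 - g"] by (simp add: algebra_simps)
  with st show ?thesis
    using assms by (intro nposI[of _ "s + t"]) (auto simp: star_add nposD)
qed

lemma npos_zero [simp]: "npos 0"
  by (rule nposI[of _ 0]) auto

lemma npos_sum: "(\<And>i. i \<in> I \<Longrightarrow> npos (f i)) \<Longrightarrow> npos (\<Sum>i\<in>I. f i)"
  by (induction I rule: infinite_finite_induct) (auto intro: npos_add)

lemma npos_scaleR:
  assumes "npos h" "r \<ge> 0" shows "npos (r *\<^sub>R h)"
proof -
  from assms obtain t where t: "t \<ge> 0" "norm (t *\<^sub>R 1 - h) \<le> t"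
    by (auto simp: npos_def)
  have "norm ((r * t) *\<^sub>R 1 - r *\<^sub>R h) = r * norm (t *\<^sub>R 1 - h)"
    using assms(2) by (simp add: scaleR_diff_right[symmetric] flip: scaleR_scaleR)
  then show ?thesis
    using t assms by (intro nposI[of _ "r * t"]) (auto simp: nposD mult_left_mono)
qed

text \<open>Rescaling gives \<open>h = t (1 - x)\<close> with \<open>norm x \<le> 1\<close>, to
  which the series applies. The commutation property of \<open>k\<close> takes the place of a
  functional calculus: roots of commuting elements commute.\<close>

lemma npos_sqrt:
  assumes "npos h"
  obtains k where "npos k" "k * k = h" "\<And>z. z * h = h * z \<Longrightarrow> z * k = k * z"
proof -
  from assms obtain t where t: "t \<ge> 0" "norm (t *\<^sub>R 1 - h) \<le> t" and h: "star h = h"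
    by (auto simp: npos_def)
  show ?thesis
  proof (cases "t = 0")
    case True
    then have "h = 0" using t by simp
    then show ?thesis using that[of 0] by simp
  next
    case False
    then have t0: "t > 0" using t by simp
    define x where "x = 1 - (1 / t) *\<^sub>R h"
    have "x = (1 / t) *\<^sub>R (t *\<^sub>R 1 - h)"
      using False by (simp add: x_def scaleR_diff_right)
    then have x: "norm x \<le> 1"
      using t t0 by simp
    have sx: "star x = x"
      by (simp add: x_def star_diff h)
    define k where "k = sqrt t *\<^sub>R sqrt_series x"
    show ?thesis
    proof (rule that[of k])
      have "npos (sqrt_series x)"
        by (rule nposI[of _ 1]) (auto simp: star_sqrt_series x sx norm_one_minus_sqrt_series)
      then show "npos k"
        unfolding k_def by (rule npos_scaleR) (use t in simp)
      show "k * k = h"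
        using t0 by (simp add: k_def sqrt_series_square[OF x]) (simp add: x_def)
      show "z * k = k * z" if "z * h = h * z" for z
        using sqrt_series_commute[OF x, of z] that by (simp add: k_def x_def algebra_simps)
    qed
  qed
qed

text \<open>If \<open>h\<close> and \<open>l\<close> commute, then \<open>h = Re w\<close> for the normal element \<open>w = h + i l\<close>,
  and \<open>w\<^sup>* w = \<beta>\<close>.\<close>

lemma norm_real_part_le:
  fixes h l :: "'a::cstar_type"
  assumes "star h = h" "star l = l" "h * l = l * h" "h * h + l * l = \<beta> *\<^sub>R 1" "\<beta> \<ge> 0"
  shows "norm h \<le> sqrt \<beta>"
proof -
  define w where "w = h + \<i> *\<^sub>C l"
  have sw: "star w = h - \<i> *\<^sub>C l"
    by (simp add: w_def star_add assms scaleC_minus_left)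
  have "star w * w = h * h + l * l"
    unfolding sw unfolding w_def using assms(3)
    by (simp add: algebra_simps scaleC_minus_left scaleC_add_right scaleC_diff_right)
  then have "(norm w)\<^sup>2 \<le> \<beta>"
    using assms norm_star_mult[of w] norm_scaleR_one_le[of \<beta>, where 'a='a] by simp
  then have nw: "norm w \<le> sqrt \<beta>"
    by (simp add: real_le_rsqrt)
  have "h = (1/2) *\<^sub>R (w + star w)"
    unfolding sw unfolding w_def by (simp add: scaleR_left.add[symmetric] flip: scaleR_2)
  then have "norm h \<le> (1/2) * (norm w + norm (star w))"
    using norm_triangle_ineq[of w "star w"] by simp
  then show ?thesis
    using nw by simp
qed

text \<open>\<open>l\<close> is a square root of \<open>1 - h * h\<close>, so that
  \<open>h + i l\<close> is unitary with real part \<open>h\<close>.\<close>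

lemma selfadjoint_complement:
  fixes h :: "'a::cstar_type"
  assumes "star h = h" "norm h \<le> 1"
  obtains l where "npos l" "h * h + l * l = 1" "\<And>z. z * h = h * z \<Longrightarrow> z * l = l * z"
proof -
  have "npos (1 - h * h)"
  proof (rule nposI[of _ 1])
    show "norm (1 *\<^sub>R 1 - (1 - h * h)) \<le> 1"
      using assms norm_selfadjoint_square[of h] by (simp add: power_le_one)
  qed (auto simp: star_diff star_mult assms)
  then obtain l where l: "npos l" "l * l = 1 - h * h"
      "\<And>z. z * (1 - h * h) = (1 - h * h) * z \<Longrightarrow> z * l = l * z"
    using npos_sqrt by metis
  have comm: "z * l = l * z" if "z * h = h * z" for z
  proof (rule l(3))
    have "z * (h * h) = (h * h) * z"
      using that by (metis mult.assoc)
    then show "z * (1 - h * h) = (1 - h * h) * z"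
      by (simp add: right_diff_distrib left_diff_distrib)
  qed
  have "h * h + l * l = 1"
    using l(2) by simp
  then show ?thesis
    by (rule that[OF l(1) _ comm])
qed

text \<open>Here \<open>1 - h * h\<close> is \<open>l * l\<close>, and \<open>l\<close> is bounded
  as a real part with the roles of \<open>h\<close> and \<open>l\<close> exchanged.\<close>

lemma norm_one_minus_square:
  fixes h :: "'a::cstar_type"
  assumes "star h = h" "norm h \<le> 1"
  shows "norm (1 - h * h) \<le> 1"
proof -
  obtain l where l: "npos l" "h * h + l * l = 1" "\<And>z. z * h = h * z \<Longrightarrow> z * l = l * z"
    using selfadjoint_complement[OF assms] by metis
  have "norm l \<le> sqrt 1"
    by (rule norm_real_part_le[of l h]) (use l(1,2) l(3)[of h] assms in \<open>simp_all add: nposD add.commute\<close>)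
  moreover have "1 - h * h = l * l"
    using l(2) by (simp add: algebra_simps)
  ultimately show ?thesis
    using l(1) norm_selfadjoint_square[of l] by (simp add: nposD power_le_one)
qed

lemma norm_diff_square_le:
  fixes h :: "'a::cstar_type"
  assumes "star h = h" "(norm h)\<^sup>2 \<le> t"
  shows "norm (t *\<^sub>R 1 - h * h) \<le> t"
proof (cases "t = 0")
  case False
  then have t: "t > 0" using assms(2) by (smt (verit) zero_le_power2)
  define g where "g = (1 / sqrt t) *\<^sub>R h"
  have "norm h \<le> sqrt t"
    using assms(2) by (simp add: real_le_rsqrt)
  then have "norm g \<le> 1"
    using t by (simp add: g_def)
  then have "norm (1 - g * g) \<le> 1"
    by (intro norm_one_minus_square) (auto simp: g_def assms)
  moreover have "t *\<^sub>R 1 - h * h = t *\<^sub>R (1 - g * g)"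
    using t by (simp add: g_def scaleR_diff_right)
  ultimately show ?thesis
    using t mult_left_mono[of "norm (1 - g * g)" 1 t] by simp
qed (use assms in simp)

lemma npos_square: "star h = h \<Longrightarrow> npos (h * h)"
  by (rule nposI[of _ "(norm h)\<^sup>2"]) (simp_all add: star_mult norm_diff_square_le)

text \<open>Positivity provides some \<open>t\<close>; this shows that every upper bound of the norm
  serves as \<open>t\<close>. Writing \<open>h\<close> as a square reduces it to the bound for
  squares.\<close>

lemma npos_norm_diff_le:
  assumes "npos h" "norm h \<le> t"
  shows "norm (t *\<^sub>R 1 - h) \<le> t"
proof -
  obtain k where k: "npos k" "k * k = h"
    using npos_sqrt[OF assms(1)] by metis
  show ?thesis
    using norm_diff_square_le[of k t] k assms(2) norm_selfadjoint_square[of k] by (simp add: nposD)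
qed

text \<open>A convergent sequence is eventually bounded by \<open>norm h + 1\<close>, so one
  \<open>t\<close> serves for almost all terms and survives the limit.\<close>

lemma npos_limit:
  fixes f :: "nat \<Rightarrow> 'a::cstar_type"
  assumes "\<And>n. npos (f n)" "f \<longlonglongrightarrow> h"
  shows "npos h"
proof (rule nposI[of _ "norm h + 1"])
  have "(\<lambda>n. star (f n)) \<longlonglongrightarrow> star h"
    by (rule bounded_linear.tendsto[OF bounded_linear_star assms(2)])
  then show "star h = h"
    using assms by (simp add: nposD LIMSEQ_unique)
  have "eventually (\<lambda>n. norm (f n) < norm h + 1) sequentially"
    using order_tendstoD(2)[OF tendsto_norm[OF assms(2)], of "norm h + 1"] by simp
  then have "eventually (\<lambda>n. norm ((norm h + 1) *\<^sub>R 1 - f n) \<le> norm h + 1) sequentially"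
    by eventually_elim (use assms(1) npos_norm_diff_le in \<open>auto intro: less_imp_le\<close>)
  moreover have "(\<lambda>n. norm ((norm h + 1) *\<^sub>R 1 - f n)) \<longlonglongrightarrow> norm ((norm h + 1) *\<^sub>R 1 - h)"
    by (intro tendsto_intros assms)
  ultimately show "norm ((norm h + 1) *\<^sub>R 1 - h) \<le> norm h + 1"
    using tendsto_upperbound by force
qed auto

text \<open>The square roots of \<open>y\<close> and of \<open>\<beta> - y\<close> commute and their
  squares add up to \<open>\<beta>\<close>, so the first is the real part of a normal element of
  norm at most \<open>sqrt \<beta>\<close>.\<close>

lemma npos_le_norm:
  fixes y :: "'a::cstar_type"
  assumes "npos y" "npos (\<beta> *\<^sub>R 1 - y)" "\<beta> \<ge> 0"
  shows "norm y \<le> \<beta>"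
proof -
  obtain k where k: "npos k" "k * k = y" "\<And>z. z * y = y * z \<Longrightarrow> z * k = k * z"
    using npos_sqrt[OF assms(1)] by metis
  obtain l where l: "npos l" "l * l = \<beta> *\<^sub>R 1 - y"
      "\<And>z. z * (\<beta> *\<^sub>R 1 - y) = (\<beta> *\<^sub>R 1 - y) * z \<Longrightarrow> z * l = l * z"
    using npos_sqrt[OF assms(2)] by metis
  have "k * l = l * k"
    by (rule l(3)) (simp add: algebra_simps k(2)[symmetric] mult.assoc)
  then have "norm k \<le> sqrt \<beta>"
    using k(1,2) l(1,2) assms(3) by (intro norm_real_part_le[of k l]) (simp_all add: nposD)
  moreover have "norm y = (norm k)\<^sup>2"
    using k(1,2) norm_selfadjoint_square[of k] by (simp add: nposD)
  ultimately show ?thesis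
    using assms(3) power_mono[of "norm k" "sqrt \<beta>" 2] by simp
qed

lemma npos_antisym:
  assumes "npos y" "npos (- y)" shows "y = 0"
  using npos_le_norm[of y 0] assms by simp

text \<open>The powers of \<open>\<beta> - c\<^sup>* c\<close> are controlled by those of \<open>\<beta> - c c\<^sup>*\<close>,
  which replaces the comparison of the spectra of \<open>c\<^sup>* c\<close> and \<open>c c\<^sup>*\<close>.\<close>

lemma norm_power_diff_swap:
  fixes c :: "'a::cstar_type"
  defines "e \<equiv> (norm c)\<^sup>2 *\<^sub>R 1 - star c * c" and "f \<equiv> (norm c)\<^sup>2 *\<^sub>R 1 - c * star c"
  assumes f: "norm f \<le> (norm c)\<^sup>2"
  shows "norm (e ^ n) \<le> (real n + 1) * (norm c)\<^sup>2 ^ n"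
proof -
  define \<beta> where "\<beta> = (norm c)\<^sup>2"
  have \<beta>: "\<beta> \<ge> 0" by (simp add: \<beta>_def)
  have ec: "e * star c = star c * f"
    by (simp add: e_def f_def algebra_simps)
  have e_pow: "e ^ n * star c = star c * f ^ n" for n
  proof (induction n)
    case (Suc n)
    have "e ^ Suc n * star c = e * (e ^ n * star c)"
      by (simp add: mult.assoc)
    also have "\<dots> = (e * star c) * f ^ n"
      by (simp add: Suc mult.assoc)
    also have "\<dots> = star c * f ^ Suc n"
      by (simp add: ec mult.assoc)
    finally show ?case .
  qed simp
  \<comment> \<open>Explicitly, \<open>g\<close> is the sum of
    \<open>\<beta> ^ (n - 1 - i) *\<^sub>R f ^ i\<close> over \<open>i < n\<close>. Its bound is
    multiplied by \<open>\<beta>\<close> to avoid the exponent \<open>n - 1\<close>.\<close>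
  have "\<exists>g. e ^ n = \<beta> ^ n *\<^sub>R 1 - star c * g * c \<and> \<beta> * norm g \<le> real n * \<beta> ^ n"
  proof (induction n)
    case 0
    show ?case by (rule exI[of _ 0]) simp
  next
    case (Suc n)
    then obtain g where g: "e ^ n = \<beta> ^ n *\<^sub>R 1 - star c * g * c" "\<beta> * norm g \<le> real n * \<beta> ^ n"
      by blast
    have "e ^ Suc n = e ^ n * e"
      by (simp add: power_commutes)
    also have "\<dots> = \<beta> *\<^sub>R e ^ n - e ^ n * star c * c"
      by (simp add: e_def \<beta>_def algebra_simps)
    also have "\<dots> = \<beta> ^ Suc n *\<^sub>R 1 - star c * (\<beta> *\<^sub>R g + f ^ n) * c"
      by (simp add: e_pow) (simp add: g algebra_simps)
    finally have 1: "e ^ Suc n = \<beta> ^ Suc n *\<^sub>R 1 - star c * (\<beta> *\<^sub>R g + f ^ n) * c" .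
    have "norm (\<beta> *\<^sub>R g + f ^ n) \<le> \<beta> * norm g + norm (f ^ n)"
      using norm_triangle_ineq[of "\<beta> *\<^sub>R g" "f ^ n"] \<beta> by simp
    moreover have "norm (f ^ n) \<le> \<beta> ^ n"
      using norm_power_le'[of f n] power_mono[OF f, of n] by (simp add: \<beta>_def)
    ultimately have "norm (\<beta> *\<^sub>R g + f ^ n) \<le> real (Suc n) * \<beta> ^ n"
      using g(2) by (simp add: algebra_simps)
    then have "\<beta> * norm (\<beta> *\<^sub>R g + f ^ n) \<le> \<beta> * (real (Suc n) * \<beta> ^ n)"
      using \<beta> by (rule mult_left_mono)
    then have "\<beta> * norm (\<beta> *\<^sub>R g + f ^ n) \<le> real (Suc n) * \<beta> ^ Suc n"
      by (simp add: mult_ac)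
    with 1 show ?case by blast
  qed
  then obtain g where g: "e ^ n = \<beta> ^ n *\<^sub>R 1 - star c * g * c" "\<beta> * norm g \<le> real n * \<beta> ^ n"
    by blast
  have "norm (star c * g * c) \<le> norm (star c) * norm g * norm c"
    by (meson mult_right_mono norm_ge_zero norm_mult_ineq order_trans)
  also have "\<dots> = \<beta> * norm g"
    by (simp add: \<beta>_def power2_eq_square)
  finally have "norm (star c * g * c) \<le> real n * \<beta> ^ n"
    using g(2) by linarith
  moreover have "norm (\<beta> ^ n *\<^sub>R (1::'a)) \<le> \<beta> ^ n"
    using norm_scaleR_one_le[of "\<beta> ^ n", where 'a='a] \<beta> by simp
  ultimately have "norm (e ^ n) \<le> \<beta> ^ n + real n * \<beta> ^ n"
    unfolding g(1) using norm_triangle_ineq4[of "\<beta> ^ n *\<^sub>R 1" "star c * g * c"] by linarith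
  then show ?thesis
    by (simp add: \<beta>_def algebra_simps)
qed

text \<open>Otherwise \<open>(a / \<beta>) ^ n\<close> would outgrow the linear factor. Exponents
  are restricted to powers of two because only for these does a self-adjoint power have the expected
  norm.\<close>

lemma le_of_power_le_linear_times_power:
  fixes a \<beta> :: real
  assumes "\<And>k. a ^ (2 ^ k) \<le> (real (2 ^ k) + 1) * \<beta> ^ (2 ^ k)" "\<beta> > 0"
  shows "a \<le> \<beta>"
proof (rule ccontr)
  assume "\<not> a \<le> \<beta>"
  define q where "q = a / \<beta>"
  have q: "q > 1"
    using \<open>\<not> a \<le> \<beta>\<close> assms(2) by (simp add: q_def)
  have "(\<lambda>n. real n / q ^ n + 1 / q ^ n) \<longlonglongrightarrow> 0 + 0"
    using q by (intro tendsto_add lim_n_over_pown LIMSEQ_inverse_realpow_zero[THEN tendsto_eq_rhs]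
        tendsto_intros) (auto simp: inverse_eq_divide intro: LIMSEQ_inverse_realpow_zero[unfolded inverse_eq_divide])
  then have "eventually (\<lambda>n. real n / q ^ n + 1 / q ^ n < 1) sequentially"
    by (intro order_tendstoD(2)[of _ "0 + 0"]) auto
  then obtain M where M: "\<And>n. n \<ge> M \<Longrightarrow> real n / q ^ n + 1 / q ^ n < 1"
    by (auto simp: eventually_sequentially)
  have "M \<le> 2 ^ M"
    by (simp add: less_imp_le)
  then have "(real (2 ^ M) + 1) / q ^ (2 ^ M) < 1"
    using M[of "2 ^ M"] by (simp add: add_divide_distrib)
  then have "real (2 ^ M) + 1 < q ^ (2 ^ M)"
    using q by (simp add: divide_less_eq)
  moreover have "q ^ (2 ^ M) \<le> real (2 ^ M) + 1"
    using assms(1)[of M] assms(2) by (simp add: q_def power_divide divide_le_eq)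
  ultimately show False by linarith
qed

text \<open>With \<open>x\<close> and \<open>y\<close> twice the real and imaginary parts of
  \<open>c\<close>, \<open>x * x + y * y\<close> is twice \<open>c * star c + star c * c\<close>, so
  negativity of \<open>star c * c\<close> makes \<open>c * star c\<close> positive. The swap
  estimate carries this back: \<open>star c * c\<close> is positive as well as negative, hence
  0.\<close>

lemma eq_zero_of_npos_uminus_star_mult:
  fixes c :: "'a::cstar_type"
  assumes "npos (- (star c * c))"
  shows "c = 0"
proof (cases "c = 0")
  case False
  define \<beta> where "\<beta> = (norm c)\<^sup>2"
  have \<beta>: "\<beta> > 0"
    using False by (simp add: \<beta>_def)
  define x y where "x = c + star c" and "y = \<i> *\<^sub>C (star c - c)"
  have "npos (x * x)" "npos (y * y)"
    by (auto intro!: npos_square simp: x_def y_def star_add star_diff scaleC_diff_right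
        scaleC_minus_left)
  moreover have "c * star c = (1/2) *\<^sub>R (x * x + y * y) + (- (star c * c))"
  proof -
    have "x * x + y * y = 2 *\<^sub>R (c * star c) + 2 *\<^sub>R (star c * c)"
      by (simp add: x_def y_def scaleC_minus_left scaleC_diff_right algebra_simps scaleR_2)
    then show ?thesis by (simp add: scaleR_add_right)
  qed
  ultimately have "npos (c * star c)"
    by (metis assms npos_add npos_scaleR zero_le_divide_1_iff zero_le_numeral)
  then have "norm (\<beta> *\<^sub>R 1 - c * star c) \<le> \<beta>"
    by (rule npos_norm_diff_le) (simp add: \<beta>_def norm_mult_star)
  then have pow: "norm ((\<beta> *\<^sub>R 1 - star c * c) ^ n) \<le> (real n + 1) * \<beta> ^ n" for n
    unfolding \<beta>_def by (rule norm_power_diff_swap)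
  have sa: "star (\<beta> *\<^sub>R 1 - star c * c) = \<beta> *\<^sub>R 1 - star c * c"
    by (simp add: star_diff star_mult)
  have "norm (\<beta> *\<^sub>R 1 - star c * c) \<le> \<beta>"
    by (rule le_of_power_le_linear_times_power[OF _ \<beta>])
       (use pow[of "2 ^ k" for k] in \<open>simp add: power_selfadjoint_norm[OF sa]\<close>)
  then have "npos (star c * c)"
    using \<beta> by (intro nposI[of _ \<beta>]) (auto simp: star_mult)
  then have "star c * c = 0"
    using assms by (rule npos_antisym)
  then show ?thesis
    using norm_star_mult[of c] by simp
qed

text \<open>With \<open>b = a\<^sup>* a\<close> and \<open>n = |b| - b\<close>, twice the negative part of \<open>b\<close>, the element
  \<open>(a n)\<^sup>* (a n) = n b n\<close> is negative, so \<open>a n = 0\<close> and then \<open>n = 0\<close>.\<close>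

lemma npos_star_mult: "npos (star a * (a::'a::cstar_type))"
proof -
  define b where "b = star a * a"
  have sb: "star b = b" by (simp add: b_def star_mult)
  obtain m where m: "npos m" "m * m = b * b" "\<And>z. z * (b * b) = (b * b) * z \<Longrightarrow> z * m = m * z"
    using npos_sqrt[OF npos_square[OF sb]] by metis
  have bm: "b * m = m * b"
    by (rule m(3)) (simp add: mult.assoc)
  \<comment> \<open>\<open>m\<close> is the absolute value of \<open>b\<close>; its root
    \<open>r\<close> exhibits \<open>n * (m * n)\<close> as the square of the self-adjoint element
    \<open>r * n\<close>.\<close>
  obtain r where r: "npos r" "r * r = m" "\<And>z. z * m = m * z \<Longrightarrow> z * r = r * z"
    using npos_sqrt[OF m(1)] by metis
  define n where "n = m - b"
  have sn: "star n = n"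
    using m(1) sb by (simp add: n_def star_diff nposD)
  have nr: "n * r = r * n"
    by (rule r(3)) (simp add: n_def algebra_simps bm)
  have bn: "b * n = - (m * n)"
    by (simp add: n_def algebra_simps m(2) bm)
  define k where "k = r * n"
  have sk: "star k = k"
    using r(1) sn nr by (simp add: k_def star_mult nposD)
  have nmn: "n * (m * n) = k * k"
    unfolding k_def r(2)[symmetric] by (metis nr mult.assoc)
  have "star (a * n) * (a * n) = n * (b * n)"
    by (simp add: star_mult sn b_def mult.assoc)
  also have "\<dots> = - (k * k)"
    by (simp add: bn nmn)
  finally have c: "star (a * n) * (a * n) = - (k * k)" .
  have "npos (- (star (a * n) * (a * n)))"
    unfolding c using npos_square[OF sk] by simp
  then have "a * n = 0"
    by (rule eq_zero_of_npos_uminus_star_mult)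
  then have kk: "k * k = 0" using c by simp
  have "n * n = 2 *\<^sub>R (m * n)"
    by (simp add: n_def algebra_simps m(2) bm scaleR_2)
  then have "n * (n * n) = 0"
    using nmn kk by simp
  \<comment> \<open>The vanishing cube is padded to a power of two, to which
    \<open>power_selfadjoint_norm\<close> applies.\<close>
  then have "n ^ (2 ^ 2) = 0"
    by (simp add: numeral_eq_Suc)
  then have "n = 0"
    using power_selfadjoint_norm[OF sn, of 2] by simp
  then have "b = m" by (simp add: n_def)
  then show ?thesis using m(1) by (simp add: b_def)
qed

lemma npos_iff: "npos h \<longleftrightarrow> (\<exists>a. h = star a * (a::'a::cstar_type))"
  by (metis npos_sqrt nposD npos_star_mult)

text \<open>For \<open>norm x \<le> 1\<close> the element \<open>1 - star x * x\<close> has the form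
  \<open>star y * y\<close>, a statement that \<open>\<phi>\<close> preserves. This is the source of
  the continuity of the gauge action.\<close>

lemma star_hom_contractive:
  fixes \<phi> :: "'a::cstar_type \<Rightarrow> 'b::cstar_type"
  assumes add: "\<And>x y. \<phi> (x + y) = \<phi> x + \<phi> y"
    and mult: "\<And>x y. \<phi> (x * y) = \<phi> x * \<phi> y"
    and scale: "\<And>c x. \<phi> (c *\<^sub>C x) = c *\<^sub>C \<phi> x"
    and star: "\<And>x. \<phi> (star x) = star (\<phi> x)"
    and one: "\<phi> 1 = 1"
  shows "norm (\<phi> x) \<le> norm x"
proof -
  have le1: "norm (\<phi> x) \<le> 1" if x: "norm x \<le> 1" for x
  proof -
    have "npos (1 - star x * x)"
      by (rule nposI[of _ 1]) (use x in \<open>auto simp: star_diff star_mult norm_star_mult power_le_one\<close>)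
    then obtain y where "1 - star x * x = star y * y"
      by (auto simp: npos_iff)
    then have "1 = star x * x + star y * y"
      by (simp add: algebra_simps)
    then have "1 = \<phi> (star x * x + star y * y)"
      using one by simp
    then have 1: "1 *\<^sub>R 1 - star (\<phi> x) * \<phi> x = star (\<phi> y) * \<phi> y"
      by (simp add: add mult star algebra_simps)
    have "norm (star (\<phi> x) * \<phi> x) \<le> 1"
      by (rule npos_le_norm) (simp_all only: npos_star_mult 1 zero_le_one)
    then show ?thesis
      by (simp add: norm_star_mult abs_square_le_1)
  qed
  show ?thesis
  proof (cases "x = 0")
    case True
    then show ?thesis using scale[of 0 0] by simp
  next
    case False
    have "\<phi> x = norm x *\<^sub>R \<phi> ((1 / norm x) *\<^sub>R x)"
      using False by (simp add: scaleR_scaleC scale)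
    moreover have "norm (\<phi> ((1 / norm x) *\<^sub>R x)) \<le> 1"
      by (rule le1) (use False in simp)
    ultimately show ?thesis
      using mult_left_mono[of "norm (\<phi> ((1 / norm x) *\<^sub>R x))" 1 "norm x"] by simp
  qed
qed

section \<open>Unitary representations of the integers\<close>

definition unity_root :: "nat \<Rightarrow> int \<Rightarrow> complex" where
  "unity_root N j = cis (2 * pi * real_of_int j / real N)"

lemma cmod_unity_root [simp]: "cmod (unity_root N j) = 1"
  by (simp add: unity_root_def)

lemma unity_root_0 [simp]: "unity_root N 0 = 1"
  by (simp add: unity_root_def)

lemma unity_root_add: "unity_root N (i + j) = unity_root N i * unity_root N j"
  by (simp add: unity_root_def cis_mult add_divide_distrib distrib_left)

lemma cnj_unity_root: "cnj (unity_root N j) = unity_root N (- j)"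
  by (simp add: unity_root_def cis_cnj)

lemma unity_root_mult_nat: "unity_root N (int i * j) = unity_root N j ^ i"
  by (induction i) (auto simp: unity_root_add distrib_right)

lemma unity_root_mult_int: "unity_root N (i * j) = unity_root N j powi i"
proof (cases "i \<ge> 0")
  case True
  then show ?thesis
    using unity_root_mult_nat[of N "nat i" j] by (simp add: power_int_def)
next
  case False
  have "unity_root N (i * j) = cnj (unity_root N (int (nat (- i)) * j))"
    using False by (simp add: cnj_unity_root)
  also have "\<dots> = cnj (unity_root N j) ^ nat (- i)"
    by (subst unity_root_mult_nat) simp
  also have "cnj (unity_root N j) = inverse (unity_root N j)"
    by (simp add: unity_root_def cis_cnj)
  finally show ?thesis
    using False by (simp add: power_int_def)
qed

lemma unity_root_eq_1_iff:
  assumes "N > 0" shows "unity_root N j = 1 \<longleftrightarrow> int N dvd j"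
proof
  assume "unity_root N j = 1"
  then have "cos (2 * pi * real_of_int j / real N) = 1"
    by (simp add: unity_root_def complex_eq_iff)
  then obtain n :: int where "2 * pi * real_of_int j / real N = real_of_int n * 2 * pi"
    by (auto simp: cos_one_2pi_int)
  then have "real_of_int j = real_of_int (n * int N)"
    using assms by (simp add: field_simps)
  then show "int N dvd j"
    by (simp only: of_int_eq_iff) simp
next
  assume "int N dvd j"
  then obtain k where "j = int N * k" by auto
  then show "unity_root N j = 1"
    using assms cis_multiple_2pi[of "real_of_int k"] by (simp add: unity_root_def mult_ac)
qed

lemma sum_unity_root:
  assumes "N > 0"
  shows "(\<Sum>j<N. unity_root N (int j * d)) = (if int N dvd d then of_nat N else 0)"
proof -
  have "unity_root N d ^ N = 1"
    using assms by (simp add: unity_root_eq_1_iff flip: unity_root_mult_nat)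
  then show ?thesis
    using unity_root_eq_1_iff[OF assms, of d]
    by (simp add: unity_root_mult_nat sum_gp_strict)
qed

text \<open>After adding \<open>M\<close> the sum lies between 0 and \<open>2 * M\<close>, so its
  norm is at most \<open>2 * M\<close>; taking \<open>M\<close> away costs another \<open>M\<close>.
  The size of the constant is immaterial later.\<close>

lemma norm_sum_npos_le:
  fixes Q :: "'i \<Rightarrow> 'a::cstar_type"
  assumes Q: "\<And>i. i \<in> I \<Longrightarrow> npos (Q i)" "(\<Sum>i\<in>I. Q i) = 1"
    and r: "\<And>i. i \<in> I \<Longrightarrow> \<bar>r i\<bar> \<le> M" and "M \<ge> 0"
  shows "norm (\<Sum>i\<in>I. r i *\<^sub>R Q i) \<le> 3 * M"
proof -
  let ?y = "\<Sum>i\<in>I. r i *\<^sub>R Q i"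
  have r': "0 \<le> M + r i" "0 \<le> M - r i" if "i \<in> I" for i
    using r[OF that] by linarith+
  have M1: "M *\<^sub>R 1 = (\<Sum>i\<in>I. M *\<^sub>R Q i)"
    by (simp add: Q(2) flip: scaleR_sum_right)
  have "npos (\<Sum>i\<in>I. (M + r i) *\<^sub>R Q i)"
    by (intro npos_sum npos_scaleR Q r')
  also have "(\<Sum>i\<in>I. (M + r i) *\<^sub>R Q i) = ?y + M *\<^sub>R 1"
    by (simp add: M1 scaleR_add_left sum.distrib)
  finally have 1: "npos (?y + M *\<^sub>R 1)" .
  have "npos (\<Sum>i\<in>I. (M - r i) *\<^sub>R Q i)"
    by (intro npos_sum npos_scaleR Q r')
  also have "(\<Sum>i\<in>I. (M - r i) *\<^sub>R Q i) = (2 * M) *\<^sub>R 1 - (?y + M *\<^sub>R 1)"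
    unfolding mult_2 scaleR_add_left by (simp add: M1 scaleR_diff_left sum_subtractf)
  finally have "norm (?y + M *\<^sub>R 1) \<le> 2 * M"
    using 1 assms(4) by (intro npos_le_norm) auto
  then show ?thesis
    using norm_triangle_ineq4[of "?y + M *\<^sub>R 1" "M *\<^sub>R 1"] assms(4)
      norm_scaleR_one_le[of M, where 'a='a] by simp
qed

lemma norm_sum_npos_le_complex:
  fixes Q :: "'i \<Rightarrow> 'a::cstar_type"
  assumes Q: "\<And>i. i \<in> I \<Longrightarrow> npos (Q i)" "(\<Sum>i\<in>I. Q i) = 1"
    and z: "\<And>i. i \<in> I \<Longrightarrow> cmod (z i) \<le> M" and "M \<ge> 0"
  shows "norm (\<Sum>i\<in>I. z i *\<^sub>C Q i) \<le> 6 * M"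
proof -
  have "(\<Sum>i\<in>I. z i *\<^sub>C Q i) = (\<Sum>i\<in>I. Re (z i) *\<^sub>R Q i) + \<i> *\<^sub>C (\<Sum>i\<in>I. Im (z i) *\<^sub>R Q i)"
    by (simp add: scaleC_sum_right scaleR_scaleC flip: sum.distrib scaleC_add_left complex_eq)
  moreover have "norm (\<Sum>i\<in>I. Re (z i) *\<^sub>R Q i) \<le> 3 * M"
    by (rule norm_sum_npos_le[OF Q]) (use z assms(4) abs_Re_le_cmod order_trans in blast)+
  moreover have "norm (\<Sum>i\<in>I. Im (z i) *\<^sub>R Q i) \<le> 3 * M"
    by (rule norm_sum_npos_le[OF Q]) (use z assms(4) abs_Im_le_cmod order_trans in blast)+
  ultimately show ?thesis
    using norm_triangle_ineq[of "\<Sum>i\<in>I. Re (z i) *\<^sub>R Q i" "\<i> *\<^sub>C (\<Sum>i\<in>I. Im (z i) *\<^sub>R Q i)"]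
    by simp
qed

locale int_unitary_rep =
  fixes V :: "int \<Rightarrow> 'a::cstar_type"
  assumes V_0: "V 0 = 1"
    and V_add: "V (g + h) = V g * V h"
    and star_V: "star (V g) = V (- g)"
begin

lemma norm_V_le: "norm (V g) \<le> 1"
  by (rule norm_isometry_le) (simp add: star_V V_0 flip: V_add)

text \<open>The positive elements \<open>P\<^sub>j\<^sup>* P\<^sub>j\<close> sum to 1 and act as approximate spectral projections of
  \<open>V 1\<close> near the \<open>N\<close>-th roots of unity (a Fejer kernel).\<close>

definition P :: "nat \<Rightarrow> nat \<Rightarrow> 'a" where
  "P N j = (1 / real N) *\<^sub>R (\<Sum>i<N. unity_root N (- (int j * int i)) *\<^sub>C V (int i))"

lemma star_P_mult_P:
  "star (P N j) * P N j = 
     (1 / real N)\<^sup>2 *\<^sub>R (\<Sum>i<N. \<Sum>i'<N. unity_root N (int j * (int i - int i')) *\<^sub>C V (int i' - int i))"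
proof -
  have "star (P N j) * P N j = (1 / real N)\<^sup>2 *\<^sub>R
     (\<Sum>i<N. \<Sum>i'<N. (unity_root N (int j * int i) *\<^sub>C V (- int i)) *
        (unity_root N (- (int j * int i')) *\<^sub>C V (int i')))"
    by (simp add: P_def star_sum star_V cnj_unity_root sum_product power2_eq_square)
  then show ?thesis
    by (simp add: V_add[symmetric] unity_root_add[symmetric] algebra_simps)
qed

text \<open>Orthogonality of characters keeps, for each \<open>i\<close>, the single index
  \<open>i'\<close> congruent to \<open>i + d\<close> modulo \<open>N\<close>. A summand is exactly
  \<open>V d\<close> unless \<open>i + d\<close> wraps around.\<close>

lemma sum_P:
  assumes "N > 0"
  shows "(\<Sum>j<N. unity_root N (int j * d) *\<^sub>C (star (P N j) * P N j)) =
    (1 / real N) *\<^sub>R (\<Sum>i<N. V ((int i + d) mod int N - int i))"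
proof -
  have inner: "(\<Sum>j<N. unity_root N (int j * d) *\<^sub>C unity_root N (int j * (int i - int i')) *\<^sub>C V (int i' - int i))
      = (if int N dvd d + int i - int i' then real N *\<^sub>R V (int i' - int i) else 0)" for i i'
  proof -
    have "(\<Sum>j<N. unity_root N (int j * d) *\<^sub>C unity_root N (int j * (int i - int i')) *\<^sub>C V (int i' - int i))
      = (\<Sum>j<N. unity_root N (int j * (d + int i - int i'))) *\<^sub>C V (int i' - int i)"
      unfolding scaleC_sum_left
      by (intro sum.cong refl) (simp flip: unity_root_add, simp add: algebra_simps)
    then show ?thesis
      by (simp add: sum_unity_root[OF assms] scaleR_scaleC)
  qed
  have pick: "(\<Sum>i'<N. if int N dvd d + int i - int i' then real N *\<^sub>R V (int i' - int i) else 0)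
      = real N *\<^sub>R V ((int i + d) mod int N - int i)" for i
  proof -
    let ?k = "nat ((int i + d) mod int N)"
    have k: "int ?k = (int i + d) mod int N" "?k < N"
      using assms by (auto simp: nat_less_iff)
    have "int N dvd d + int i - int i' \<longleftrightarrow> i' = ?k" if "i' < N" for i'
    proof -
      have "int N dvd d + int i - int i' \<longleftrightarrow> (int i + d) mod int N = int i' mod int N"
        by (simp add: mod_eq_dvd_iff add.commute)
      then show ?thesis
        using that k by (auto simp: mod_pos_pos_trivial)
    qed
    then have "(\<Sum>i'<N. if int N dvd d + int i - int i' then real N *\<^sub>R V (int i' - int i) else 0)
       = (\<Sum>i'<N. if i' = ?k then real N *\<^sub>R V (int i' - int i) else 0)"
      by (intro sum.cong) auto
    also have "\<dots> = real N *\<^sub>R V (int ?k - int i)"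
      using k(2) by simp
    finally show ?thesis
      by (simp only: k)
  qed
  have "(\<Sum>j<N. unity_root N (int j * d) *\<^sub>C (star (P N j) * P N j)) =
     (1 / real N)\<^sup>2 *\<^sub>R (\<Sum>j<N. \<Sum>i<N. \<Sum>i'<N. unity_root N (int j * d) *\<^sub>C
        unity_root N (int j * (int i - int i')) *\<^sub>C V (int i' - int i))"
    unfolding star_P_mult_P scaleR_sum_right scaleC_sum_right scaleR_scaleC
    by (simp only: scaleC_scaleC mult_ac)
  also have "(\<Sum>j<N. \<Sum>i<N. \<Sum>i'<N. unity_root N (int j * d) *\<^sub>C
        unity_root N (int j * (int i - int i')) *\<^sub>C V (int i' - int i)) =
      (\<Sum>i<N. \<Sum>i'<N. \<Sum>j<N. unity_root N (int j * d) *\<^sub>C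
        unity_root N (int j * (int i - int i')) *\<^sub>C V (int i' - int i))"
    by (subst sum.swap) (intro sum.cong refl sum.swap)
  also have "\<dots> = real N *\<^sub>R (\<Sum>i<N. V ((int i + d) mod int N - int i))"
    by (simp only: inner pick scaleR_sum_right)
  finally show ?thesis
    using assms by (simp add: power2_eq_square)
qed

lemma sum_P_approx:
  assumes "N > 0"
  shows "norm (V d - (\<Sum>j<N. unity_root N (int j * d) *\<^sub>C (star (P N j) * P N j)))
    \<le> 2 * real_of_int \<bar>d\<bar> / real N"
proof -
  let ?w = "\<lambda>i. (int i + d) mod int N - int i"
  \<comment> \<open>The indices at which \<open>i + d\<close> wraps around modulo \<open>N\<close>:
    at most \<open>\<bar>d\<bar>\<close> of them, each with an error of norm at most 2.\<close>
  define B where "B = {i. i < N \<and> \<not> (0 \<le> int i + d \<and> int i + d < int N)}"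
  have fin: "finite B" by (simp add: B_def)
  have "B \<subseteq> (if d \<ge> 0 then {nat (int N - d)..<N} else {..<nat (- d)})"
    by (auto simp: B_def)
  then have "card B \<le> card (if d \<ge> 0 then {nat (int N - d)..<N} else {..<nat (- d)})"
    by (intro card_mono) auto
  then have card: "real (card B) \<le> real_of_int \<bar>d\<bar>"
    by (auto split: if_splits)
  have "V d - (\<Sum>j<N. unity_root N (int j * d) *\<^sub>C (star (P N j) * P N j)) =
      (1 / real N) *\<^sub>R (\<Sum>i<N. V d - V (?w i))"
    using assms by (simp add: sum_P sum_subtractf scaleR_diff_right sum_constant_scaleR)
  also have "(\<Sum>i<N. V d - V (?w i)) = (\<Sum>i\<in>B. V d - V (?w i))"
    by (rule sum.mono_neutral_right) (auto simp: B_def mod_pos_pos_trivial)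
  finally have eq: "V d - (\<Sum>j<N. unity_root N (int j * d) *\<^sub>C (star (P N j) * P N j)) =
      (1 / real N) *\<^sub>R (\<Sum>i\<in>B. V d - V (?w i))" .
  have "norm (\<Sum>i\<in>B. V d - V (?w i)) \<le> (\<Sum>i\<in>B. 2)"
  proof (rule order_trans[OF norm_sum sum_mono])
    fix i
    show "norm (V d - V (?w i)) \<le> 2"
      using norm_triangle_ineq4[of "V d" "V (?w i)"] norm_V_le[of d] norm_V_le[of "?w i"] by linarith
  qed
  also have "\<dots> \<le> 2 * real_of_int \<bar>d\<bar>"
    using card by simp
  finally show ?thesis
    unfolding eq by (simp add: divide_right_mono)
qed

text \<open>Replacing each \<open>V d\<close> by its approximation turns the sum into a combination
  of the \<open>Q j\<close>, positive with sum 1, whose coefficients are the values at the roots of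
  unity. The factor 6 comes from \<open>norm_sum_npos_le_complex\<close>; the last term is the
  approximation error and disappears for large \<open>N\<close>.\<close>

lemma norm_le_max_at_roots:
  assumes "N > 0" "finite D"
    and M: "\<And>j. j < N \<Longrightarrow> cmod (\<Sum>d\<in>D. c d * unity_root N (int j * d)) \<le> M"
  shows "norm (\<Sum>d\<in>D. c d *\<^sub>C V d) \<le> 6 * M + (\<Sum>d\<in>D. cmod (c d) * (2 * real_of_int \<bar>d\<bar>)) / real N"
proof -
  define Q where "Q j = star (P N j) * P N j" for j
  define z where "z j = (\<Sum>d\<in>D. c d * unity_root N (int j * d))" for j
  have M0: "M \<ge> 0"
    using M[of 0] assms(1) norm_ge_zero order_trans by blast
  have "(\<Sum>j<N. Q j) = 1"
    using sum_P[OF assms(1), of 0] assms(1) by (simp add: Q_def V_0 sum_constant_scaleR)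
  then have 1: "norm (\<Sum>j<N. z j *\<^sub>C Q j) \<le> 6 * M"
    by (intro norm_sum_npos_le_complex) (auto simp: Q_def npos_star_mult z_def M M0)
  have "(\<Sum>d\<in>D. c d *\<^sub>C V d) - (\<Sum>j<N. z j *\<^sub>C Q j)
      = (\<Sum>d\<in>D. c d *\<^sub>C (V d - (\<Sum>j<N. unity_root N (int j * d) *\<^sub>C Q j)))"
    unfolding z_def scaleC_sum_left
    by (subst sum.swap) (simp add: scaleC_diff_right scaleC_sum_right sum_subtractf)
  also have "norm \<dots> \<le> (\<Sum>d\<in>D. cmod (c d) * (2 * real_of_int \<bar>d\<bar> / real N))"
    by (rule order_trans[OF norm_sum sum_mono])
       (auto simp: Q_def intro!: mult_left_mono sum_P_approx[OF assms(1), simplified of_int_abs] simp del: times_divide_eq_right)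
  also have "\<dots> = (\<Sum>d\<in>D. cmod (c d) * (2 * real_of_int \<bar>d\<bar>)) / real N"
    by (simp add: sum_divide_distrib)
  finally show ?thesis
    using 1 norm_triangle_ineq[of "(\<Sum>d\<in>D. c d *\<^sub>C V d) - (\<Sum>j<N. z j *\<^sub>C Q j)" "\<Sum>j<N. z j *\<^sub>C Q j"]
    by simp
qed

end

section \<open>Closed complex subspaces\<close>

definition csubspace :: "'a::cstar_type set \<Rightarrow> bool" where
  "csubspace X \<longleftrightarrow> 0 \<in> X \<and> (\<forall>x\<in>X. \<forall>y\<in>X. x + y \<in> X) \<and> (\<forall>c. \<forall>x\<in>X. c *\<^sub>C x \<in> X)"

lemma csubspaceI:
  assumes "0 \<in> X" "\<And>x y. x \<in> X \<Longrightarrow> y \<in> X \<Longrightarrow> x + y \<in> X" "\<And>c x. x \<in> X \<Longrightarrow> c *\<^sub>C x \<in> X"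
  shows "csubspace X"
  using assms by (auto simp: csubspace_def)

lemma
  assumes "csubspace X"
  shows csubspace_0: "0 \<in> X"
    and csubspace_add: "x \<in> X \<Longrightarrow> y \<in> X \<Longrightarrow> x + y \<in> X"
    and csubspace_scaleC: "x \<in> X \<Longrightarrow> c *\<^sub>C x \<in> X"
  using assms by (auto simp: csubspace_def)

lemma csubspace_diff: "csubspace X \<Longrightarrow> x \<in> X \<Longrightarrow> y \<in> X \<Longrightarrow> x - y \<in> X"
  using csubspace_add[of X x "(- 1) *\<^sub>C y"] csubspace_scaleC[of X y "- 1"]
  by (simp add: scaleC_minus_left)

lemma csubspace_Inter: "(\<And>X. X \<in> \<X> \<Longrightarrow> csubspace X) \<Longrightarrow> csubspace (\<Inter>\<X>)"
  by (auto simp: csubspace_def)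

lemma csubspace_closure:
  assumes "csubspace X" shows "csubspace (closure X)"
proof (rule csubspaceI)
  show "0 \<in> closure X"
    using csubspace_0[OF assms] closure_subset by blast
  show "x + y \<in> closure X" if "x \<in> closure X" "y \<in> closure X" for x y
  proof -
    obtain f g where "\<And>n. f n \<in> X" "f \<longlonglongrightarrow> x" "\<And>n. g n \<in> X" "g \<longlonglongrightarrow> y"
      using \<open>x \<in> closure X\<close> \<open>y \<in> closure X\<close> unfolding closure_sequential by metis
    then show ?thesis
      unfolding closure_sequential
      by (intro exI[of _ "\<lambda>n. f n + g n"]) (auto intro: csubspace_add[OF assms] tendsto_add)
  qed
  show "c *\<^sub>C x \<in> closure X" if "x \<in> closure X" for c x
  proof -
    obtain f where "\<And>n. f n \<in> X" "f \<longlonglongrightarrow> x"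
      using \<open>x \<in> closure X\<close> unfolding closure_sequential by metis
    then show ?thesis
      unfolding closure_sequential
      by (intro exI[of _ "\<lambda>n. c *\<^sub>C f n"])
         (auto intro: csubspace_scaleC[OF assms] bounded_linear.tendsto[OF bounded_linear_scaleC])
  qed
qed

lemma csubspace_vimage:
  assumes "csubspace X" "\<And>x y. T (x + y) = T x + T y" "\<And>c x. T (c *\<^sub>C x) = c *\<^sub>C T x"
  shows "csubspace {x. T x \<in> X}"
proof -
  have "T 0 = 0" using assms(3)[of 0 0] by simp
  then show ?thesis
    using assms by (intro csubspaceI) (auto intro: csubspace_0 csubspace_add csubspace_scaleC)
qed

lemma closed_vimage_bounded_linear:
  "closed X \<Longrightarrow> bounded_linear T \<Longrightarrow> closed {x. T x \<in> X}"
  using closed_vimage[of X T] by (simp add: linear_continuous_on vimage_def)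

lemma csubspace_singleton_0: "csubspace {0}"
  by (auto simp: csubspace_def)

lemma bounded_linear_contractionI:
  fixes T :: "'a::cstar_type \<Rightarrow> 'b::cstar_type"
  assumes "\<And>x y. T (x + y) = T x + T y" "\<And>c x. T (c *\<^sub>C x) = c *\<^sub>C T x" "\<And>x. norm (T x) \<le> norm x"
  shows "bounded_linear T"
  by (rule bounded_linear_intro[where K=1]) (use assms in \<open>auto simp: scaleR_scaleC\<close>)

lemma closed_convergent_contractions:
  fixes T :: "nat \<Rightarrow> 'a::cstar_type \<Rightarrow> 'a"
  assumes T: "\<And>i x y. T i (x - y) = T i x - T i y" "\<And>i x. norm (T i x) \<le> norm x"
  shows "closed {x. convergent (\<lambda>i. T i x)}"
proof -
  have "x \<in> {x. convergent (\<lambda>i. T i x)}" if x: "x \<in> closure {x. convergent (\<lambda>i. T i x)}" for x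
  proof -
    have "Cauchy (\<lambda>i. T i x)"
    proof (rule CauchyI)
      fix e :: real assume e: "e > 0"
      then obtain y where y: "convergent (\<lambda>i. T i y)" "norm (x - y) < e / 3"
        using x[unfolded closure_approachable, rule_format, of "e / 3"]
        by (auto simp: dist_norm norm_minus_commute)
      then obtain M where M: "\<And>i j. i \<ge> M \<Longrightarrow> j \<ge> M \<Longrightarrow> norm (T i y - T j y) < e / 3"
        using CauchyD[OF convergent_Cauchy, of "\<lambda>i. T i y" "e / 3"] e by auto
      have "norm (T i x - T j x) < e" if "i \<ge> M" "j \<ge> M" for i j
      proof -
        have "T i x - T j x = T i (x - y) + (T i y - T j y) - T j (x - y)"
          by (simp add: T(1))
        then have "norm (T i x - T j x) \<le> norm (T i (x - y)) + norm (T i y - T j y) + norm (T j (x - y))"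
          using norm_triangle_ineq4[of "T i (x - y) + (T i y - T j y)" "T j (x - y)"]
            norm_triangle_ineq[of "T i (x - y)" "T i y - T j y"] by simp
        also have "\<dots> < e"
          using T(2)[of i "x - y"] T(2)[of j "x - y"] M[OF that] y(2) by linarith
        finally show ?thesis .
      qed
      then show "\<exists>M. \<forall>i\<ge>M. \<forall>j\<ge>M. norm (T i x - T j x) < e"
        by blast
    qed
    then show ?thesis
      by (simp add: Cauchy_convergent_iff)
  qed
  then show ?thesis
    by (intro closure_subset_eq[THEN iffD1] subsetI)
qed

text \<open>Divisibility by 0 means equality to 0, so the case of injective powers fits the same
  form.\<close>

lemma power_eq_power_iff_dvd:
  fixes m :: int
  assumes "m \<noteq> 0"
  shows "m ^ p = m ^ q \<longleftrightarrow> int (if m = 1 then 1 else if m = - 1 then 2 else 0) dvd int p - int q"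
proof -
  consider "m = 1" | "m = - 1" | "\<bar>m\<bar> > 1"
    using assms by linarith
  then show ?thesis
  proof cases
    case 2
    have "even (int p - int q) \<longleftrightarrow> (even p \<longleftrightarrow> even q)"
      by simp
    then show ?thesis
      using 2 by (cases "even p"; cases "even q") auto
  next
    case 3
    have "p = q" if "m ^ p = m ^ q"
    proof -
      have "\<bar>m\<bar> ^ p = \<bar>m\<bar> ^ q"
        using that by (metis power_abs)
      then show ?thesis
        using 3 by simp
    qed
    then show ?thesis
      using 3 by auto
  qed simp
qed

section \<open>The algebra generated by the relations\<close>

text \<open>For \<open>g = p = 1\<close> the last relation says that conjugation by the unitary
  \<open>S 1\<close> turns \<open>U 1\<close> into its \<open>m\<close>-th power: the
  Baumslag-Solitar relation.\<close>

locale bs_relations =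
  fixes m :: int and U :: "int \<Rightarrow> 'a::cstar_type" and S :: "nat \<Rightarrow> 'a"
  assumes U_add: "U (g + h) = U g * U h"
    and U_isometry: "star (U g) * U g = 1"
    and S_add: "S (p + q) = S p * S q"
    and S_isometry: "star (S p) * S p = 1"
    and S_coisometry: "S p * star (S p) = 1"
    and U_S: "U g * S p = S p * U (g * m ^ p)"
begin

lemma U_0: "U 0 = 1"
proof -
  have "U 0 * U 0 = U 0"
    by (simp flip: U_add)
  then show ?thesis
    by (metis U_isometry mult.assoc mult_1_left)
qed

lemma S_0: "S 0 = 1"
proof -
  have "S 0 * S 0 = S 0"
    by (simp flip: S_add)
  then show ?thesis
    by (metis S_isometry mult.assoc mult_1_left)
qed

lemma star_U: "star (U g) = U (- g)"
proof -
  have "star (U g) = star (U g) * (U g * U (- g))"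
    by (simp add: U_0 flip: U_add)
  also have "\<dots> = U (- g)"
    by (simp add: U_isometry flip: mult.assoc)
  finally show ?thesis .
qed

sublocale int_unitary_rep U
  by unfold_locales (simp_all add: U_0 U_add star_U)

section \<open>The spanning elements and their products\<close>

definition W :: "nat \<Rightarrow> int \<Rightarrow> nat \<Rightarrow> 'a" where
  "W p g q = S p * U g * star (S q)"

lemma star_W: "star (W p g q) = W q (- g) p"
  by (simp add: W_def star_mult star_U mult.assoc)

text \<open>Moving \<open>S r\<close> to the left past \<open>U (g * m ^ r)\<close> brings it next
  to its adjoint, and the two cancel. Elements with different exponents are compared by raising them
  to common ones.\<close>

lemma W_raise: "W (p + r) (g * m ^ r) (q + r) = W p g q"
proof -
  have "W (p + r) (g * m ^ r) (q + r) = S p * (S r * U (g * m ^ r)) * (star (S r) * star (S q))"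
    by (simp add: W_def S_add star_mult mult.assoc)
  also have "\<dots> = S p * U g * (S r * star (S r)) * star (S q)"
    by (simp add: U_S[symmetric] mult.assoc)
  also have "\<dots> = W p g q"
    by (simp add: W_def S_coisometry)
  finally show ?thesis .
qed

text \<open>Both factors are raised until the inner exponents agree, namely to
  \<open>q + p'\<close>; then the inner isometries cancel.\<close>

lemma W_mult: "W p g q * W p' g' q' = W (p + p') (g * m ^ p' + g' * m ^ q) (q + q')"
proof -
  have "W p g q * W p' g' q' = W (p + p') (g * m ^ p') (q + p') * W (p' + q) (g' * m ^ q) (q' + q)"
    by (simp add: W_raise)
  also have "\<dots> = S (p + p') * U (g * m ^ p') * (star (S (q + p')) * S (q + p')) * U (g' * m ^ q) * star (S (q + q'))"
    by (simp add: W_def mult.assoc add.commute)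
  also have "\<dots> = W (p + p') (g * m ^ p' + g' * m ^ q) (q + q')"
    by (simp add: W_def S_isometry U_add mult.assoc)
  finally show ?thesis .
qed

lemma W_0_0: "W 0 g 0 = U g"
  by (simp add: W_def S_0)

lemma W_S: "W p 0 0 = S p"
  by (simp add: W_def S_0 U_0)

lemma norm_S_le: "norm (S p) \<le> 1"
  by (rule norm_isometry_le) (rule S_isometry)

lemma conj_S_conj: "star (S p) * (S p * x * star (S p)) * S p = x"
  "S p * (star (S p) * x * S p) * star (S p) = x"
proof -
  have "star (S p) * (S p * x * star (S p)) * S p = (star (S p) * S p) * x * (star (S p) * S p)"
    "S p * (star (S p) * x * S p) * star (S p) = (S p * star (S p)) * x * (S p * star (S p))"
    by (simp_all only: mult.assoc)
  then show "star (S p) * (S p * x * star (S p)) * S p = x"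
    "S p * (star (S p) * x * S p) * star (S p) = x"
    by (simp_all add: S_isometry S_coisometry)
qed

lemma norm_conj_S_le: "norm (star (S p) * x * S p) \<le> norm x" "norm (S p * x * star (S p)) \<le> norm x"
proof -
  have *: "norm (a * x * b) \<le> norm x" if "norm a \<le> 1" "norm b \<le> 1" for a b x :: 'a
  proof -
    have "norm (a * x * b) \<le> norm a * norm x * norm b"
      by (meson mult_right_mono norm_ge_zero norm_mult_ineq order_trans)
    also have "\<dots> \<le> 1 * norm x * 1"
      by (intro mult_mono) (use that in auto)
    finally show ?thesis by simp
  qed
  show "norm (star (S p) * x * S p) \<le> norm x" "norm (S p * x * star (S p)) \<le> norm x"
    by (intro *; simp add: norm_S_le)+
qed

end

locale bs_gauge = bs_relations +
  fixes \<Gamma> :: "complex \<Rightarrow> 'a \<Rightarrow> 'a"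
  assumes generated: "\<lbrakk>csubspace X; closed X; \<And>x y. x \<in> X \<Longrightarrow> y \<in> X \<Longrightarrow> x * y \<in> X;
      \<And>x. x \<in> X \<Longrightarrow> star x \<in> X; range U \<subseteq> X; range S \<subseteq> X\<rbrakk> \<Longrightarrow> X = UNIV"
    and \<Gamma>_add: "cmod z = 1 \<Longrightarrow> \<Gamma> z (x + y) = \<Gamma> z x + \<Gamma> z y"
    and \<Gamma>_mult: "cmod z = 1 \<Longrightarrow> \<Gamma> z (x * y) = \<Gamma> z x * \<Gamma> z y"
    and \<Gamma>_scaleC: "cmod z = 1 \<Longrightarrow> \<Gamma> z (c *\<^sub>C x) = c *\<^sub>C \<Gamma> z x"
    and \<Gamma>_star: "cmod z = 1 \<Longrightarrow> \<Gamma> z (star x) = star (\<Gamma> z x)"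
    and \<Gamma>_W: "cmod z = 1 \<Longrightarrow> \<Gamma> z (W p g q) = (z powi (int p - int q)) *\<^sub>C W p g q"
begin

text \<open>The least closed subspace containing all \<open>W p g q\<close> is stable under
  products, first with a \<open>W\<close> on the right and then in general, and under adjoints. It
  contains the generators, so it is everything.\<close>

lemma dense_induct:
  assumes X: "csubspace X" "closed X" "\<And>p g q. W p g q \<in> X"
  shows "x \<in> X"
proof -
  define H where "H = \<Inter>{X. csubspace X \<and> closed X \<and> (\<forall>p g q. W p g q \<in> X)}"
  have H: "csubspace H" "closed H" "\<And>p g q. W p g q \<in> H"
    unfolding H_def by (auto intro: csubspace_Inter)
  have H_least: "H \<subseteq> Y" if "csubspace Y" "closed Y" "\<And>p g q. W p g q \<in> Y" for Y
    unfolding H_def using that by blast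
  have mult_W: "x * W p g q \<in> H" if "x \<in> H" for x p g q
  proof -
    have "H \<subseteq> {x. x * W p g q \<in> H}"
      by (intro H_least csubspace_vimage closed_vimage_bounded_linear H bounded_linear_mult_left)
         (simp_all add: distrib_right W_mult H)
    with that show ?thesis by blast
  qed
  have mult: "x * y \<in> H" if "x \<in> H" "y \<in> H" for x y
  proof -
    have "H \<subseteq> {y. x * y \<in> H}"
      by (intro H_least csubspace_vimage closed_vimage_bounded_linear H bounded_linear_mult_right)
         (simp_all add: distrib_left mult_W \<open>x \<in> H\<close>)
    with that show ?thesis by blast
  qed
  have star: "star x \<in> H" if "x \<in> H" for x
  proof -
    have "csubspace {x. star x \<in> H}"
      using H(1) by (intro csubspaceI) (auto simp: star_add intro: csubspace_0 csubspace_add csubspace_scaleC)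
    then have "H \<subseteq> {x. star x \<in> H}"
      by (intro H_least closed_vimage_bounded_linear H bounded_linear_star)
         (simp_all add: star_W H)
    with that show ?thesis by blast
  qed
  have "H = UNIV"
    by (rule generated[OF H(1,2) mult star])
       (use H(3) in \<open>auto simp flip: W_0_0 W_S\<close>)
  then show ?thesis
    using H_least[OF X] by blast
qed

lemma dense_eq_zero:
  assumes T: "bounded_linear T" "\<And>c x. T (c *\<^sub>C x) = c *\<^sub>C T x" and W: "\<And>p g q. T (W p g q) = 0"
  shows "T x = (0 :: 'b::cstar_type)"
proof -
  have "x \<in> {x. T x \<in> {0}}"
  proof (rule dense_induct)
    show "csubspace {x. T x \<in> {0}}"
      by (rule csubspace_vimage[OF csubspace_singleton_0 linear_add[OF bounded_linear.linear[OF T(1)]] T(2)])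
    show "closed {x. T x \<in> {0}}"
      by (rule closed_vimage_bounded_linear[OF closed_singleton T(1)])
    show "W p g q \<in> {x. T x \<in> {0}}" for p g q
      using W by simp
  qed
  then show ?thesis by simp
qed

lemma \<Gamma>_one: "cmod z = 1 \<Longrightarrow> \<Gamma> z 1 = 1"
  using \<Gamma>_W[of z 0 0 0] by (simp add: W_0_0 U_0)

lemma norm_\<Gamma>_le: "cmod z = 1 \<Longrightarrow> norm (\<Gamma> z x) \<le> norm x"
  by (rule star_hom_contractive) (auto simp: \<Gamma>_add \<Gamma>_mult \<Gamma>_scaleC \<Gamma>_star \<Gamma>_one)

lemma bounded_linear_\<Gamma>: "cmod z = 1 \<Longrightarrow> bounded_linear (\<Gamma> z)"
  by (rule bounded_linear_contractionI) (auto simp: \<Gamma>_add \<Gamma>_scaleC norm_\<Gamma>_le)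

lemma \<Gamma>_1: "\<Gamma> 1 x = x"
proof -
  have "\<Gamma> 1 x - x = 0"
    by (rule dense_eq_zero[where T="\<lambda>x. \<Gamma> 1 x - x"])
       (auto intro!: bounded_linear_sub bounded_linear_\<Gamma> bounded_linear_ident
         simp: \<Gamma>_scaleC \<Gamma>_W scaleC_diff_right)
  then show ?thesis by simp
qed

lemma npos_\<Gamma>: "cmod z = 1 \<Longrightarrow> npos x \<Longrightarrow> npos (\<Gamma> z x)"
  by (auto simp: npos_iff \<Gamma>_mult \<Gamma>_star)

text \<open>On \<open>W p g q\<close> the action multiplies by a continuous character; contractivity
  of all \<open>\<Gamma> z\<close> carries the convergence over to limits.\<close>

lemma \<Gamma>_tendsto_at_1: "((\<lambda>t. \<Gamma> (cis t) x) \<longlongrightarrow> x) (at 0)"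
proof -
  let ?X = "{x. ((\<lambda>t. \<Gamma> (cis t) x) \<longlongrightarrow> x) (at 0)}"
  have "x \<in> ?X"
  proof (rule dense_induct)
    show "csubspace ?X"
    proof (rule csubspaceI)
      show "0 \<in> ?X"
        using \<Gamma>_scaleC[of "cis t" 0 0 for t] by simp
      show "x + y \<in> ?X" if "x \<in> ?X" "y \<in> ?X" for x y
        using tendsto_add that by (auto simp: \<Gamma>_add)
      show "c *\<^sub>C x \<in> ?X" if "x \<in> ?X" for c x
        using bounded_linear.tendsto[OF bounded_linear_scaleC] that by (auto simp: \<Gamma>_scaleC)
    qed
    show "W p g q \<in> ?X" for p g q
    proof -
      let ?d = "int p - int q"
      have "((\<lambda>t. cis (of_int ?d * t)) \<longlongrightarrow> cis (of_int ?d * 0)) (at 0)"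
        by (intro tendsto_intros)
      moreover have "bounded_linear (\<lambda>c. c *\<^sub>C W p g q)"
        by (rule bounded_linear_intro[where K="norm (W p g q)"])
           (auto simp: scaleC_add_left scaleR_scaleC scaleR_conv_of_real)
      ultimately have "((\<lambda>t. cis (of_int ?d * t) *\<^sub>C W p g q) \<longlongrightarrow> cis (of_int ?d * 0) *\<^sub>C W p g q) (at 0)"
        by (rule bounded_linear.tendsto[rotated])
      then show ?thesis
        by (simp add: \<Gamma>_W cis_power_int)
    qed
    show "closed ?X"
    proof -
      have "x \<in> ?X" if x: "x \<in> closure ?X" for x
      proof -
        have "((\<lambda>t. \<Gamma> (cis t) x) \<longlongrightarrow> x) (at 0)"
        proof (rule tendstoI)
          fix e :: real assume "e > 0"
          then obtain y where y: "((\<lambda>t. \<Gamma> (cis t) y) \<longlongrightarrow> y) (at 0)" "norm (x - y) < e / 3"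
            using x[unfolded closure_approachable, rule_format, of "e / 3"]
            by (auto simp: dist_norm norm_minus_commute)
          have "eventually (\<lambda>t. dist (\<Gamma> (cis t) y) y < e / 3) (at 0)"
            using tendstoD[OF y(1), of "e / 3"] \<open>e > 0\<close> by simp
          then show "eventually (\<lambda>t. dist (\<Gamma> (cis t) x) x < e) (at 0)"
          proof eventually_elim
            case (elim t)
            have "\<Gamma> (cis t) x = \<Gamma> (cis t) (x - y) + \<Gamma> (cis t) y"
              by (simp flip: \<Gamma>_add)
            then have "\<Gamma> (cis t) x - x = \<Gamma> (cis t) (x - y) + (\<Gamma> (cis t) y - y) - (x - y)"
              by simp
            then have "norm (\<Gamma> (cis t) x - x)
                \<le> norm (\<Gamma> (cis t) (x - y)) + norm (\<Gamma> (cis t) y - y) + norm (x - y)"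
              using norm_triangle_ineq4[of "\<Gamma> (cis t) (x - y) + (\<Gamma> (cis t) y - y)" "x - y"]
                norm_triangle_ineq[of "\<Gamma> (cis t) (x - y)" "\<Gamma> (cis t) y - y"] by simp
            then show ?case
              using elim y(2) norm_\<Gamma>_le[of "cis t" "x - y"] by (simp add: dist_norm)
          qed
        qed
        then show ?thesis by simp
      qed
      then show ?thesis
        by (intro closure_subset_eq[THEN iffD1] subsetI)
    qed
  qed
  then show ?thesis by simp
qed

section \<open>Fixed points under groups of roots of unity\<close>

text \<open>For \<open>k = 0\<close> the condition \<open>z ^ k = 1\<close> always holds, so
  \<open>Fix 0\<close> consists of the fixed points of the whole circle.\<close>

definition Fix :: "nat \<Rightarrow> 'a set" where
  "Fix k = {x. \<forall>z. cmod z = 1 \<and> z ^ k = 1 \<longrightarrow> \<Gamma> z x = x}"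

lemma FixD: "x \<in> Fix k \<Longrightarrow> cmod z = 1 \<Longrightarrow> z ^ k = 1 \<Longrightarrow> \<Gamma> z x = x"
  by (simp add: Fix_def)

lemma Fix_0_subset: "Fix 0 \<subseteq> Fix k"
  by (auto simp: Fix_def)

lemma Fix_star: "x \<in> Fix k \<Longrightarrow> star x \<in> Fix k"
  by (auto simp: Fix_def \<Gamma>_star)

lemma Fix_mult: "x \<in> Fix k \<Longrightarrow> y \<in> Fix k \<Longrightarrow> x * y \<in> Fix k"
  by (auto simp: Fix_def \<Gamma>_mult)

lemma csubspace_Fix: "csubspace (Fix k)"
proof (rule csubspaceI)
  show "0 \<in> Fix k"
    using \<Gamma>_scaleC[of _ 0 0] by (simp add: Fix_def)
qed (auto simp: Fix_def \<Gamma>_add \<Gamma>_scaleC)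

lemma closed_Fix: "closed (Fix k)"
proof -
  have "closed {x. \<Gamma> z x - x \<in> {0}}" if "cmod z = 1" for z
    using that by (intro closed_vimage_bounded_linear bounded_linear_sub bounded_linear_\<Gamma>
        bounded_linear_ident) auto
  moreover have "Fix k = (\<Inter>z\<in>{z. cmod z = 1 \<and> z ^ k = 1}. {x. \<Gamma> z x - x \<in> {0}})"
    by (auto simp: Fix_def)
  ultimately show ?thesis
    by (simp only:) (intro closed_INT ballI, blast)
qed

lemma W_in_Fix:
  assumes "int k dvd int p - int q" shows "W p g q \<in> Fix k"
proof -
  obtain d where d: "int p - int q = int k * d"
    using assms by (auto simp: dvd_def)
  show ?thesis
    by (auto simp: Fix_def \<Gamma>_W d power_int_mult)
qed

lemma one_in_Fix: "1 \<in> Fix k"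
  by (auto simp: Fix_def \<Gamma>_one)

text \<open>The scalars \<open>z ^ p\<close> and \<open>cnj (z ^ p)\<close> picked up by
  \<open>S p\<close> and its adjoint cancel on the circle. This is what makes \<open>S p\<close> a
  normalizer.\<close>

lemma conj_S_in_Fix: 
  assumes "x \<in> Fix k"
  shows "S p * x * star (S p) \<in> Fix k" "star (S p) * x * S p \<in> Fix k"
proof -
  have S: "\<Gamma> z (S p) = z ^ p *\<^sub>C S p" "\<Gamma> z (star (S p)) = cnj (z ^ p) *\<^sub>C star (S p)"
    if "cmod z = 1" for z
    using \<Gamma>_W[of z p 0 0] that by (auto simp: W_S \<Gamma>_star)
  have "z ^ p * cnj (z ^ p) = 1" if "cmod z = 1" for z
    using that by (metis complex_norm_square norm_power power_one of_real_1)
  then show "S p * x * star (S p) \<in> Fix k" "star (S p) * x * S p \<in> Fix k"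
    using assms by (auto simp: Fix_def \<Gamma>_mult S mult.commute)
qed

section \<open>Averages over roots of unity\<close>

definition avg :: "nat \<Rightarrow> 'a \<Rightarrow> 'a" where
  "avg N x = (1 / real N) *\<^sub>R (\<Sum>j<N. \<Gamma> (unity_root N (int j)) x)"

lemma avg_add: "avg N (x + y) = avg N x + avg N y"
  by (simp add: avg_def \<Gamma>_add sum.distrib scaleR_add_right)

lemma avg_scaleC: "avg N (c *\<^sub>C x) = c *\<^sub>C avg N x"
  by (simp add: avg_def \<Gamma>_scaleC scaleC_sum_right scaleR_scaleC mult.commute)

lemma avg_diff: "avg N (x - y) = avg N x - avg N y"
  using avg_add[of N "x - y" y] by (simp add: algebra_simps)

lemma avg_star: "avg N (star x) = star (avg N x)"
  by (simp add: avg_def \<Gamma>_star star_sum)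

lemma norm_avg_le: 
  assumes "N > 0" shows "norm (avg N x) \<le> norm x"
proof -
  have "norm (\<Sum>j<N. \<Gamma> (unity_root N (int j)) x) \<le> (\<Sum>j<N. norm x)"
    by (rule order_trans[OF norm_sum sum_mono]) (auto intro: norm_\<Gamma>_le)
  then show ?thesis
    using assms by (simp add: avg_def divide_le_eq mult.commute)
qed

lemma avg_W:
  assumes "N > 0"
  shows "avg N (W p g q) = (if int N dvd int p - int q then W p g q else 0)"
proof -
  have "(\<Sum>j<N. \<Gamma> (unity_root N (int j)) (W p g q))
      = (\<Sum>j<N. unity_root N (int j * (int p - int q))) *\<^sub>C W p g q"
    by (simp add: \<Gamma>_W scaleC_sum_left mult.commute[of "int _" "_ - _"] flip: unity_root_mult_int)
  then show ?thesis
    using assms by (simp add: avg_def sum_unity_root scaleR_scaleC)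
qed

text \<open>For \<open>k = 0\<close> the averages run over ever larger groups of roots of unity, so that the
  limit is the average over the circle.\<close>

definition level :: "nat \<Rightarrow> nat \<Rightarrow> nat" where
  "level k i = (if k = 0 then Suc i else k)"

lemma level_pos: "level k i > 0"
  by (simp add: level_def)

definition E :: "nat \<Rightarrow> 'a \<Rightarrow> 'a" where
  "E k x = lim (\<lambda>i. avg (level k i) x)"

text \<open>For \<open>k = 0\<close> and \<open>i \<ge> p + q\<close> the level exceeds the absolute
  value of \<open>p - q\<close>, so it divides the degree only if the degree is 0.\<close>

lemma avg_level_W:
  "eventually (\<lambda>i. avg (level k i) (W p g q) = (if int k dvd int p - int q then W p g q else 0)) sequentially"
proof (cases "k = 0")
  case True
  have "int (Suc i) dvd int p - int q \<longleftrightarrow> int p - int q = 0" if "i \<ge> p + q" for i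
    using that by (auto dest!: zdvd_imp_le[of "int (Suc i)" "\<bar>int p - int q\<bar>", simplified] )
  then show ?thesis
    using True unfolding eventually_sequentially
    by (intro exI[of _ "p + q"]) (auto simp: avg_W level_def simp del: of_nat_Suc)
next
  case False
  then show ?thesis
    by (simp add: level_def avg_W)
qed

lemma avg_tendsto_E: "(\<lambda>i. avg (level k i) x) \<longlonglongrightarrow> E k x"
proof -
  let ?X = "{x. convergent (\<lambda>i. avg (level k i) x)}"
  have "x \<in> ?X"
  proof (rule dense_induct)
    show "csubspace ?X"
    proof (rule csubspaceI)
      show "0 \<in> ?X"
        using avg_scaleC[of _ 0 0] by (simp add: convergent_const)
      show "x + y \<in> ?X" if "x \<in> ?X" "y \<in> ?X" for x y
        using that convergent_add by (auto simp: avg_add)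
      show "c *\<^sub>C x \<in> ?X" if "x \<in> ?X" for c x
        using that bounded_linear.tendsto[OF bounded_linear_scaleC, of _ _ _ c]
        by (auto simp: avg_scaleC convergent_def)
    qed
    show "closed ?X"
      by (rule closed_convergent_contractions) (auto simp: avg_diff intro: norm_avg_le level_pos)
    show "W p g q \<in> ?X" for p g q
      using tendsto_eventually[OF avg_level_W, of k p g q] by (auto simp only: convergent_def mem_Collect_eq)
  qed
  then show ?thesis
    by (simp add: E_def convergent_LIMSEQ_iff)
qed

lemma E_eqI: "(\<lambda>i. avg (level k i) x) \<longlonglongrightarrow> y \<Longrightarrow> E k x = y"
  using avg_tendsto_E LIMSEQ_unique by blast

lemma E_W: "E k (W p g q) = (if int k dvd int p - int q then W p g q else 0)"
  by (rule E_eqI[OF tendsto_eventually[OF avg_level_W]])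

lemma E_add: "E k (x + y) = E k x + E k y"
  by (rule E_eqI) (simp add: avg_add tendsto_add avg_tendsto_E)

lemma E_scaleC: "E k (c *\<^sub>C x) = c *\<^sub>C E k x"
  by (rule E_eqI) (simp add: avg_scaleC bounded_linear.tendsto[OF bounded_linear_scaleC] avg_tendsto_E)

lemma E_star: "E k (star x) = star (E k x)"
  by (rule E_eqI) (simp add: avg_star bounded_linear.tendsto[OF bounded_linear_star] avg_tendsto_E)

lemma norm_E_le: "norm (E k x) \<le> norm x"
  by (rule tendsto_upperbound[OF tendsto_norm[OF avg_tendsto_E]])
     (auto intro!: always_eventually norm_avg_le level_pos)

lemma bounded_linear_E: "bounded_linear (E k)"
  by (rule bounded_linear_contractionI) (auto simp: E_add E_scaleC norm_E_le)

lemma E_diff: "E k (x - y) = E k x - E k y"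
  using E_add[of k "x - y" y] by (simp add: algebra_simps)

lemma unity_root_level_power: "unity_root (level k i) (int j) ^ k = 1"
  by (auto simp: level_def unity_root_eq_1_iff simp flip: unity_root_mult_nat)

text \<open>Every root of unity occurring in the averages satisfies \<open>z ^ k = 1\<close>, so its
  automorphism fixes \<open>b\<close>, which can be pulled out of the sum.\<close>

lemma E_bimodule:
  assumes "b \<in> Fix k"
  shows E_mult_left: "E k (b * x) = b * E k x" and E_mult_right: "E k (x * b) = E k x * b"
proof -
  have b: "\<Gamma> (unity_root (level k i) (int j)) b = b" for i j
    by (rule FixD[OF assms]) (auto simp: unity_root_level_power)
  show "E k (b * x) = b * E k x"
    by (rule E_eqI) (simp add: avg_def \<Gamma>_mult b flip: sum_distrib_left,
      use tendsto_mult[OF tendsto_const avg_tendsto_E, of b k x] in \<open>simp add: avg_def\<close>)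
  show "E k (x * b) = E k x * b"
    by (rule E_eqI) (simp add: avg_def \<Gamma>_mult b flip: sum_distrib_right,
      use tendsto_mult[OF avg_tendsto_E tendsto_const, of k x b] in \<open>simp add: avg_def\<close>)
qed

lemma E_one: "E k 1 = 1"
  using E_W[of k 0 0 0] by (simp add: W_0_0 U_0)

lemma E_Fix: "b \<in> Fix k \<Longrightarrow> E k b = b"
  using E_mult_left[of b k 1] by (simp add: E_one)

lemma E_mem:
  assumes "csubspace X" "closed X" "\<And>p g q. int k dvd int p - int q \<Longrightarrow> W p g q \<in> X"
  shows "E k x \<in> X"
proof -
  have "x \<in> {x. E k x \<in> X}"
  proof (rule dense_induct)
    show "csubspace {x. E k x \<in> X}"
      by (rule csubspace_vimage[OF assms(1) E_add E_scaleC])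
    show "closed {x. E k x \<in> X}"
      by (rule closed_vimage_bounded_linear[OF assms(2) bounded_linear_E])
  qed (use assms(3) csubspace_0[OF assms(1)] in \<open>auto simp: E_W\<close>)
  then show ?thesis by simp
qed

lemma E_in_Fix: "E k x \<in> Fix k"
  by (rule E_mem[OF csubspace_Fix closed_Fix W_in_Fix])

text \<open>Each element of \<open>Fix k\<close> is its own average, and averaging kills the
  spanning elements of other degrees; hence those of degree divisible by \<open>k\<close> are
  already dense in \<open>Fix k\<close>.\<close>

lemma Fix_subset:
  assumes "csubspace X" "closed X" "\<And>p g q. int k dvd int p - int q \<Longrightarrow> W p g q \<in> X"
  shows "Fix k \<subseteq> X"
  using E_mem[OF assms] E_Fix by (metis subsetI)

lemma E_0_E: "E 0 (E k x) = E 0 x"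
proof -
  have "E 0 (E k x) - E 0 x = 0"
  proof (rule dense_eq_zero[where T="\<lambda>x. E 0 (E k x) - E 0 x"])
    show "bounded_linear (\<lambda>x. E 0 (E k x) - E 0 x)"
      by (intro bounded_linear_sub bounded_linear_compose[OF bounded_linear_E bounded_linear_E]
          bounded_linear_E)
    show "E 0 (E k (W p g q)) - E 0 (W p g q) = 0" for p g q
      using E_scaleC[of 0 0 0] by (auto simp: E_W)
  qed (simp add: E_scaleC scaleC_diff_right)
  then show ?thesis by simp
qed

text \<open>A unital contraction that respects adjoints preserves the norm formulation of positivity
  with the same \<open>t\<close>.\<close>

lemma npos_E:
  assumes "npos x" shows "npos (E k x)"
proof -
  from assms obtain t where t: "t \<ge> 0" "norm (t *\<^sub>R 1 - x) \<le> t" and x: "star x = x"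
    by (auto simp: npos_def)
  have "t *\<^sub>R 1 - E k x = E k (t *\<^sub>R 1 - x)"
    by (simp add: E_diff scaleR_scaleC E_scaleC E_one)
  then have "norm (t *\<^sub>R 1 - E k x) \<le> t"
    using norm_E_le[of k "t *\<^sub>R 1 - x"] t by simp
  then show ?thesis
    using t x by (intro nposI[of _ t]) (auto simp flip: E_star)
qed

text \<open>The \<open>N\<close>-th roots of unity with argument below \<open>2 \<pi> / L\<close> make up the fraction \<open>1 / L\<close> of
  the average and move \<open>y\<close> by at most \<open>e\<close>; hence \<open>y \<le> e + L E(y)\<close>.\<close>

lemma E_0_faithful:
  assumes y: "npos y" and "E 0 y = 0"
  shows "y = 0"
proof -
  have "norm y \<le> e" if e: "e > 0" for e
  proof -
    have "eventually (\<lambda>t. dist (\<Gamma> (cis t) y) y < e) (at 0)"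
      by (rule tendstoD[OF \<Gamma>_tendsto_at_1 e])
    then obtain \<eta> where \<eta>: "\<eta> > 0" "\<And>t. t \<noteq> 0 \<Longrightarrow> \<bar>t\<bar> < \<eta> \<Longrightarrow> dist (\<Gamma> (cis t) y) y < e"
      by (auto simp: eventually_at dist_norm)
    have near: "norm (\<Gamma> (cis t) y - y) \<le> e" if "\<bar>t\<bar> < \<eta>" for t
      using \<eta>(2)[of t] that e by (cases "t = 0") (auto simp: dist_norm \<Gamma>_1)
    \<comment> \<open>With this choice an angle below \<open>2 * pi / L\<close> is below
      \<open>\<eta>\<close>; among the \<open>L * r\<close> roots of unity these are the first
      \<open>r\<close>.\<close>
    obtain L :: nat where L: "2 * pi / \<eta> < real L"
      using reals_Archimedean2 by blast
    have L0: "L > 0"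
    proof -
      have "0 < 2 * pi / \<eta>" using \<eta>(1) by simp
      then show ?thesis using L by (simp flip: of_nat_0_less_iff)
    qed
    have pos: "npos (real L *\<^sub>R avg (L * r) y - y + e *\<^sub>R 1)" if r: "r > 0" for r
    proof -
      let ?G = "\<lambda>j. \<Gamma> (unity_root (L * r) (int j)) y"
      have small: "norm (?G j - y) \<le> e" if "j < r" for j
      proof -
        have "2 * pi * real j / (real L * real r) < 2 * pi * real r / (real L * real r)"
          using that L0 r by (intro divide_strict_right_mono) auto
        also have "\<dots> = 2 * pi / real L"
          using r by simp
        also have "\<dots> < \<eta>"
          using L \<eta>(1) L0 by (simp add: field_simps)
        finally show ?thesis
          unfolding unity_root_def by (intro near) simp
      qed
      have "npos (?G j - y + e *\<^sub>R 1)" if "j < r" for j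
      proof (rule nposI[of _ e])
        show "star (?G j - y + e *\<^sub>R 1) = ?G j - y + e *\<^sub>R 1"
          using nposD[OF y] by (simp add: star_add star_diff flip: \<Gamma>_star)
        show "norm (e *\<^sub>R 1 - (?G j - y + e *\<^sub>R 1)) \<le> e"
          using small[OF that] by (simp add: norm_minus_commute)
      qed (use e in simp)
      then have "npos (\<Sum>j<r. ?G j - y + e *\<^sub>R 1)"
        by (intro npos_sum) auto
      moreover have "npos (\<Sum>j\<in>{r..<L * r}. ?G j)"
        by (intro npos_sum npos_\<Gamma> y) auto
      \<comment> \<open>The first \<open>r\<close> terms are bounded below by \<open>y - e\<close>,
        the others only by 0. Dividing by \<open>r\<close> turns the full sum into \<open>L\<close>
        times the average over \<open>L * r\<close> roots.\<close>
      ultimately have "npos ((1 / real r) *\<^sub>R ((\<Sum>j<r. ?G j - y + e *\<^sub>R 1) + (\<Sum>j\<in>{r..<L * r}. ?G j)))"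
        by (intro npos_scaleR npos_add) auto
      also have "(\<Sum>j<r. ?G j - y + e *\<^sub>R 1) + (\<Sum>j\<in>{r..<L * r}. ?G j)
          = (\<Sum>j<L * r. ?G j) + real r *\<^sub>R (e *\<^sub>R 1 - y)"
      proof -
        have "(\<Sum>j<L * r. ?G j) = (\<Sum>j<r. ?G j) + (\<Sum>j\<in>{r..<L * r}. ?G j)"
          using L0 by (subst sum.union_disjoint[symmetric]) (auto intro!: sum.cong simp: ivl_disj_un)
        then show ?thesis
          by (simp add: sum.distrib sum_subtractf sum_constant_scaleR algebra_simps)
      qed
      finally show ?thesis
        using r L0 by (simp add: avg_def scaleR_add_right algebra_simps)
    qed
    \<comment> \<open>\<open>level 0 i\<close> is \<open>Suc i\<close>, so the index
      \<open>L * Suc i - 1\<close> selects the averages over \<open>L * Suc i\<close> roots, a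
      subsequence with limit \<open>E 0 y\<close>.\<close>
    have "i \<le> L * Suc i - 1" for i
    proof -
      have "1 * Suc i \<le> L * Suc i"
        using L0 by (intro mult_le_mono1) simp
      then show ?thesis by simp
    qed
    then have "filterlim (\<lambda>i. L * Suc i - 1) at_top sequentially"
      by (intro filterlim_at_top_mono[OF filterlim_ident] always_eventually allI)
    then have "(\<lambda>i. avg (level 0 (L * Suc i - 1)) y) \<longlonglongrightarrow> E 0 y"
      by (rule filterlim_compose[OF avg_tendsto_E])
    then have "(\<lambda>i. avg (level 0 (L * Suc i - 1)) y) \<longlonglongrightarrow> 0"
      by (simp only: assms(2))
    then have "(\<lambda>i. real L *\<^sub>R avg (L * Suc i) y - y + e *\<^sub>R 1) \<longlonglongrightarrow> real L *\<^sub>R 0 - y + e *\<^sub>R 1"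
      using L0 by (intro tendsto_intros) (simp add: level_def)
    then have "npos (real L *\<^sub>R 0 - y + e *\<^sub>R 1)"
      by (rule npos_limit[rotated]) (rule pos, simp)
    then have "npos (e *\<^sub>R 1 - y)"
      by simp
    then show ?thesis
      using y e by (intro npos_le_norm) auto
  qed
  then have "norm y \<le> 0"
    using field_le_epsilon[of "norm y" 0] by simp
  then show ?thesis by simp
qed

lemma E_faithful: "npos y \<Longrightarrow> E k y = 0 \<Longrightarrow> y = 0"
  by (metis E_0_faithful E_0_E E_scaleC scaleC_zero_left)

end

section \<open>Laurent polynomials in conjugates of \<open>U 1\<close>\<close>

context bs_relations
begin

definition trig :: "'a set" where
  "trig = {x. \<exists>D c. finite D \<and> x = (\<Sum>d\<in>D. c d *\<^sub>C U d)}"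

lemma sum_in_trig: "finite D \<Longrightarrow> (\<Sum>d\<in>D. c d *\<^sub>C U d) \<in> trig"
  unfolding trig_def by (rule CollectI, rule exI[of _ D], rule exI[of _ c]) simp

lemma csubspace_trig: "csubspace trig"
proof (rule csubspaceI)
  show "0 \<in> trig"
    unfolding trig_def by (auto intro: exI[of _ "{}"])
  show "x + y \<in> trig" if "x \<in> trig" "y \<in> trig" for x y
  proof -
    obtain D c where x: "finite D" "x = (\<Sum>d\<in>D. c d *\<^sub>C U d)"
      using \<open>x \<in> trig\<close> by (auto simp: trig_def)
    obtain D' c' where y: "finite D'" "y = (\<Sum>d\<in>D'. c' d *\<^sub>C U d)"
      using \<open>y \<in> trig\<close> by (auto simp: trig_def)
    have "x = (\<Sum>d\<in>D \<union> D'. (if d \<in> D then c d else 0) *\<^sub>C U d)"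
      unfolding x(2) by (rule sum.mono_neutral_cong_left) (use x y in auto)
    moreover have "y = (\<Sum>d\<in>D \<union> D'. (if d \<in> D' then c' d else 0) *\<^sub>C U d)"
      unfolding y(2) by (rule sum.mono_neutral_cong_left) (use x y in auto)
    ultimately have "x + y = (\<Sum>d\<in>D \<union> D'. ((if d \<in> D then c d else 0) + (if d \<in> D' then c' d else 0)) *\<^sub>C U d)"
      by (simp only: scaleC_add_left sum.distrib)
    moreover have "finite (D \<union> D')"
      using x y by simp
    ultimately show ?thesis
      by (simp only: sum_in_trig)
  qed
  show "a *\<^sub>C x \<in> trig" if "x \<in> trig" for a x
  proof -
    obtain D c where "finite D" "x = (\<Sum>d\<in>D. c d *\<^sub>C U d)"
      using \<open>x \<in> trig\<close> by (auto simp: trig_def)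
    then have "finite D" "a *\<^sub>C x = (\<Sum>d\<in>D. (a * c d) *\<^sub>C U d)"
      by (simp_all add: scaleC_sum_right)
    then show ?thesis
      by (simp only: sum_in_trig)
  qed
qed

lemma U_in_trig: "U g \<in> trig"
  using sum_in_trig[of "{g}" "\<lambda>_. 1"] by simp

definition trig_level :: "nat \<Rightarrow> 'a set" where
  "trig_level p = (\<lambda>q. S p * q * star (S p)) ` trig"

lemma csubspace_trig_level: "csubspace (trig_level p)"
proof (rule csubspaceI)
  show "0 \<in> trig_level p"
    unfolding trig_level_def using csubspace_0[OF csubspace_trig] by force
  show "x + y \<in> trig_level p" if "x \<in> trig_level p" "y \<in> trig_level p" for x y
  proof -
    obtain a b where "a \<in> trig" "b \<in> trig" "x = S p * a * star (S p)" "y = S p * b * star (S p)"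
      using \<open>x \<in> trig_level p\<close> \<open>y \<in> trig_level p\<close> unfolding trig_level_def by blast
    then show ?thesis
      unfolding trig_level_def
      by (intro image_eqI[of _ _ "a + b"]) (auto simp: algebra_simps csubspace_add[OF csubspace_trig])
  qed
  show "c *\<^sub>C x \<in> trig_level p" if "x \<in> trig_level p" for c x
  proof -
    obtain a where "a \<in> trig" "x = S p * a * star (S p)"
      using \<open>x \<in> trig_level p\<close> unfolding trig_level_def by blast
    then show ?thesis
      unfolding trig_level_def
      by (intro image_eqI[of _ _ "c *\<^sub>C a"]) (auto simp: csubspace_scaleC[OF csubspace_trig])
  qed
qed

lemma W_in_trig_level: "W p g p \<in> trig_level p"
  by (auto simp: W_def trig_level_def U_in_trig)

text \<open>By \<open>W_raise\<close> the conjugate of \<open>U d\<close> at level \<open>p\<close>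
  is that of \<open>U (d * m ^ r)\<close> at level \<open>p + r\<close>. The levels thus form an
  increasing chain, whose union is a subspace.\<close>

lemma trig_level_mono: "trig_level p \<subseteq> trig_level (p + r)"
proof -
  have "S p * (\<Sum>d\<in>D. c d *\<^sub>C U d) * star (S p) \<in> trig_level (p + r)" if "finite D" for D c
    using that
  proof (induction D)
    case empty
    then show ?case by (simp add: csubspace_0[OF csubspace_trig_level])
  next
    case (insert d D)
    have "c d *\<^sub>C W (p + r) (d * m ^ r) (p + r) \<in> trig_level (p + r)"
      by (intro csubspace_scaleC[OF csubspace_trig_level] W_in_trig_level)
    then have "c d *\<^sub>C W p d p \<in> trig_level (p + r)"
      by (simp only: W_raise)
    then have "c d *\<^sub>C W p d p + S p * (\<Sum>d\<in>D. c d *\<^sub>C U d) * star (S p) \<in> trig_level (p + r)"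
      using insert.IH by (rule csubspace_add[OF csubspace_trig_level])
    then show ?case
      using insert.hyps by (simp add: W_def distrib_left distrib_right)
  qed
  then show ?thesis
    by (auto simp: trig_level_def[of p] trig_def)
qed

lemma csubspace_Union_trig_level: "csubspace (\<Union>p. trig_level p)"
proof (rule csubspaceI)
  show "0 \<in> (\<Union>p. trig_level p)"
    using csubspace_0[OF csubspace_trig_level] by blast
  show "x + y \<in> (\<Union>p. trig_level p)" if "x \<in> (\<Union>p. trig_level p)" "y \<in> (\<Union>p. trig_level p)" for x y
  proof -
    obtain p q where "x \<in> trig_level p" "y \<in> trig_level q"
      using \<open>x \<in> (\<Union>p. trig_level p)\<close> \<open>y \<in> (\<Union>p. trig_level p)\<close> by blast
    then have "x \<in> trig_level (p + q)" "y \<in> trig_level (p + q)"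
      using trig_level_mono[of p q] trig_level_mono[of q p] by (auto simp: add.commute)
    then show ?thesis
      using csubspace_add[OF csubspace_trig_level] by blast
  qed
  show "c *\<^sub>C x \<in> (\<Union>p. trig_level p)" if "x \<in> (\<Union>p. trig_level p)" for c x
    using that csubspace_scaleC[OF csubspace_trig_level] by blast
qed

end

text \<open>The assumption \<open>root_functional\<close> isolates what is taken from the universal
  property: contractive functionals that act on the elements \<open>U g\<close> as evaluation at an
  \<open>N\<close>-th root of unity.\<close>

locale bs_universal = bs_gauge +
  assumes m_nonzero: "m \<noteq> 0"
    and root_functional: "N > 0 \<Longrightarrow> coprime (int N) m \<Longrightarrow> j < N \<Longrightarrow>
      \<exists>\<psi> :: 'a \<Rightarrow> complex. (\<forall>x y. \<psi> (x + y) = \<psi> x + \<psi> y) \<and> (\<forall>c x. \<psi> (c *\<^sub>C x) = c * \<psi> x) \<and>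
        (\<forall>x. cmod (\<psi> x) \<le> norm x) \<and> (\<forall>g. \<psi> (U g) = unity_root N (int j * g))"
begin

lemma E_zero: "E k 0 = 0"
  using E_scaleC[of k 0 0] by simp

text \<open>Conjugation by \<open>S p\<close> is contractive and undoes level \<open>p\<close>, so
  an approximation of \<open>f\<close> at that level becomes an approximation of a conjugate of
  \<open>f\<close> by a Laurent polynomial.\<close>

lemma approx_trig_level:
  assumes "f \<in> Fix 0" "e > 0"
  obtains p q where "q \<in> trig" "norm (star (S p) * f * S p - q) < e"
proof -
  have "f \<in> closure (\<Union>p. trig_level p)"
  proof (rule subsetD[OF Fix_subset assms(1)])
    show "csubspace (closure (\<Union>p. trig_level p))"
      by (rule csubspace_closure[OF csubspace_Union_trig_level])
    show "W p g q \<in> closure (\<Union>p. trig_level p)" if "int 0 dvd int p - int q" for p g q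
      using that W_in_trig_level[of p g] closure_subset[of "\<Union>p. trig_level p"] by auto
  qed simp
  then obtain y where "y \<in> (\<Union>p. trig_level p)" "dist y f < e"
    using assms(2) unfolding closure_approachable by blast
  then obtain p q where q: "q \<in> trig" and y: "norm (f - S p * q * star (S p)) < e"
    by (auto simp: trig_level_def dist_norm norm_minus_commute)
  have "star (S p) * (f - S p * q * star (S p)) * S p
      = star (S p) * f * S p - star (S p) * (S p * q * star (S p)) * S p"
    by (simp add: left_diff_distrib right_diff_distrib)
  then have "star (S p) * (f - S p * q * star (S p)) * S p = star (S p) * f * S p - q"
    by (simp only: conj_S_conj)
  then have "norm (star (S p) * f * S p - q) < e"
    using norm_conj_S_le(1)[of p "f - S p * q * star (S p)"] y by simp
  then show ?thesis
    using that q by blast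
qed

lemma norm_avg_U_le: "norm ((1 / real N) *\<^sub>R (\<Sum>i<N. U (h i))) \<le> 1"
proof -
  have "norm (\<Sum>i<N. U (h i)) \<le> (\<Sum>i<N. 1)"
    by (rule order_trans[OF norm_sum sum_mono]) (rule norm_V_le)
  then show ?thesis
    by (cases "N = 0") (auto simp: divide_le_eq)
qed

text \<open>If \<open>g u\<^sub>K = g\<close> then \<open>g\<close> equals its product with the average of the
  \<open>u\<^sub>i\<^sub>K\<close>, and that average vanishes at every nontrivial \<open>N\<close>-th root of unity.\<close>

lemma trig_small_at_root:
  assumes g: "g * U K = g" and q: "norm (g - (\<Sum>d\<in>D. c d *\<^sub>C U d)) \<le> e"
    and N: "N > 0" "coprime (int N) m" "coprime (int N) K" and j: "0 < j" "j < N"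
  shows "cmod (\<Sum>d\<in>D. c d * unity_root N (int j * d)) \<le> 2 * e"
proof -
  define Q where "Q = (\<Sum>d\<in>D. c d *\<^sub>C U d)"
  define A where "A = (1 / real N) *\<^sub>R (\<Sum>i<N. U (int i * K))"
  have gU: "g * U (int i * K) = g" for i
    by (induction i) (auto simp: U_0 distrib_right U_add g simp flip: mult.assoc)
  have gA: "g * A = g"
    using N(1) by (simp add: A_def sum_distrib_left gU sum_constant_scaleR)
  have "norm ((g - Q) * A) \<le> norm (g - Q) * norm A"
    by (rule norm_mult_ineq)
  also have "\<dots> \<le> norm (g - Q) * 1"
    unfolding A_def by (intro mult_left_mono norm_avg_U_le) simp
  finally have "norm ((g - Q) * A) \<le> e"
    using q by (simp add: Q_def)
  \<comment> \<open>Since \<open>g * A = g\<close>, the polynomial \<open>Q\<close> is fixed by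
    right multiplication with \<open>A\<close> up to \<open>2 * e\<close>, whereas
    \<open>Q * A\<close> vanishes at the root under consideration.\<close>
  moreover have "Q - Q * A = (g - Q) * A - (g - Q)"
    by (simp add: left_diff_distrib gA)
  moreover have "norm (g - Q) \<le> e"
    using q by (simp add: Q_def)
  ultimately have QA: "norm (Q - Q * A) \<le> 2 * e"
    using norm_triangle_ineq4[of "(g - Q) * A" "g - Q"] by (metis add_mono mult_2 order_trans)
  obtain \<psi> where \<psi>: "\<And>x y. \<psi> (x + y) = \<psi> x + \<psi> y" "\<And>c x. \<psi> (c *\<^sub>C x) = c * \<psi> x"
      "\<And>x. cmod (\<psi> x) \<le> norm x" "\<And>g. \<psi> (U g) = unity_root N (int j * g)"
    using root_functional[OF N(1,2) j(2)] by metis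
  have \<psi>_sum: "\<psi> (\<Sum>i\<in>I. f i) = (\<Sum>i\<in>I. \<psi> (f i))" for f :: "'b \<Rightarrow> 'a" and I
    using \<psi>(2)[of 0 0] by (induction I rule: infinite_finite_induct) (auto simp: \<psi>(1))
  have \<psi>_diff: "\<psi> (x - y) = \<psi> x - \<psi> y" for x y
    using \<psi>(1)[of "x - y" y] by simp
  have Aroot: "(\<Sum>i<N. unity_root N (int j * (d + int i * K))) = 0" for d
  proof -
    have "\<not> int N dvd int j * K"
    proof
      assume "int N dvd int j * K"
      then have "int N dvd int j"
        using N(3) by (simp add: coprime_dvd_mult_left_iff)
      then show False
        using j zdvd_imp_le[of "int N" "int j"] by simp
    qed
    then have "(\<Sum>i<N. unity_root N (int i * (int j * K))) = 0"
      using sum_unity_root[OF N(1), of "int j * K"] by simp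
    then show ?thesis
      by (simp add: distrib_left unity_root_add mult.left_commute flip: sum_distrib_left)
  qed
  have "Q * A = (1 / real N) *\<^sub>R (\<Sum>d\<in>D. c d *\<^sub>C (\<Sum>i<N. U (d + int i * K)))"
    by (simp add: Q_def A_def sum_product scaleC_sum_right U_add)
  then have "\<psi> (Q * A) = 0"
    by (simp add: scaleR_scaleC \<psi>(2,4) \<psi>_sum Aroot)
  then have "\<psi> (Q - Q * A) = (\<Sum>d\<in>D. c d * unity_root N (int j * d))"
    by (simp add: \<psi>_diff) (simp add: Q_def \<psi>_sum \<psi>(2,4))
  then show ?thesis
    using \<psi>(3)[of "Q - Q * A"] QA by simp
qed

text \<open>Away from the root 1 the values are at most \<open>2 * e\<close>. The value at 1 is
  compared with that at the neighbouring root, which costs \<open>a r\<close>. With the factor 6 of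
  \<open>norm_le_max_at_roots\<close> and errors tending to 0 this gives 12.\<close>

lemma trig_norm_le:
  assumes g: "g * U K = g" and K: "K \<noteq> 0" and q: "norm (g - (\<Sum>d\<in>D. c d *\<^sub>C U d)) \<le> e"
    and D: "finite D"
  shows "norm (\<Sum>d\<in>D. c d *\<^sub>C U d) \<le> 12 * e"
proof -
  define M where "M = nat \<bar>m * K\<bar>"
  \<comment> \<open>One more than a multiple of \<open>m * K\<close>, hence coprime to both factors,
    and unbounded in \<open>r\<close>.\<close>
  define N where "N r = M * Suc r + 1" for r
  have M: "M > 0"
    using m_nonzero K by (simp add: M_def)
  define a where "a r = (\<Sum>d\<in>D. cmod (c d) * cmod (1 - unity_root (N r) d))" for r
  define b where "b r = (\<Sum>d\<in>D. cmod (c d) * (2 * real_of_int \<bar>d\<bar>)) / real (N r)" for r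
  have e: "e \<ge> 0"
    using q norm_ge_zero order_trans by blast
  have cop: "coprime (int (N r)) m" "coprime (int (N r)) K" for r
  proof -
    have "coprime (int (N r)) (m * K)"
    proof (rule coprimeI)
      fix l assume l: "l dvd int (N r)" "l dvd m * K"
      have "int (N r) = \<bar>m * K\<bar> * int (Suc r) + 1"
        by (simp add: N_def M_def algebra_simps)
      moreover have "l dvd \<bar>m * K\<bar> * int (Suc r)"
        using l(2) by (simp del: of_nat_Suc)
      ultimately show "is_unit l"
        using l(1) by (metis dvd_add_right_iff)
    qed
    then show "coprime (int (N r)) m" "coprime (int (N r)) K"
      by auto
  qed
  have N2: "N r \<ge> 2" for r
    using M by (simp add: N_def)
  have root: "cmod (\<Sum>d\<in>D. c d * unity_root (N r) (int j * d)) \<le> 2 * e + a r" if j: "j < N r" for j r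
  proof (cases "j = 0")
    case False
    have "cmod (\<Sum>d\<in>D. c d * unity_root (N r) (int j * d)) \<le> 2 * e"
      by (rule trig_small_at_root[OF g q _ cop]) (use False j in auto)
    moreover have "a r \<ge> 0"
      by (auto simp: a_def intro: sum_nonneg)
    ultimately show ?thesis by simp
  next
    case True
    have 1: "cmod (\<Sum>d\<in>D. c d * unity_root (N r) (int 1 * d)) \<le> 2 * e"
      by (rule trig_small_at_root[OF g q _ cop]) (use N2[of r] in auto)
    have "(\<Sum>d\<in>D. c d) = (\<Sum>d\<in>D. c d * unity_root (N r) d) + (\<Sum>d\<in>D. c d * (1 - unity_root (N r) d))"
      by (simp add: algebra_simps flip: sum.distrib)
    also have "cmod \<dots> \<le> 2 * e + a r"
      unfolding a_def by (rule norm_triangle_mono) (use 1 in \<open>auto intro!: norm_sum simp flip: norm_mult\<close>)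
    finally show ?thesis
      using True by simp
  qed
  have bound: "norm (\<Sum>d\<in>D. c d *\<^sub>C U d) \<le> 6 * (2 * e + a r) + b r" for r
    unfolding b_def by (rule norm_le_max_at_roots[OF _ D root]) (use N2[of r] in auto)
  have "filterlim N at_top sequentially"
  proof (rule filterlim_at_top_mono[OF filterlim_ident always_eventually], rule allI)
    fix r
    have "1 * Suc r \<le> M * Suc r"
      using M by (intro mult_le_mono1) simp
    then show "r \<le> N r" by (simp add: N_def)
  qed
  then have N_top: "filterlim (\<lambda>r. real (N r)) at_top sequentially"
    by (rule filterlim_compose[OF filterlim_real_sequentially])
  have "(\<lambda>r. cmod (1 - unity_root (N r) d)) \<longlonglongrightarrow> cmod (1 - cis 0)" for d
    unfolding unity_root_def
    by (intro tendsto_intros tendsto_divide_0[OF tendsto_const]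
        filterlim_at_top_imp_at_infinity N_top)
  then have "(\<lambda>r. cmod (1 - unity_root (N r) d)) \<longlonglongrightarrow> 0" for d
    by simp
  then have "a \<longlonglongrightarrow> (\<Sum>d\<in>D. cmod (c d) * 0)"
    unfolding a_def by (intro tendsto_intros)
  then have "a \<longlonglongrightarrow> 0" by simp
  moreover have "b \<longlonglongrightarrow> 0"
    unfolding b_def
    by (intro tendsto_divide_0[OF tendsto_const] filterlim_at_top_imp_at_infinity N_top)
  ultimately have "(\<lambda>r. 6 * (2 * e + a r) + b r) \<longlonglongrightarrow> 6 * (2 * e + 0) + 0"
    by (intro tendsto_intros)
  then have "norm (\<Sum>d\<in>D. c d *\<^sub>C U d) \<le> 6 * (2 * e + 0) + 0"
    by (rule tendsto_lowerbound[OF _ always_eventually]) (simp_all only: bound simp_thms trivial_limit_sequentially)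
  then show ?thesis by simp
qed

text \<open>Conjugation by \<open>S p\<close> changes the period from \<open>K\<close> to
  \<open>K * m ^ p\<close>, still nonzero. The approximating polynomial has norm at most
  \<open>12 * e\<close> and is within \<open>e\<close> of the conjugate of \<open>f\<close>, whence
  13.\<close>

lemma Fix_0_no_periodic:
  assumes f: "f \<in> Fix 0" and fU: "f * U K = f" and K: "K \<noteq> 0"
  shows "f = 0"
proof -
  have "norm f \<le> 13 * e" if e: "e > 0" for e
  proof -
    obtain p q where q: "q \<in> trig" "norm (star (S p) * f * S p - q) < e"
      using approx_trig_level[OF f e] by metis
    define g where "g = star (S p) * f * S p"
    obtain D c where D: "finite D" "q = (\<Sum>d\<in>D. c d *\<^sub>C U d)"
      using q(1) by (auto simp: trig_def)
    have "g * U (K * m ^ p) = star (S p) * (f * U K) * S p"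
      by (simp add: g_def mult.assoc U_S)
    then have "g * U (K * m ^ p) = g"
      by (simp add: fU g_def)
    then have "norm q \<le> 12 * e"
      unfolding D(2)
      by (rule trig_norm_le) (use K m_nonzero q(2) D in \<open>auto simp: g_def\<close>)
    then have "norm g \<le> 13 * e"
      using q(2) norm_triangle_ineq2[of g q] by (simp add: g_def)
    moreover have "f = S p * g * star (S p)"
      by (simp only: g_def conj_S_conj)
    ultimately show ?thesis
      using norm_conj_S_le(2)[of p g] by simp
  qed
  then have "norm f \<le> 0 + e" if "e > 0" for e
    using that \<open>\<And>e. 0 < e \<Longrightarrow> norm f \<le> 13 * e\<close>[of "e / 13"] by simp
  then have "norm f \<le> 0"
    by (rule field_le_epsilon)
  then show ?thesis by simp
qed

section \<open>The relative commutant\<close>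

definition period :: nat where
  "period = (if m = 1 then 1 else if m = - 1 then 2 else 0)"

lemma power_eq_iff_period_dvd: "m ^ p = m ^ q \<longleftrightarrow> int period dvd int p - int q"
  unfolding period_def by (rule power_eq_power_iff_dvd[OF m_nonzero])

text \<open>The middle exponents of the two products are \<open>g * m ^ p' + g' * m ^ q\<close> and
  \<open>g' * m ^ p + g * m ^ q'\<close>; they agree once \<open>m ^ p = m ^ q\<close> and
  \<open>m ^ p' = m ^ q'\<close>.\<close>

lemma W_commute:
  assumes "int period dvd int p - int q" "int period dvd int p' - int q'"
  shows "W p g q * W p' g' q' = W p' g' q' * W p g q"
  using assms by (simp add: W_mult add.commute power_eq_iff_period_dvd[symmetric])

lemma closed_csubspace_commuting: "csubspace {x. x * y = y * x}" "closed {x. x * y = (y * x :: 'a)}"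
proof -
  show "csubspace {x. x * y = y * x}"
    by (rule csubspaceI) (auto simp: distrib_left distrib_right)
  have "closed {x. x * y - y * x \<in> {0}}"
    by (intro closed_vimage_bounded_linear bounded_linear_sub bounded_linear_mult_left
        bounded_linear_mult_right) auto
  then show "closed {x. x * y = y * x}" by simp
qed

lemma Fix_period_commute:
  assumes "x \<in> Fix period" "y \<in> Fix period"
  shows "x * y = y * x"
proof -
  have 1: "x * W p g q = W p g q * x" if "int period dvd int p - int q" for p g q
  proof -
    have "Fix period \<subseteq> {x. x * W p g q = W p g q * x}"
      by (rule Fix_subset[OF closed_csubspace_commuting]) (use that W_commute in auto)
    then show ?thesis
      using assms(1) by blast
  qed
  have "Fix period \<subseteq> {y. y * x = x * y}"
    by (rule Fix_subset[OF closed_csubspace_commuting]) (simp add: 1)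
  then show ?thesis
    using assms(2) by auto
qed

text \<open>Moving \<open>U l\<close> across \<open>W p g q\<close> replaces it by its conjugate,
  which has degree 0 again.\<close>

lemma W_conj_Fix: "U l * W p g q = W p g q * W q (l * m ^ p) q"
proof -
  have "W p g q * W q (l * m ^ p) q = W (p + q) ((l * m ^ p + g) * m ^ q) (q + q)"
    by (simp add: W_mult distrib_right add.commute)
  also have "\<dots> = W 0 l 0 * W p g q"
    by (simp only: W_raise) (simp add: W_mult)
  finally show ?thesis
    by (simp add: W_0_0)
qed

lemma E_0_commutant_W:
  assumes x: "\<And>f. f \<in> Fix 0 \<Longrightarrow> x * f = f * x" and pq: "\<not> int period dvd int p - int q"
  shows "E 0 (x * W p g q) = 0"
proof (rule Fix_0_no_periodic)
  let ?f = "E 0 (x * W p g q)"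
  show f: "?f \<in> Fix 0" by (rule E_in_Fix)
  have U: "U l \<in> Fix 0" for l
    using W_in_Fix[of 0 0 0 l] by (simp add: W_0_0)
  \<comment> \<open>The choice \<open>l = m ^ q\<close> makes the conjugate
    \<open>W q (l * m ^ p) q\<close> collapse to \<open>U (m ^ p)\<close>.\<close>
  have Wq: "W q (m ^ p * m ^ q) q = U (m ^ p)"
    using W_raise[of 0 q "m ^ p" 0] by (simp add: W_0_0)
  have "U (m ^ q) * ?f = E 0 (U (m ^ q) * (x * W p g q))"
    by (simp add: E_mult_left[OF U])
  also have "U (m ^ q) * (x * W p g q) = x * (U (m ^ q) * W p g q)"
    by (simp add: x[OF U] flip: mult.assoc)
  also have "\<dots> = (x * W p g q) * U (m ^ p)"
    by (simp add: W_conj_Fix mult.assoc) (simp add: Wq mult.commute[of "m ^ q"])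
  also have "E 0 \<dots> = ?f * U (m ^ p)"
    by (simp add: E_mult_right[OF U])
  \<comment> \<open>On the left, \<open>U (m ^ q)\<close> is moved behind the coefficient, since
    both lie in the commutative algebra \<open>Fix period\<close>. This yields the exponent
    \<open>m ^ p - m ^ q\<close>.\<close>
  finally have "?f * U (m ^ q) = ?f * U (m ^ p)"
    using Fix_period_commute[of ?f "U (m ^ q)"] f U Fix_0_subset by auto
  then have "?f * U (m ^ p) * U (- (m ^ q)) = ?f * U (m ^ q) * U (- (m ^ q))"
    by simp
  then show "?f * U (m ^ p - m ^ q) = ?f"
    by (simp add: mult.assoc U_0 flip: U_add)
  show "m ^ p - m ^ q \<noteq> 0"
    using pq power_eq_iff_period_dvd by auto
qed

theorem commutant_Fix_0: "{x. \<forall>f\<in>Fix 0. x * f = f * x} = Fix period"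
proof (intro subset_antisym subsetI)
  fix x assume "x \<in> Fix period"
  then show "x \<in> {x. \<forall>f\<in>Fix 0. x * f = f * x}"
    using Fix_period_commute Fix_0_subset by blast
next
  fix x assume x: "x \<in> {x. \<forall>f\<in>Fix 0. x * f = f * x}"
  define y where "y = x - E period x"
  have "E 0 (y * W p g q) = 0" for p g q
  proof (cases "int period dvd int p - int q")
    case True
    have "E 0 (E period x * W p g q) = E 0 (E period (x * W p g q))"
      by (simp add: E_mult_right[OF W_in_Fix[OF True]])
    then show ?thesis
      by (simp add: y_def left_diff_distrib E_diff E_0_E)
  next
    case False
    \<comment> \<open>\<open>E period x\<close> has only degrees divisible by the period; multiplied
      by \<open>W p g q\<close>, whose degree is not, it has no part of degree 0.\<close>
    have "E 0 (E period x * W p g q) = 0"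
    proof (rule dense_eq_zero[where T="\<lambda>x. E 0 (E period x * W p g q)"])
      show "bounded_linear (\<lambda>x. E 0 (E period x * W p g q))"
        by (rule bounded_linear_compose[OF bounded_linear_E
              bounded_linear_compose[OF bounded_linear_mult_left bounded_linear_E]])
      show "E 0 (E period (W p' g' q') * W p g q) = 0" for p' g' q'
      proof (cases "int period dvd int p' - int q'")
        case True
        have "int (p' + p) \<noteq> int (q' + q)"
        proof
          assume "int (p' + p) = int (q' + q)"
          then have "int p - int q = - (int p' - int q')" by simp
          then show False using True False by (metis dvd_minus_iff)
        qed
        then show ?thesis
          by (simp add: E_W W_mult E_zero)
      qed (simp add: E_W E_zero)
    qed (simp add: E_scaleC)
    moreover have "E 0 (x * W p g q) = 0"
      by (rule E_0_commutant_W[OF _ False]) (use x in blast)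
    ultimately show ?thesis
      by (simp add: y_def left_diff_distrib E_diff)
  qed
  \<comment> \<open>By density \<open>E 0 (y * z)\<close> vanishes for every \<open>z\<close>; the
    case \<open>z = star y\<close> is the one to which faithfulness applies.\<close>
  then have "E 0 (y * star y) = 0"
    by (rule dense_eq_zero[where T="\<lambda>z. E 0 (y * z)",
          OF bounded_linear_compose[OF bounded_linear_E bounded_linear_mult_right], rotated])
       (simp add: E_scaleC)
  then have "y * star y = 0"
    using npos_star_mult[of "star y"] by (simp only: star_star E_0_faithful)
  then have "y = 0"
    using norm_mult_star[of y] by simp
  then show "x \<in> Fix period"
    using E_in_Fix[of period x] by (simp add: y_def)
qed

lemma Fix_period_closure:
  assumes "csubspace X" "\<And>p g q. m ^ p = m ^ q \<Longrightarrow> W p g q \<in> X"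
  shows "Fix period \<subseteq> closure X"
  by (rule Fix_subset[OF csubspace_closure[OF assms(1)]])
     (simp_all add: assms(2) closure_subset[THEN subsetD] power_eq_iff_period_dvd)

end

section \<open>Matrix algebras\<close>

text \<open>Matrices are realised as maps of sequences because \<open>is_OZE1\<close> tests the
  universal property on algebras of this type. Reading and writing only the first \<open>N\<close>
  coordinates makes the map determine its entries and makes the unit of \<open>mat_algebra\<close> a
  truncation.\<close>

definition mat_op :: "nat \<Rightarrow> (nat \<Rightarrow> nat \<Rightarrow> complex) \<Rightarrow> seq_map" where
  "mat_op N M = (\<lambda>v i. if i < N then \<Sum>j<N. M i j * v j else 0)"

definition unit_seq :: "nat \<Rightarrow> nat \<Rightarrow> complex" where
  "unit_seq j = (\<lambda>k. if k = j then 1 else 0)"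

definition entry :: "seq_map \<Rightarrow> nat \<Rightarrow> nat \<Rightarrow> complex" where
  "entry T i j = T (unit_seq j) i"

definition l2 :: "nat \<Rightarrow> (nat \<Rightarrow> complex) \<Rightarrow> real" where
  "l2 N v = L2_set (\<lambda>i. cmod (v i)) {..<N}"

definition mat_adj :: "nat \<Rightarrow> seq_map \<Rightarrow> seq_map" where
  "mat_adj N T = mat_op N (\<lambda>i j. cnj (entry T j i))"

definition op_norm :: "nat \<Rightarrow> seq_map \<Rightarrow> real" where
  "op_norm N T = Sup ((\<lambda>v. l2 N (T v)) ` {v. l2 N v \<le> 1})"

definition mat_algebra :: "nat \<Rightarrow> seq_map cstar" where
  "mat_algebra N = \<lparr>carrier = range (mat_op N), mult = (\<circ>),
     one = (\<lambda>v i. if i < N then v i else 0), zero = (\<lambda>v i. 0),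
     add = (\<lambda>S T v i. S v i + T v i), smult = (\<lambda>c T v i. c * T v i),
     adj = mat_adj N, nrm = op_norm N\<rparr>"

lemma mat_algebra_simps [simp]:
  "carrier (mat_algebra N) = range (mat_op N)"
  "mult (mat_algebra N) = (\<circ>)"
  "one (mat_algebra N) = (\<lambda>v i. if i < N then v i else 0)"
  "zero (mat_algebra N) = (\<lambda>v i. 0)"
  "add (mat_algebra N) = (\<lambda>S T v i. S v i + T v i)"
  "smult (mat_algebra N) = (\<lambda>c T v i. c * T v i)"
  "adj (mat_algebra N) = mat_adj N"
  "nrm (mat_algebra N) = op_norm N"
  by (simp_all add: mat_algebra_def)

lemma mat_op_cong: "(\<And>i j. i < N \<Longrightarrow> j < N \<Longrightarrow> M i j = M' i j) \<Longrightarrow> mat_op N M = mat_op N M'"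
  by (auto simp: mat_op_def fun_eq_iff intro!: sum.cong)

lemma entry_mat_op: "i < N \<Longrightarrow> j < N \<Longrightarrow> entry (mat_op N M) i j = M i j"
  by (simp add: entry_def mat_op_def unit_seq_def mult_delta_right)

lemma mat_op_entry: "T \<in> range (mat_op N) \<Longrightarrow> mat_op N (entry T) = T"
  by (auto intro!: mat_op_cong simp: entry_mat_op)

lemma mat_op_add: "(\<lambda>v i. mat_op N M v i + mat_op N M' v i) = mat_op N (\<lambda>i j. M i j + M' i j)"
  by (simp add: mat_op_def fun_eq_iff sum.distrib distrib_right)

lemma mat_op_scale: "(\<lambda>v i. c * mat_op N M v i) = mat_op N (\<lambda>i j. c * M i j)"
  by (simp add: mat_op_def fun_eq_iff sum_distrib_left mult.assoc)

lemma mat_op_zero: "(\<lambda>v i. 0) = mat_op N (\<lambda>i j. 0)"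
  by (simp add: mat_op_def fun_eq_iff)

lemma mat_op_one: "(\<lambda>v i. if i < N then v i else 0) = mat_op N (\<lambda>i j. if i = j then 1 else 0)"
  by (auto simp: mat_op_def fun_eq_iff if_distrib[of "\<lambda>x. x * _"] cong: if_cong)

lemma mat_op_mult: "mat_op N M \<circ> mat_op N M' = mat_op N (\<lambda>i j. \<Sum>k<N. M i k * M' k j)"
proof -
  have "(\<Sum>k<N. M i k * (\<Sum>j<N. M' k j * v j)) = (\<Sum>j<N. (\<Sum>k<N. M i k * M' k j) * v j)" for i and v :: "nat \<Rightarrow> complex"
    unfolding sum_distrib_left sum_distrib_right
    by (subst sum.swap) (simp add: mult.assoc)
  then show ?thesis
    by (auto simp: mat_op_def fun_eq_iff intro!: sum.cong)
qed

lemma mat_adj_mat_op: "mat_adj N (mat_op N M) = mat_op N (\<lambda>i j. cnj (M j i))"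
  unfolding mat_adj_def by (intro mat_op_cong) (simp add: entry_mat_op)

lemma mat_op_linear:
  "mat_op N M (\<lambda>i. v i + w i) = (\<lambda>i. mat_op N M v i + mat_op N M w i)"
  "mat_op N M (\<lambda>i. c * v i) = (\<lambda>i. c * mat_op N M v i)"
  by (auto simp: mat_op_def fun_eq_iff sum.distrib distrib_left sum_distrib_left mult.left_commute)

lemma l2_nonneg [simp]: "l2 N v \<ge> 0"
  by (simp add: l2_def)

lemma l2_zero [simp]: "l2 N (\<lambda>i. 0) = 0"
  by (simp add: l2_def L2_set_def)

lemma l2_scale: "l2 N (\<lambda>i. c * v i) = cmod c * l2 N v"
  by (simp add: l2_def norm_mult L2_set_right_distrib)

lemma l2_triangle: "l2 N (\<lambda>i. v i + w i) \<le> l2 N v + l2 N w"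
  unfolding l2_def by (rule order_trans[OF L2_set_mono L2_set_triangle_ineq]) (auto intro: norm_triangle_ineq)

lemma cmod_le_l2: "i < N \<Longrightarrow> cmod (v i) \<le> l2 N v"
  unfolding l2_def by (rule member_le_L2_set) auto

lemma l2_eq_0_iff: "l2 N v = 0 \<longleftrightarrow> (\<forall>i<N. v i = 0)"
  by (auto simp: l2_def L2_set_eq_0_iff)

lemma l2_unit_seq: "j < N \<Longrightarrow> l2 N (unit_seq j) = 1"
proof -
  assume "j < N"
  have "(\<Sum>i<N. (cmod (unit_seq j i))\<^sup>2) = (\<Sum>i<N. if i = j then 1 else 0)"
    by (rule sum.cong) (auto simp: unit_seq_def)
  then show ?thesis
    using \<open>j < N\<close> by (simp add: l2_def L2_set_def)
qed

text \<open>A crude bound that makes the supremum in \<open>op_norm\<close> finite and turns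
  entrywise convergence into norm convergence.\<close>

lemma l2_mat_op_le: "l2 N (mat_op N M v) \<le> (\<Sum>i<N. \<Sum>j<N. cmod (M i j)) * l2 N v"
proof -
  have "cmod (mat_op N M v i) \<le> (\<Sum>j<N. cmod (M i j)) * l2 N v" if "i < N" for i
  proof -
    have "cmod (mat_op N M v i) \<le> (\<Sum>j<N. cmod (M i j * v j))"
      using that by (simp add: mat_op_def norm_sum)
    also have "\<dots> \<le> (\<Sum>j<N. cmod (M i j) * l2 N v)"
      by (intro sum_mono) (auto simp: norm_mult intro!: mult_left_mono cmod_le_l2)
    finally show ?thesis
      by (simp add: sum_distrib_right)
  qed
  then have "(\<Sum>i<N. cmod (mat_op N M v i)) \<le> (\<Sum>i<N. (\<Sum>j<N. cmod (M i j)) * l2 N v)"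
    by (intro sum_mono) auto
  moreover have "l2 N (mat_op N M v) \<le> (\<Sum>i<N. cmod (mat_op N M v i))"
    unfolding l2_def by (rule L2_set_le_sum) auto
  ultimately show ?thesis
    by (simp add: sum_distrib_right)
qed

lemma op_norm_bdd: "bdd_above ((\<lambda>v. l2 N (mat_op N M v)) ` {v. l2 N v \<le> 1})"
proof (rule bdd_aboveI2)
  fix v assume "v \<in> {v. l2 N v \<le> 1}"
  then have "(\<Sum>i<N. \<Sum>j<N. cmod (M i j)) * l2 N v \<le> (\<Sum>i<N. \<Sum>j<N. cmod (M i j)) * 1"
    by (intro mult_left_mono sum_nonneg) auto
  then show "l2 N (mat_op N M v) \<le> (\<Sum>i<N. \<Sum>j<N. cmod (M i j))"
    using l2_mat_op_le[of N M v] by simp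
qed

lemma op_norm_leI:
  assumes "\<And>v. l2 N v \<le> 1 \<Longrightarrow> l2 N (T v) \<le> c"
  shows "op_norm N T \<le> c"
  unfolding op_norm_def by (intro cSup_least) (use assms in \<open>auto intro!: exI[of _ "\<lambda>i. 0"]\<close>)

lemma l2_le_op_norm_unit:
  "T \<in> range (mat_op N) \<Longrightarrow> l2 N v \<le> 1 \<Longrightarrow> l2 N (T v) \<le> op_norm N T"
  unfolding op_norm_def by (rule cSup_upper) (auto intro: op_norm_bdd)

lemma op_norm_nonneg:
  assumes "T \<in> range (mat_op N)" shows "0 \<le> op_norm N T"
  by (rule order_trans[OF l2_nonneg l2_le_op_norm_unit[OF assms, of "\<lambda>i. 0"]]) simp

lemma l2_le_op_norm:
  assumes T: "T \<in> range (mat_op N)"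
  shows "l2 N (T v) \<le> op_norm N T * l2 N v"
proof (cases "l2 N v = 0")
  case True
  \<comment> \<open>\<open>l2 N\<close> is only a seminorm on sequences; \<open>T v\<close> vanishes
    because \<open>T\<close> ignores the coordinates from \<open>N\<close> on.\<close>
  then have "T v = (\<lambda>i. 0)"
    using T by (auto simp: mat_op_def l2_eq_0_iff)
  then show ?thesis
    using True by simp
next
  case False
  let ?c = "complex_of_real (1 / l2 N v)"
  have "l2 N (T (\<lambda>i. ?c * v i)) \<le> op_norm N T"
    by (rule l2_le_op_norm_unit[OF T], simp only: l2_scale) (use False in \<open>simp add: norm_divide\<close>)
  moreover have "T (\<lambda>i. ?c * v i) = (\<lambda>i. ?c * T v i)"
    using T mat_op_linear(2)[of N _ ?c v] by auto
  ultimately have "cmod ?c * l2 N (T v) \<le> op_norm N T"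
    by (simp only: l2_scale)
  then show ?thesis
    using False l2_nonneg[of N v] by (simp add: norm_divide field_simps)
qed

lemma op_norm_mat_op_le: "op_norm N (mat_op N M) \<le> (\<Sum>i<N. \<Sum>j<N. cmod (M i j))"
proof (rule op_norm_leI)
  fix v assume "l2 N v \<le> 1"
  then have "(\<Sum>i<N. \<Sum>j<N. cmod (M i j)) * l2 N v \<le> (\<Sum>i<N. \<Sum>j<N. cmod (M i j)) * 1"
    by (intro mult_left_mono sum_nonneg) auto
  then show "l2 N (mat_op N M v) \<le> (\<Sum>i<N. \<Sum>j<N. cmod (M i j))"
    using l2_mat_op_le[of N M v] by simp
qed

lemma cmod_entry_le:
  assumes "T \<in> range (mat_op N)" "i < N" "j < N"
  shows "cmod (entry T i j) \<le> op_norm N T"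
  using cmod_le_l2[OF assms(2), of "T (unit_seq j)"] l2_le_op_norm[OF assms(1), of "unit_seq j"]
  by (simp add: entry_def l2_unit_seq assms(3))

section \<open>Inner product and C*-identity for matrices\<close>

definition inner_seq :: "nat \<Rightarrow> (nat \<Rightarrow> complex) \<Rightarrow> (nat \<Rightarrow> complex) \<Rightarrow> complex" where
  "inner_seq N v w = (\<Sum>i<N. cnj (v i) * w i)"

lemma inner_seq_self: "inner_seq N v v = complex_of_real ((l2 N v)\<^sup>2)"
  by (simp add: inner_seq_def l2_def L2_set_def sum_nonneg complex_norm_square[unfolded of_real_power] mult.commute)

lemma cmod_inner_seq_le: "cmod (inner_seq N v w) \<le> l2 N v * l2 N w"
proof -
  have "cmod (inner_seq N v w) \<le> (\<Sum>i<N. cmod (v i) * cmod (w i))"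
    unfolding inner_seq_def by (rule order_trans[OF norm_sum]) (simp add: norm_mult)
  also have "\<dots> \<le> l2 N v * l2 N w"
    unfolding l2_def using L2_set_mult_ineq[of "\<lambda>i. cmod (v i)" "\<lambda>i. cmod (w i)" "{..<N}"] by simp
  finally show ?thesis .
qed

lemma inner_seq_adj:
  assumes "T \<in> range (mat_op N)"
  shows "inner_seq N v (mat_adj N T w) = inner_seq N (T v) w"
proof -
  obtain M where T: "T = mat_op N M"
    using assms by blast
  have "inner_seq N v (mat_adj N T w) = (\<Sum>i<N. \<Sum>j<N. cnj (v i) * (cnj (M j i) * w j))"
    unfolding T mat_adj_mat_op inner_seq_def by (simp add: mat_op_def sum_distrib_left)
  also have "\<dots> = (\<Sum>j<N. \<Sum>i<N. cnj (M j i) * cnj (v i) * w j)"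
    by (subst sum.swap) (simp add: mult_ac)
  also have "\<dots> = inner_seq N (T v) w"
    by (simp add: T inner_seq_def mat_op_def sum_distrib_right)
  finally show ?thesis .
qed

lemma l2_square_eq:
  assumes "T \<in> range (mat_op N)"
  shows "complex_of_real ((l2 N (T v))\<^sup>2) = inner_seq N v ((mat_adj N T \<circ> T) v)"
  using inner_seq_adj[OF assms, of v "T v"] by (simp only: o_def inner_seq_self)

lemma mat_adj_closed: "mat_adj N T \<in> range (mat_op N)"
  by (simp add: mat_adj_def)

lemma mat_mult_closed: "T \<in> range (mat_op N) \<Longrightarrow> T' \<in> range (mat_op N) \<Longrightarrow> T \<circ> T' \<in> range (mat_op N)"
  by (auto simp: mat_op_mult)

lemma mat_adj_adj: "T \<in> range (mat_op N) \<Longrightarrow> mat_adj N (mat_adj N T) = T"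
  by (auto simp: mat_adj_mat_op)

lemma op_norm_mult:
  assumes "T \<in> range (mat_op N)" "T' \<in> range (mat_op N)"
  shows "op_norm N (T \<circ> T') \<le> op_norm N T * op_norm N T'"
proof (rule op_norm_leI)
  fix v assume "l2 N v \<le> 1"
  then have "l2 N (T' v) \<le> op_norm N T'"
    by (rule l2_le_op_norm_unit[OF assms(2)])
  then have "op_norm N T * l2 N (T' v) \<le> op_norm N T * op_norm N T'"
    using op_norm_nonneg[OF assms(1)] by (rule mult_left_mono)
  then show "l2 N ((T \<circ> T') v) \<le> op_norm N T * op_norm N T'"
    using l2_le_op_norm[OF assms(1), of "T' v"] by simp
qed

lemma op_norm_square_le:
  assumes T: "T \<in> range (mat_op N)"
  shows "(op_norm N T)\<^sup>2 \<le> op_norm N (mat_adj N T \<circ> T)"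
proof -
  have TT: "mat_adj N T \<circ> T \<in> range (mat_op N)"
    by (intro mat_mult_closed mat_adj_closed T)
  have "op_norm N T \<le> sqrt (op_norm N (mat_adj N T \<circ> T))"
  proof (rule op_norm_leI)
    fix v assume v: "l2 N v \<le> 1"
    have "(l2 N (T v))\<^sup>2 = cmod (inner_seq N v ((mat_adj N T \<circ> T) v))"
      by (simp only: l2_square_eq[OF T, symmetric] norm_of_real abs_power2)
    also have "\<dots> \<le> l2 N v * l2 N ((mat_adj N T \<circ> T) v)"
      by (rule cmod_inner_seq_le)
    also have "\<dots> \<le> 1 * op_norm N (mat_adj N T \<circ> T)"
      by (intro mult_mono v l2_le_op_norm_unit[OF TT v]) auto
    finally show "l2 N (T v) \<le> sqrt (op_norm N (mat_adj N T \<circ> T))"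
      by (simp add: real_le_rsqrt)
  qed
  then show ?thesis
    using op_norm_nonneg[OF T] op_norm_nonneg[OF TT]
      power_mono[of "op_norm N T" "sqrt (op_norm N (mat_adj N T \<circ> T))" 2] by simp
qed

lemma op_norm_cstar:
  assumes T: "T \<in> range (mat_op N)"
  shows "op_norm N (mat_adj N T \<circ> T) = (op_norm N T)\<^sup>2"
proof -
  have le: "op_norm N S \<le> op_norm N (mat_adj N S)" if S: "S \<in> range (mat_op N)" for S
  proof (cases "op_norm N S = 0")
    case True
    then show ?thesis using op_norm_nonneg[OF mat_adj_closed] by simp
  next
    case False
    have "op_norm N S * op_norm N S \<le> op_norm N (mat_adj N S) * op_norm N S"
      using op_norm_square_le[OF S] op_norm_mult[OF mat_adj_closed[of N S] S] by (simp add: power2_eq_square)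
    then show ?thesis
      using False op_norm_nonneg[OF S] by (simp add: mult_le_cancel_right)
  qed
  have "op_norm N (mat_adj N T) = op_norm N T"
    using le[OF T] le[OF mat_adj_closed, of T] by (simp add: mat_adj_adj[OF T])
  then show ?thesis
    using op_norm_square_le[OF T] op_norm_mult[OF mat_adj_closed[of N T] T] by (simp add: power2_eq_square)
qed

section \<open>Verification of the algebra axioms for matrices\<close>

lemma cring_complex_ring: "cring complex_ring"
proof (rule cringI)
  show "abelian_group complex_ring"
    by (rule abelian_groupI) (auto simp: complex_ring_def add.assoc intro: exI[of _ "- _"] left_minus)
  show "comm_monoid complex_ring"
    by (rule comm_monoidI) (auto simp: complex_ring_def)
qed (simp add: complex_ring_def distrib_right)

lemma complex_ring_simps [simp]:
  "carrier complex_ring = UNIV" "mult complex_ring = (*)" "one complex_ring = 1"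
  "zero complex_ring = 0" "add complex_ring = (+)"
  by (simp_all add: complex_ring_def)

lemma range_mat_op_add: "T \<in> range (mat_op N) \<Longrightarrow> T' \<in> range (mat_op N) \<Longrightarrow> (\<lambda>v i. T v i + T' v i) \<in> range (mat_op N)"
  by (auto simp: mat_op_add)

lemma range_mat_op_scale: "T \<in> range (mat_op N) \<Longrightarrow> (\<lambda>v i. c * T v i) \<in> range (mat_op N)"
  by (auto simp: mat_op_scale)

lemma abelian_group_mat_algebra: "abelian_group (mat_algebra N)"
proof (rule abelian_groupI)
  fix T assume T: "T \<in> carrier (mat_algebra N)"
  show "\<exists>T'\<in>carrier (mat_algebra N). T' \<oplus>\<^bsub>mat_algebra N\<^esub> T = \<zero>\<^bsub>mat_algebra N\<^esub>"
    by (rule bexI[of _ "\<lambda>v i. (-1) * T v i"]) (use T range_mat_op_scale[of T N "-1"] in auto)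
next
  show "\<zero>\<^bsub>mat_algebra N\<^esub> \<in> carrier (mat_algebra N)"
    by (simp add: mat_op_zero[of N])
qed (auto simp: range_mat_op_add algebra_simps)

lemma ring_mat_algebra: "ring (mat_algebra N)"
proof (rule ringI[OF abelian_group_mat_algebra])
  show "monoid (mat_algebra N)"
  proof (rule monoidI)
    show "\<one>\<^bsub>mat_algebra N\<^esub> \<in> carrier (mat_algebra N)"
      by (simp add: mat_op_one)
  qed (auto simp: mat_mult_closed o_assoc, auto simp: mat_op_def fun_eq_iff intro!: sum.cong)
qed (auto simp: fun_eq_iff mat_op_linear)

lemma module_mat_algebra: "Module.module complex_ring (mat_algebra N)"
  by (rule moduleI[OF cring_complex_ring abelian_group_mat_algebra])
     (auto simp: range_mat_op_scale distrib_left distrib_right mult.assoc)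

lemma mat_algebra_minus:
  assumes "S \<in> range (mat_op N)" "T \<in> range (mat_op N)"
  shows "S \<ominus>\<^bsub>mat_algebra N\<^esub> T = mat_op N (\<lambda>i j. entry S i j - entry T i j)"
proof -
  interpret ring "mat_algebra N" by (rule ring_mat_algebra)
  have "\<ominus>\<^bsub>mat_algebra N\<^esub> T = (\<lambda>v i. (- 1) * T v i)"
    by (rule minus_equality) (use assms range_mat_op_scale[of T N "-1"] in auto)
  then have "S \<ominus>\<^bsub>mat_algebra N\<^esub> T = (\<lambda>v i. S v i + (- 1) * T v i)"
    by (simp add: a_minus_def)
  also have "\<dots> = mat_op N (\<lambda>i j. entry S i j - entry T i j)"
    by (subst (1) mat_op_entry[OF assms(1), symmetric], subst (1) mat_op_entry[OF assms(2), symmetric])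
       (simp add: mat_op_def fun_eq_iff sum_subtractf left_diff_distrib)
  finally show ?thesis .
qed

lemma op_norm_eq_0_iff:
  assumes "T \<in> range (mat_op N)"
  shows "op_norm N T = 0 \<longleftrightarrow> T = (\<lambda>v i. 0)"
proof
  assume "op_norm N T = 0"
  then have "entry T i j = 0" if "i < N" "j < N" for i j
    using cmod_entry_le[OF assms that] by simp
  then have "mat_op N (entry T) = mat_op N (\<lambda>i j. 0)"
    by (intro mat_op_cong) auto
  then show "T = (\<lambda>v i. 0)"
    using mat_op_entry[OF assms] by (simp add: mat_op_zero[of N])
next
  assume "T = (\<lambda>v i. 0)"
  then show "op_norm N T = 0"
    using op_norm_mat_op_le[of N "\<lambda>i j. 0"] op_norm_nonneg[OF assms] by (simp add: mat_op_zero[of N])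
qed

lemma op_norm_triangle:
  assumes "S \<in> range (mat_op N)" "T \<in> range (mat_op N)"
  shows "op_norm N (\<lambda>v i. S v i + T v i) \<le> op_norm N S + op_norm N T"
proof (rule op_norm_leI)
  fix v assume v: "l2 N v \<le> 1"
  show "l2 N (\<lambda>i. S v i + T v i) \<le> op_norm N S + op_norm N T"
    by (rule order_trans[OF l2_triangle add_mono]) (rule l2_le_op_norm_unit[OF _ v]; rule assms)+
qed

lemma op_norm_scale:
  assumes "T \<in> range (mat_op N)"
  shows "op_norm N (\<lambda>v i. c * T v i) = cmod c * op_norm N T"
proof (rule antisym)
  have le: "op_norm N (\<lambda>v i. c * T v i) \<le> cmod c * op_norm N T" if T: "T \<in> range (mat_op N)" for T c
  proof (rule op_norm_leI)
    fix v assume "l2 N v \<le> 1"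
    then show "l2 N (\<lambda>i. c * T v i) \<le> cmod c * op_norm N T"
      unfolding l2_scale by (intro mult_left_mono l2_le_op_norm_unit[OF T]) auto
  qed
  show "op_norm N (\<lambda>v i. c * T v i) \<le> cmod c * op_norm N T"
    by (rule le[OF assms])
  show "cmod c * op_norm N T \<le> op_norm N (\<lambda>v i. c * T v i)"
  proof (cases "c = 0")
    case True
    then show ?thesis
      using op_norm_nonneg[OF range_mat_op_scale[OF assms, of c]] by simp
  next
    case False
    then have "T = (\<lambda>v i. inverse c * (c * T v i))"
      by (simp add: fun_eq_iff)
    then have "op_norm N T \<le> cmod (inverse c) * op_norm N (\<lambda>v i. c * T v i)"
      using le[OF range_mat_op_scale[OF assms, of c], of "inverse c"] by simp
    then show ?thesis
      using False by (simp add: norm_inverse norm_divide field_simps)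
  qed
qed

lemma mat_algebra_metric: "Metric_space (range (mat_op N)) (cdist (mat_algebra N))"
proof
  have cd: "cdist (mat_algebra N) S T = op_norm N (mat_op N (\<lambda>i j. entry S i j - entry T i j))"
    if "S \<in> range (mat_op N)" "T \<in> range (mat_op N)" for S T
    using that by (simp add: cdist_def mat_algebra_minus)
  fix R S T
  show "0 \<le> cdist (mat_algebra N) S T"
    by (auto simp: cdist_def mat_algebra_minus intro: op_norm_nonneg)
  show "cdist (mat_algebra N) S T = cdist (mat_algebra N) T S"
  proof (cases "S \<in> range (mat_op N) \<and> T \<in> range (mat_op N)")
    case True
    have "mat_op N (\<lambda>i j. entry T i j - entry S i j)
        = (\<lambda>v i. (- 1) * mat_op N (\<lambda>i j. entry S i j - entry T i j) v i)"
      by (simp only: mat_op_scale) simp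
    then show ?thesis
      using op_norm_scale[of "mat_op N (\<lambda>i j. entry S i j - entry T i j)" N "-1"] True
      by (simp add: cd)
  qed (auto simp: cdist_def)
  show "cdist (mat_algebra N) S T = 0 \<longleftrightarrow> S = T" if ST: "S \<in> range (mat_op N)" "T \<in> range (mat_op N)"
  proof
    assume "cdist (mat_algebra N) S T = 0"
    then have 0: "op_norm N (mat_op N (\<lambda>i j. entry S i j - entry T i j)) = 0"
      by (simp add: cd ST)
    have "entry S i j = entry T i j" if "i < N" "j < N" for i j
      using cmod_entry_le[OF rangeI that, of "\<lambda>i j. entry S i j - entry T i j"]
      by (simp add: entry_mat_op that 0)
    then have "mat_op N (entry S) = mat_op N (entry T)"
      by (rule mat_op_cong)
    then show "S = T"
      by (simp only: mat_op_entry ST)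
  next
    assume "S = T"
    then show "cdist (mat_algebra N) S T = 0"
      using op_norm_eq_0_iff[of "mat_op N (\<lambda>i j. 0)" N] ST by (simp add: cd mat_op_zero[of N])
  qed
  show "cdist (mat_algebra N) R T \<le> cdist (mat_algebra N) R S + cdist (mat_algebra N) S T"
    if "R \<in> range (mat_op N)" "S \<in> range (mat_op N)" "T \<in> range (mat_op N)"
    using op_norm_triangle[of "mat_op N (\<lambda>i j. entry R i j - entry S i j)" N
        "mat_op N (\<lambda>i j. entry S i j - entry T i j)"] that
    by (simp add: cd mat_op_add)
qed

lemma mat_algebra_complete: "Metric_space.mcomplete (range (mat_op N)) (cdist (mat_algebra N))"
proof -
  interpret Metric_space "range (mat_op N)" "cdist (mat_algebra N)"
    by (rule mat_algebra_metric)
  have cd: "cdist (mat_algebra N) S T = op_norm N (mat_op N (\<lambda>i j. entry S i j - entry T i j))"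
    if "S \<in> range (mat_op N)" "T \<in> range (mat_op N)" for S T
    using that by (simp add: cdist_def mat_algebra_minus)
  show ?thesis
    unfolding mcomplete_def
  proof (intro allI impI)
    fix \<sigma> assume \<sigma>: "MCauchy \<sigma>"
    then have mem: "\<sigma> n \<in> range (mat_op N)" for n
      by (auto simp: MCauchy_def)
    have "Cauchy (\<lambda>n. entry (\<sigma> n) i j)" if "i < N" "j < N" for i j
    proof (rule CauchyI)
      fix e :: real assume "e > 0"
      then obtain K where K: "\<And>n n'. K \<le> n \<Longrightarrow> K \<le> n' \<Longrightarrow> cdist (mat_algebra N) (\<sigma> n) (\<sigma> n') < e"
        using \<sigma> unfolding MCauchy_def by metis
      have "norm (entry (\<sigma> n) i j - entry (\<sigma> n') i j) < e" if "n \<ge> K" "n' \<ge> K" for n n'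
        using cmod_entry_le[OF rangeI \<open>i < N\<close> \<open>j < N\<close>, of "\<lambda>i j. entry (\<sigma> n) i j - entry (\<sigma> n') i j"]
          K[OF that] by (simp add: cd mem entry_mat_op \<open>i < N\<close> \<open>j < N\<close>)
      then show "\<exists>K. \<forall>n\<ge>K. \<forall>n'\<ge>K. norm (entry (\<sigma> n) i j - entry (\<sigma> n') i j) < e"
        by blast
    qed
    then have lim: "(\<lambda>n. entry (\<sigma> n) i j) \<longlonglongrightarrow> lim (\<lambda>n. entry (\<sigma> n) i j)" if "i < N" "j < N" for i j
      using that by (simp add: Cauchy_convergent_iff convergent_LIMSEQ_iff)
    define L where "L i j = lim (\<lambda>n. entry (\<sigma> n) i j)" for i j
    have "limitin mtopology \<sigma> (mat_op N L) sequentially"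
    proof (rule limitin_metric[THEN iffD2], intro conjI allI impI)
      fix e :: real assume "e > 0"
      have "(\<lambda>n. \<Sum>i<N. \<Sum>j<N. cmod (entry (\<sigma> n) i j - L i j)) \<longlonglongrightarrow> (\<Sum>i<N. \<Sum>j<N. cmod (L i j - L i j))"
        by (intro tendsto_sum tendsto_norm tendsto_diff tendsto_const) (auto simp: L_def lim)
      then have "eventually (\<lambda>n. (\<Sum>i<N. \<Sum>j<N. cmod (entry (\<sigma> n) i j - L i j)) < e) sequentially"
        using \<open>e > 0\<close> by (intro order_tendstoD(2)) auto
      then show "\<forall>\<^sub>F n in sequentially. \<sigma> n \<in> range (mat_op N) \<and> cdist (mat_algebra N) (\<sigma> n) (mat_op N L) < e"
      proof eventually_elim
        case (elim n)
        have "mat_op N (\<lambda>i j. entry (\<sigma> n) i j - entry (mat_op N L) i j) = mat_op N (\<lambda>i j. entry (\<sigma> n) i j - L i j)"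
          by (rule mat_op_cong) (simp add: entry_mat_op)
        then show ?case
          using elim op_norm_mat_op_le[of N "\<lambda>i j. entry (\<sigma> n) i j - L i j"] by (simp add: cd mem)
      qed
    qed simp
    then show "\<exists>x. limitin mtopology \<sigma> x sequentially" by blast
  qed
qed

lemma cstar_algebra_mat_algebra: "cstar_algebra (mat_algebra N)"
proof (rule cstar_algebra.intro[OF module_mat_algebra ring_mat_algebra], unfold_locales)
  fix S T :: seq_map and c
  show "adj (mat_algebra N) (S \<otimes>\<^bsub>mat_algebra N\<^esub> T) = adj (mat_algebra N) T \<otimes>\<^bsub>mat_algebra N\<^esub> adj (mat_algebra N) S"
    if "S \<in> carrier (mat_algebra N)" "T \<in> carrier (mat_algebra N)"
    using that by (auto simp: mat_op_mult mat_adj_mat_op mult.commute)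
  show "adj (mat_algebra N) (S \<oplus>\<^bsub>mat_algebra N\<^esub> T) = adj (mat_algebra N) S \<oplus>\<^bsub>mat_algebra N\<^esub> adj (mat_algebra N) T"
    if "S \<in> carrier (mat_algebra N)" "T \<in> carrier (mat_algebra N)"
    using that by (auto simp: mat_op_add mat_adj_mat_op)
  show "adj (mat_algebra N) (c \<odot>\<^bsub>mat_algebra N\<^esub> T) = cnj c \<odot>\<^bsub>mat_algebra N\<^esub> adj (mat_algebra N) T"
    if "T \<in> carrier (mat_algebra N)"
    using that by (auto simp: mat_op_scale mat_adj_mat_op)
qed (auto simp: mat_adj_closed mat_adj_adj mat_adj_mat_op mat_op_add mat_op_scale op_norm_nonneg
    op_norm_eq_0_iff op_norm_triangle op_norm_scale op_norm_mult op_norm_cstar mat_algebra_complete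
    mat_op_linear fun_eq_iff)

section \<open>Representations on finite cyclic groups\<close>

definition diag_op :: "nat \<Rightarrow> int \<Rightarrow> seq_map" where
  "diag_op N g = mat_op N (\<lambda>i j. if i = j then unity_root N (int i * g) else 0)"

text \<open>Composition with multiplication by \<open>c\<close> modulo \<open>N\<close>; a
  permutation matrix when \<open>c\<close> is a unit modulo \<open>N\<close>.\<close>

definition perm_op :: "nat \<Rightarrow> int \<Rightarrow> seq_map" where
  "perm_op N c = mat_op N (\<lambda>i j. if int j = c * int i mod int N then 1 else 0)"

lemma diag_op_apply: "diag_op N g v = (\<lambda>i. if i < N then unity_root N (int i * g) * v i else 0)"
  by (auto simp: diag_op_def mat_op_def fun_eq_iff if_distrib[of "\<lambda>x. x * _"] cong: if_cong)

lemma perm_op_apply: "perm_op N c v = (\<lambda>i. if i < N then v (nat (c * int i mod int N)) else 0)"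
proof -
  have "(\<Sum>j<N. (if int j = c * int i mod int N then 1 else 0) * v j) = v (nat (c * int i mod int N))"
    if "i < N" for i
  proof -
    have "int j = c * int i mod int N \<longleftrightarrow> j = nat (c * int i mod int N)" for j
      using that by (auto simp: nat_eq_iff)
    moreover have "nat (c * int i mod int N) < N"
      using that by (simp add: nat_less_iff)
    ultimately show ?thesis
      by (simp add: mult_delta_left)
  qed
  then show ?thesis
    by (auto simp: perm_op_def mat_op_def fun_eq_iff)
qed

lemma diag_op_closed: "diag_op N g \<in> range (mat_op N)"
  by (simp add: diag_op_def)

lemma perm_op_closed: "perm_op N c \<in> range (mat_op N)"
  by (simp add: perm_op_def)

lemma diag_op_mult: "diag_op N g \<circ> diag_op N h = diag_op N (g + h)"
  by (auto simp: diag_op_apply fun_eq_iff distrib_left unity_root_add)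

lemma perm_op_mult: "perm_op N c \<circ> perm_op N d = perm_op N (c * d)"
proof (intro ext)
  fix v i
  show "(perm_op N c \<circ> perm_op N d) v i = perm_op N (c * d) v i"
  proof (cases "i < N")
    case True
    then have "nat (c * int i mod int N) < N"
      by (simp add: nat_less_iff)
    moreover have "d * (c * int i mod int N) mod int N = c * d * int i mod int N"
      by (simp add: mod_mult_right_eq mult_ac)
    ultimately show ?thesis
      using True by (simp add: perm_op_apply)
  qed (simp add: perm_op_apply)
qed

lemma perm_op_cong:
  assumes "c mod int N = d mod int N" shows "perm_op N c = perm_op N d"
  unfolding perm_op_def by (intro mat_op_cong) (metis assms mod_mult_left_eq)

lemma diag_op_0: "diag_op N 0 = \<one>\<^bsub>mat_algebra N\<^esub>"
  by (auto simp: diag_op_apply fun_eq_iff)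

lemma perm_op_1: "perm_op N 1 = \<one>\<^bsub>mat_algebra N\<^esub>"
  by (auto simp: perm_op_apply fun_eq_iff)

lemma adj_diag_op: "mat_adj N (diag_op N g) = diag_op N (- g)"
  unfolding diag_op_def mat_adj_mat_op by (rule mat_op_cong) (auto simp: cnj_unity_root)

lemma adj_perm_op:
  assumes "c * d mod int N = 1 mod int N"
  shows "mat_adj N (perm_op N c) = perm_op N d"
  unfolding perm_op_def mat_adj_mat_op
proof (rule mat_op_cong)
  have *: "int j = d * int i mod int N" if "int i = c * int j mod int N" "j < N"
    and cd: "c * d mod int N = 1 mod int N" for i j c d
  proof -
    have "d * int i mod int N = d * (c * int j) mod int N"
      unfolding that(1) by (simp add: mod_mult_right_eq)
    also have "\<dots> = int j * (c * d) mod int N"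
      by (simp add: mult_ac)
    also have "\<dots> = int j * (c * d mod int N) mod int N"
      by (simp only: mod_mult_right_eq)
    also have "\<dots> = int j"
      unfolding cd using that(2) by (simp add: mod_mult_right_eq)
    finally show ?thesis by simp
  qed
  fix i j assume ij: "i < N" "j < N"
  have dc: "d * c mod int N = 1 mod int N"
    using assms by (simp only: mult.commute)
  have "int i = c * int j mod int N \<longleftrightarrow> int j = d * int i mod int N"
    using *[OF _ ij(2) assms, of i] *[OF _ ij(1) dc, of j] by blast
  then show "cnj (if int i = c * int j mod int N then 1 else 0) = (if int j = d * int i mod int N then 1 else 0)"
    by (simp only: if_distrib[of cnj] complex_cnj_one complex_cnj_zero)
qed

text \<open>On functions on the integers modulo \<open>N\<close>, \<open>u\<close> acts by
  characters and \<open>s p\<close> by composition with multiplication by \<open>a ^ p\<close>,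
  where \<open>a\<close> is an inverse of \<open>m\<close>. Pulling the character of
  \<open>g * m ^ p\<close> back along this map cancels \<open>m ^ p\<close> against
  \<open>a ^ p\<close>, which is the covariance relation.\<close>

lemma OZE1_relations_mat_algebra:
  assumes "N > 0" and a: "a * m mod int N = 1 mod int N"
  shows "OZE1_relations m (mat_algebra N) (diag_op N) (\<lambda>p. perm_op N (a ^ p))"
proof -
  have am: "a ^ p * m ^ p mod int N = 1 mod int N" for p
    by (metis a power_mod power_mult_distrib power_one)
  have adj: "mat_adj N (perm_op N (a ^ p)) = perm_op N (m ^ p)" for p
    by (rule adj_perm_op[OF am])
  have inv: "perm_op N (a ^ p * m ^ p) = \<one>\<^bsub>mat_algebra N\<^esub>" for p
    using perm_op_cong[OF am[of p]] perm_op_1 by simp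
  have cov: "diag_op N g \<circ> perm_op N (a ^ p) = perm_op N (a ^ p) \<circ> diag_op N (g * m ^ p)" for g p
  proof (intro ext)
    fix v i
    show "(diag_op N g \<circ> perm_op N (a ^ p)) v i = (perm_op N (a ^ p) \<circ> diag_op N (g * m ^ p)) v i"
    proof (cases "i < N")
      case True
      let ?j = "a ^ p * int i mod int N"
      have j: "nat ?j < N" "int (nat ?j) = ?j"
        using assms(1) by (auto simp: nat_less_iff)
      have "?j * (g * m ^ p) mod int N = a ^ p * int i * (g * m ^ p) mod int N"
        by (simp only: mod_mult_left_eq)
      also have "\<dots> = int i * g * (a ^ p * m ^ p) mod int N"
        by (simp add: mult_ac)
      also have "\<dots> = int i * g * (a ^ p * m ^ p mod int N) mod int N"
        by (simp only: mod_mult_right_eq)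
      also have "\<dots> = int i * g mod int N"
        unfolding am by (simp add: mod_mult_right_eq)
      finally have "int N dvd ?j * (g * m ^ p) - int i * g"
        by (simp add: mod_eq_dvd_iff)
      then have "unity_root N (?j * (g * m ^ p) - int i * g) = 1"
        by (simp only: unity_root_eq_1_iff[OF assms(1)])
      then have "unity_root N (?j * (g * m ^ p)) = unity_root N (int i * g)"
        using unity_root_add[of N "?j * (g * m ^ p) - int i * g" "int i * g"] by simp
      then show ?thesis
        using True j by (simp add: diag_op_apply perm_op_apply)
    qed (simp add: diag_op_apply perm_op_apply)
  qed
  have inv': "perm_op N (m ^ p * a ^ p) = \<one>\<^bsub>mat_algebra N\<^esub>" for p
    using inv[of p] by (simp only: mult.commute)
  show ?thesis
    unfolding OZE1_relations_def
  proof (intro conjI allI)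
    show "unitary_in (mat_algebra N) (diag_op N g)" for g
      by (simp add: unitary_in_def diag_op_closed adj_diag_op diag_op_mult diag_op_0)
    show "isometry_in (mat_algebra N) (perm_op N (a ^ p))" for p
      by (simp add: isometry_in_def perm_op_closed adj perm_op_mult inv')
    show "perm_op N (a ^ p) \<otimes>\<^bsub>mat_algebra N\<^esub> adj (mat_algebra N) (perm_op N (a ^ p)) = \<one>\<^bsub>mat_algebra N\<^esub>" for p
      by (simp add: adj perm_op_mult inv)
  qed (simp_all add: diag_op_mult perm_op_mult power_add cov restriction_def)
qed

section \<open>A C*-algebra as a type\<close>

text \<open>A type cannot depend on the algebra of the theorem. It is therefore built from a
  counterexample to the theorem, if there is one, and the theorem follows by contradiction.\<close>

definition counterexample :: "'a cstar \<Rightarrow> bool" where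
  "counterexample A \<longleftrightarrow> (\<exists>m u s \<gamma>. m \<noteq> 0 \<and> is_OZE1 m A u s \<and> gauge_action A u s \<gamma> \<and>
     \<not> (relative_commutant A (fixed_point_algebra A \<gamma>)
           = closed_span A {spanning_element A u s p l q | p q l. m ^ p = m ^ q}
        \<and> cartan_subalgebra A (relative_commutant A (fixed_point_algebra A \<gamma>))))"

text \<open>The zero algebra, a default that makes \<open>model_algebra\<close> a C*-algebra in
  every case.\<close>

definition trivial_cstar :: "'a cstar" where
  "trivial_cstar = \<lparr>carrier = {undefined}, mult = (\<lambda>_ _. undefined), one = undefined,
     zero = undefined, add = (\<lambda>_ _. undefined), smult = (\<lambda>_ _. undefined),
     adj = (\<lambda>_. undefined), nrm = (\<lambda>_. 0)\<rparr>"

definition model_algebra :: "'a cstar" where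
  "model_algebra = (if \<exists>A::'a cstar. counterexample A then SOME A. counterexample A else trivial_cstar)"

lemma cstar_algebra_trivial: "cstar_algebra (trivial_cstar :: 'a cstar)"
proof -
  have ag: "abelian_group trivial_cstar"
    by (rule abelian_groupI) (auto simp: trivial_cstar_def)
  have ring: "ring trivial_cstar"
    by (rule ringI[OF ag monoidI]) (auto simp: trivial_cstar_def)
  have module: "Module.module complex_ring trivial_cstar"
    by (rule moduleI[OF cring_complex_ring ag]) (auto simp: trivial_cstar_def)
  interpret Metric_space "carrier (trivial_cstar :: 'a cstar)" "cdist (trivial_cstar :: 'a cstar)"
    by unfold_locales (auto simp: cdist_def trivial_cstar_def)
  have mcomplete
    unfolding mcomplete_def
  proof (intro allI impI)
    fix \<sigma> assume "MCauchy \<sigma>"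
    then have "range \<sigma> \<subseteq> carrier (trivial_cstar :: 'a cstar)"
      by (simp add: MCauchy_def)
    then have "\<sigma> = (\<lambda>_. undefined)"
      by (auto simp: trivial_cstar_def)
    moreover have "undefined \<in> topspace mtopology"
      unfolding topspace_mtopology by (simp add: trivial_cstar_def)
    ultimately show "\<exists>x. limitin mtopology \<sigma> x sequentially"
      by (intro exI[of _ undefined]) simp
  qed
  then show ?thesis
    by (intro cstar_algebra.intro[OF module ring] cstar_algebra_axioms.intro)
       (auto simp: trivial_cstar_def)
qed

lemma cstar_algebra_model: "cstar_algebra (model_algebra :: 'a cstar)"
proof (cases "\<exists>A::'a cstar. counterexample A")
  case True
  then have "counterexample (model_algebra :: 'a cstar)"
    by (simp add: model_algebra_def someI_ex)
  then show ?thesis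
    by (auto simp: counterexample_def is_OZE1_def)
qed (simp add: model_algebra_def cstar_algebra_trivial)

interpretation M: cstar_algebra "model_algebra :: 'a cstar"
  by (rule cstar_algebra_model)

typedef 'a model = "carrier (model_algebra :: 'a cstar)"
  by (rule exI[of _ "\<zero>\<^bsub>model_algebra\<^esub>"]) simp

setup_lifting type_definition_model

instantiation model :: (type) "{real_normed_algebra, monoid_mult}"
begin

lift_definition plus_model :: "'a model \<Rightarrow> 'a model \<Rightarrow> 'a model" is "add model_algebra"
  by simp

lift_definition zero_model :: "'a model" is "zero model_algebra"
  by simp

lift_definition uminus_model :: "'a model \<Rightarrow> 'a model" is "a_inv model_algebra"
  by simp

lift_definition minus_model :: "'a model \<Rightarrow> 'a model \<Rightarrow> 'a model" is "a_minus model_algebra"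
  by simp

lift_definition times_model :: "'a model \<Rightarrow> 'a model \<Rightarrow> 'a model" is "mult model_algebra"
  by simp

lift_definition one_model :: "'a model" is "one model_algebra"
  by simp

lift_definition scaleR_model :: "real \<Rightarrow> 'a model \<Rightarrow> 'a model" is "\<lambda>r. smult model_algebra (complex_of_real r)"
  by simp

lift_definition norm_model :: "'a model \<Rightarrow> real" is "nrm model_algebra" .

definition dist_model :: "'a model \<Rightarrow> 'a model \<Rightarrow> real" where
  "dist_model x y = norm (x - y)"

definition sgn_model :: "'a model \<Rightarrow> 'a model" where
  "sgn_model x = inverse (norm x) *\<^sub>R x"

definition uniformity_model :: "('a model \<times> 'a model) filter" where
  "uniformity_model = (INF e\<in>{0<..}. principal {(x, y). dist x y < e})"

definition open_model :: "'a model set \<Rightarrow> bool" where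
  "open_model U \<longleftrightarrow> (\<forall>x\<in>U. \<forall>\<^sub>F (x', y) in uniformity. x' = x \<longrightarrow> y \<in> U)"

instance
proof
  fix x y z :: "'a model" and a b :: real and U :: "'a model set"
  show "x + y + z = x + (y + z)"
    by transfer (rule M.a_assoc)
  show "x + y = y + x"
    by transfer (rule M.a_comm)
  show "0 + x = x"
    by transfer simp
  show "- x + x = 0"
    by transfer (rule M.l_neg)
  show "x - y = x + - y"
    by transfer (simp add: a_minus_def)
  show "x * y * z = x * (y * z)"
    by transfer (rule M.m_assoc)
  show "(x + y) * z = x * z + y * z"
    by transfer (rule M.l_distr)
  show "x * (y + z) = x * y + x * z"
    by transfer (rule M.r_distr)
  show "1 * x = x"
    by transfer simp
  show "x * 1 = x"
    by transfer simp
  show "a *\<^sub>R (x + y) = a *\<^sub>R x + a *\<^sub>R y"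
    by transfer (simp add: M.smult_r_distr)
  show "(a + b) *\<^sub>R x = a *\<^sub>R x + b *\<^sub>R x"
    by transfer (use M.smult_l_distr in simp)
  show "a *\<^sub>R b *\<^sub>R x = (a * b) *\<^sub>R x"
    by transfer (simp add: M.smult_assoc1[simplified])
  show "1 *\<^sub>R x = x"
    by transfer (use M.smult_one in simp)
  show "a *\<^sub>R x * y = a *\<^sub>R (x * y)"
    by transfer (rule M.smult_mult_left)
  show "x * a *\<^sub>R y = a *\<^sub>R (x * y)"
    by transfer (rule M.smult_mult_right)
  show "dist x y = norm (x - y)"
    by (rule dist_model_def)
  show "sgn x = inverse (norm x) *\<^sub>R x"
    by (rule sgn_model_def)
  show "uniformity = (INF e\<in>{0<..}. principal {(x::'a model, y). dist x y < e})"
    by (rule uniformity_model_def)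
  show "open U \<longleftrightarrow> (\<forall>x\<in>U. \<forall>\<^sub>F (x', y) in uniformity. x' = x \<longrightarrow> y \<in> U)"
    by (rule open_model_def)
  show "norm x = 0 \<longleftrightarrow> x = 0"
    by transfer (rule M.nrm_eq_0_iff)
  show "norm (x + y) \<le> norm x + norm y"
    by transfer (rule M.nrm_triangle)
  show "norm (a *\<^sub>R x) = \<bar>a\<bar> * norm x"
    by transfer (simp add: M.nrm_smult)
  show "norm (x * y) \<le> norm x * norm y"
    by transfer (rule M.nrm_mult)
qed

end

lemma cdist_Rep_model: "cdist model_algebra (Rep_model x) (Rep_model y) = dist x y"
  using Rep_model[of x] Rep_model[of y]
  by (simp add: cdist_def dist_model_def norm_model.rep_eq minus_model.rep_eq)

instance model :: (type) banach
proof
  fix X :: "nat \<Rightarrow> 'a model"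
  assume X: "Cauchy X"
  have "M.cmetric.MCauchy (\<lambda>n. Rep_model (X n))"
    unfolding M.cmetric.MCauchy_def
    using Rep_model metric_CauchyD[OF X] by (auto simp: cdist_Rep_model)
  then obtain l where l: "limitin (norm_topology model_algebra) (\<lambda>n. Rep_model (X n)) l sequentially"
    using M.complete by (auto simp: M.cmetric.mcomplete_def)
  then have "l \<in> carrier model_algebra"
    by (rule M.cmetric.limitin_mspace)
  then obtain x where x: "l = Rep_model x"
    by (metis Abs_model_inverse)
  have "X \<longlonglongrightarrow> x"
    unfolding tendsto_iff
  proof (intro allI impI)
    fix e :: real assume "e > 0"
    then have "eventually (\<lambda>n. Rep_model (X n) \<in> carrier model_algebra \<and>
        cdist model_algebra (Rep_model (X n)) (Rep_model x) < e) sequentially"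
      using l by (simp only: M.cmetric.limitin_metric x)
    then show "eventually (\<lambda>n. dist (X n) x < e) sequentially"
      by eventually_elim (simp add: cdist_Rep_model)
  qed
  then show "convergent X"
    by (rule convergentI)
qed

instantiation model :: (type) cstar_type
begin

lift_definition scaleC_model :: "complex \<Rightarrow> 'a model \<Rightarrow> 'a model" is "smult model_algebra"
  by simp

lift_definition star_model :: "'a model \<Rightarrow> 'a model" is "adj model_algebra"
  by (rule M.adj_closed)

instance
proof
  fix x y z :: "'a model" and c d :: complex and a :: real
  show "c *\<^sub>C (x + y) = c *\<^sub>C x + c *\<^sub>C y"
    by transfer (simp add: M.smult_r_distr)
  show "(c + d) *\<^sub>C x = c *\<^sub>C x + d *\<^sub>C x"
    by transfer (use M.smult_l_distr in simp)
  show "c *\<^sub>C d *\<^sub>C x = (c * d) *\<^sub>C x"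
    by transfer (simp add: M.smult_assoc1[simplified])
  show "a *\<^sub>R x = complex_of_real a *\<^sub>C x"
    by transfer simp
  show "c *\<^sub>C x * y = c *\<^sub>C (x * y)"
    by transfer (rule M.smult_mult_left)
  show "x * c *\<^sub>C y = c *\<^sub>C (x * y)"
    by transfer (rule M.smult_mult_right)
  show "norm (c *\<^sub>C x) = cmod c * norm x"
    by transfer (rule M.nrm_smult)
  show "star (star x) = x"
    by transfer (rule M.adj_adj)
  show "star (x + y) = star x + star y"
    by transfer (rule M.adj_add)
  show "star (c *\<^sub>C x) = cnj c *\<^sub>C star x"
    by transfer (rule M.adj_smult)
  show "star (x * y) = star y * star x"
    by transfer (rule M.adj_mult)
  show "norm (star x * x) = (norm x)\<^sup>2"
    by transfer (rule M.cstar_identity)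
qed

end

section \<open>Transfer between the type and the carrier\<close>

lemmas Rep_model_simps = plus_model.rep_eq zero_model.rep_eq uminus_model.rep_eq minus_model.rep_eq
  times_model.rep_eq one_model.rep_eq scaleC_model.rep_eq star_model.rep_eq norm_model.rep_eq

lemma range_Rep_model: "range Rep_model = carrier model_algebra"
  using type_definition.Rep_range[OF type_definition_model] .

lemma closedin_Rep_image: "closedin (norm_topology model_algebra) (Rep_model ` X) \<longleftrightarrow> closed X"
proof -
  have "closedin (norm_topology model_algebra) (Rep_model ` X) \<longleftrightarrow>
      (\<forall>x. x \<notin> X \<longrightarrow> (\<exists>r>0. \<forall>y\<in>X. \<not> dist x y < r))"
    unfolding M.cmetric.closedin_metric
  proof (intro iffI conjI allI impI; (elim conjE)?)
    fix x assume *: "\<forall>x. x \<in> carrier model_algebra - Rep_model ` X \<longrightarrow>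
        (\<exists>r>0. disjnt (Rep_model ` X) (M.cmetric.mball x r))" and "x \<notin> X"
    then have "Rep_model x \<in> carrier model_algebra - Rep_model ` X"
      using Rep_model by (auto simp: Rep_model_inject)
    with * obtain r where "r > 0" "disjnt (Rep_model ` X) (M.cmetric.mball (Rep_model x) r)"
      by blast
    then show "\<exists>r>0. \<forall>y\<in>X. \<not> dist x y < r"
      using Rep_model by (intro exI[of _ r]) (auto simp: disjnt_iff simp flip: cdist_Rep_model)
  next
    fix x assume *: "\<forall>x. x \<notin> X \<longrightarrow> (\<exists>r>0. \<forall>y\<in>X. \<not> dist x y < r)"
      and x: "x \<in> carrier model_algebra - Rep_model ` X"
    then obtain x' where x': "x = Rep_model x'"
      by (metis Abs_model_inverse DiffD1)
    then have "x' \<notin> X" using x by auto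
    with * obtain r where "r > 0" "\<forall>y\<in>X. \<not> dist x' y < r"
      by blast
    then show "\<exists>r>0. disjnt (Rep_model ` X) (M.cmetric.mball x r)"
      by (intro exI[of _ r]) (auto simp: disjnt_iff x' cdist_Rep_model)
  next
    show "Rep_model ` X \<subseteq> carrier model_algebra"
      using Rep_model by blast
  qed
  also have "\<dots> \<longleftrightarrow> closed X"
  proof -
    have "(\<exists>r>0. \<forall>y\<in>X. \<not> dist x y < r) \<longleftrightarrow> (\<exists>r>0. \<forall>y. dist y x < r \<longrightarrow> y \<in> - X)" for x
      by (metis ComplD ComplI dist_commute)
    then show ?thesis
      by (simp only: closed_def open_dist Ball_def Compl_iff)
  qed
  finally show ?thesis .
qed

lemma closure_Rep_image:
  "norm_topology model_algebra closure_of (Rep_model ` X) = Rep_model ` closure X"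
proof (rule closure_of_unique)
  show "Rep_model ` X \<subseteq> Rep_model ` closure X"
    using closure_subset by blast
  show "closedin (norm_topology model_algebra) (Rep_model ` closure X)"
    by (simp add: closedin_Rep_image)
  fix T assume T: "Rep_model ` X \<subseteq> T" "closedin (norm_topology model_algebra) T"
  then have "T = Rep_model ` (Rep_model -` T)"
    using closedin_subset[OF T(2)] by (auto simp: image_vimage_eq range_Rep_model)
  then have "closed (Rep_model -` T)"
    using T(2) closedin_Rep_image by metis
  then have "closure X \<subseteq> Rep_model -` T"
    using T(1) by (intro closure_minimal) auto
  then show "Rep_model ` closure X \<subseteq> T" by blast
qed

lemma submodule_Rep_image: "submodule (Rep_model ` X) complex_ring model_algebra \<longleftrightarrow> csubspace X"
proof
  assume sub: "submodule (Rep_model ` X) complex_ring model_algebra"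
  note E = M.submoduleE[OF sub]
  have scale: "c *\<^sub>C x \<in> X" if "x \<in> X" for c x
  proof -
    have "Rep_model (c *\<^sub>C x) \<in> Rep_model ` X"
      using E(4)[of c "Rep_model x"] that by (simp add: scaleC_model.rep_eq)
    then show ?thesis by (auto simp: Rep_model_inject)
  qed
  show "csubspace X"
  proof (rule csubspaceI[OF _ _ scale])
    obtain x where "x \<in> X" using E(2) by blast
    then show "0 \<in> X" using scale[of x 0] by simp
    show "x + y \<in> X" if "x \<in> X" "y \<in> X" for x y
    proof -
      have "Rep_model (x + y) \<in> Rep_model ` X"
        using E(5)[of "Rep_model x" "Rep_model y"] that by (simp add: plus_model.rep_eq)
      then show ?thesis by (auto simp: Rep_model_inject)
    qed
  qed
next
  assume X: "csubspace X"
  show "submodule (Rep_model ` X) complex_ring model_algebra"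
  proof (rule M.submoduleI)
    show "Rep_model ` X \<subseteq> carrier model_algebra"
      using Rep_model by blast
    show "\<zero>\<^bsub>model_algebra\<^esub> \<in> Rep_model ` X"
      using csubspace_0[OF X] zero_model.rep_eq by (metis imageI)
    show "\<ominus>\<^bsub>model_algebra\<^esub> a \<in> Rep_model ` X" if "a \<in> Rep_model ` X" for a
      using that csubspace_diff[OF X csubspace_0[OF X]]
      by (auto simp flip: uminus_model.rep_eq intro!: imageI)
    show "a \<oplus>\<^bsub>model_algebra\<^esub> b \<in> Rep_model ` X" if "a \<in> Rep_model ` X" "b \<in> Rep_model ` X" for a b
      using that csubspace_add[OF X] by (auto simp flip: plus_model.rep_eq)
    show "a \<odot>\<^bsub>model_algebra\<^esub> x \<in> Rep_model ` X" if "x \<in> Rep_model ` X" for a x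
      using that csubspace_scaleC[OF X] by (auto simp flip: scaleC_model.rep_eq)
  qed
qed

lemma cstar_subalgebra_Rep_image:
  "cstar_subalgebra model_algebra (Rep_model ` X) \<longleftrightarrow>
     csubspace X \<and> closed X \<and> (\<forall>x\<in>X. \<forall>y\<in>X. x * y \<in> X) \<and> (\<forall>x\<in>X. star x \<in> X)"
  unfolding cstar_subalgebra_def submodule_Rep_image closedin_Rep_image
  by (auto simp flip: times_model.rep_eq star_model.rep_eq simp: inj_image_mem_iff inj_def Rep_model_inject)

lemma closed_span_Rep_image:
  assumes B: "csubspace B" "closed B" "G \<subseteq> B" "\<And>X. csubspace X \<Longrightarrow> G \<subseteq> X \<Longrightarrow> B \<subseteq> closure X"
  shows "closed_span model_algebra (Rep_model ` G) = Rep_model ` B"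
proof -
  define H where "H = csubspace hull G"
  have H: "csubspace H"
    unfolding H_def by (rule hull_in) (auto intro: csubspace_Inter)
  have "(\<lambda>V. submodule V complex_ring model_algebra) hull (Rep_model ` G) = Rep_model ` H"
  proof (rule hull_unique)
    show "Rep_model ` G \<subseteq> Rep_model ` H"
      unfolding H_def by (intro image_mono hull_subset)
    show "submodule (Rep_model ` H) complex_ring model_algebra"
      by (simp add: submodule_Rep_image H)
    fix V assume V: "Rep_model ` G \<subseteq> V" "submodule V complex_ring model_algebra"
    have "V = Rep_model ` (Rep_model -` V)"
      using M.submoduleE(1)[OF V(2)] by (auto simp: image_vimage_eq range_Rep_model)
    then have "csubspace (Rep_model -` V)"
      using V(2) submodule_Rep_image by metis
    then have "H \<subseteq> Rep_model -` V"
      unfolding H_def using V(1) by (intro hull_minimal) auto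
    then show "Rep_model ` H \<subseteq> V" by blast
  qed
  moreover have "closure H = B"
  proof (rule subset_antisym)
    show "closure H \<subseteq> B"
      unfolding H_def by (intro closure_minimal hull_minimal B)
    show "B \<subseteq> closure H"
      by (rule B(4)[OF H]) (simp add: H_def hull_subset)
  qed
  ultimately show ?thesis
    by (simp add: closed_span_def closure_Rep_image)
qed

lemma positive_element_Rep_model: "positive_element model_algebra (Rep_model x) \<longleftrightarrow> npos x"
proof
  assume "positive_element model_algebra (Rep_model x)"
  then obtain y where "y \<in> carrier model_algebra" "Rep_model x = adj model_algebra y \<otimes>\<^bsub>model_algebra\<^esub> y"
    by (auto simp: positive_element_def)
  then have "x = star (Abs_model y) * Abs_model y"
    by (simp add: Rep_model_simps Abs_model_inverse flip: Rep_model_inject)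
  then show "npos x" using npos_star_mult by simp
next
  assume "npos x"
  then obtain y where "x = star y * y"
    by (auto simp: npos_iff)
  then show "positive_element model_algebra (Rep_model x)"
    unfolding positive_element_def
    by (intro bexI[of _ "Rep_model y"]) (auto simp: Rep_model_simps Rep_model)
qed

text \<open>The constant net at the unit serves; as a filter it is the principal filter of
  \<open>{1}\<close>.\<close>

lemma contains_approximate_unit_Rep_image:
  assumes "1 \<in> B" shows "contains_approximate_unit model_algebra (Rep_model ` B)"
  unfolding contains_approximate_unit_def
proof (intro exI[of _ "principal {\<one>\<^bsub>model_algebra\<^esub>}"] conjI ballI)
  have 1: "\<one>\<^bsub>model_algebra\<^esub> = Rep_model 1"
    by (simp add: one_model.rep_eq)
  have "npos (1 :: 'a model)"
    using npos_star_mult[of 1] by simp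
  then show "\<forall>\<^sub>F h in principal {\<one>\<^bsub>model_algebra\<^esub>}. h \<in> Rep_model ` B \<and>
      positive_element model_algebra h \<and> nrm model_algebra h \<le> 1"
    using assms norm_one_le[where 'a="'a model"]
    by (simp add: eventually_principal 1 positive_element_Rep_model flip: norm_model.rep_eq)
  fix x :: 'a assume x: "x \<in> carrier model_algebra"
  then have "x \<ominus>\<^bsub>model_algebra\<^esub> x = \<zero>\<^bsub>model_algebra\<^esub>"
    by (simp add: a_minus_def M.r_neg)
  then have "nrm model_algebra (x \<ominus>\<^bsub>model_algebra\<^esub> x) = 0"
    using M.nrm_eq_0_iff[of "\<zero>\<^bsub>model_algebra\<^esub>"] by simp
  then show "((\<lambda>h. nrm model_algebra (h \<otimes>\<^bsub>model_algebra\<^esub> x \<ominus>\<^bsub>model_algebra\<^esub> x)) \<longlongrightarrow> 0)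
        (principal {\<one>\<^bsub>model_algebra\<^esub>})"
    and "((\<lambda>h. nrm model_algebra (x \<otimes>\<^bsub>model_algebra\<^esub> h \<ominus>\<^bsub>model_algebra\<^esub> x)) \<longlongrightarrow> 0)
        (principal {\<one>\<^bsub>model_algebra\<^esub>})"
    using x by (auto intro!: tendsto_eventually simp: eventually_principal)
qed (simp add: principal_eq_bot_iff)

lemma cstar_generated_model_least:
  assumes "cstar_generated model_algebra (Rep_model ` G) = carrier model_algebra"
    and "csubspace X" "closed X" "\<And>x y. x \<in> X \<Longrightarrow> y \<in> X \<Longrightarrow> x * y \<in> X"
      "\<And>x. x \<in> X \<Longrightarrow> star x \<in> X" "G \<subseteq> X"
  shows "X = UNIV"
proof -
  have "carrier model_algebra \<subseteq> Rep_model ` X"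
    unfolding assms(1)[symmetric] cstar_generated_def
    by (rule hull_minimal) (use assms in \<open>auto simp: cstar_subalgebra_Rep_image\<close>)
  then have "Rep_model x \<in> Rep_model ` X" for x
    using Rep_model by blast
  then show ?thesis
    by (auto simp: inj_image_mem_iff inj_def Rep_model_inject)
qed

text \<open>The functional is a diagonal entry of a representation. It is contractive because
  \<open>1 - x\<^sup>* x\<close> has the form \<open>y\<^sup>* y\<close> if \<open>x\<close> has norm at most 1.\<close>

lemma root_functional_model:
  assumes rel: "is_OZE1 m (model_algebra :: 'a cstar) u s" and N: "N > 0" "coprime (int N) m" "j < N"
  shows "\<exists>\<psi> :: 'a model \<Rightarrow> complex. (\<forall>x y. \<psi> (x + y) = \<psi> x + \<psi> y) \<and> (\<forall>c x. \<psi> (c *\<^sub>C x) = c * \<psi> x) \<and>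
      (\<forall>x. cmod (\<psi> x) \<le> norm x) \<and> (\<forall>g. \<psi> (Abs_model (u g)) = unity_root N (int j * g))"
proof -
  have u: "u g \<in> carrier model_algebra" for g
    using rel by (simp add: is_OZE1_def OZE1_relations_def unitary_in_def)
  \<comment> \<open>Bezout's identity provides the inverse \<open>a\<close> of \<open>m\<close>
    modulo \<open>N\<close> that the matrix representation requires.\<close>
  obtain a b where "a * m + b * int N = 1"
    using bezout_int[of m "int N"] N(2) by (auto simp: coprime_iff_gcd_eq_1 gcd.commute)
  then have "a * m mod int N = 1 mod int N"
    by (metis mod_mult_self1 add.commute)
  then obtain \<phi> where \<phi>: "\<phi> \<in> star_homs (model_algebra :: 'a cstar) (mat_algebra N)"
      and \<phi>_u: "\<And>g. \<phi> (u g) = diag_op N g"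
    using rel cstar_algebra_mat_algebra OZE1_relations_mat_algebra[OF N(1)]
    unfolding is_OZE1_def by metis
  define \<Phi> where "\<Phi> x = \<phi> (Rep_model x)" for x :: "'a model"
  have closed: "\<Phi> x \<in> range (mat_op N)" for x
    using \<phi> Rep_model[of x] by (auto simp: star_homs_def ring_hom_def \<Phi>_def)
  have add: "\<Phi> (x + y) = (\<lambda>v i. \<Phi> x v i + \<Phi> y v i)" for x y
    using \<phi> Rep_model[of x] Rep_model[of y] by (simp add: star_homs_def ring_hom_def \<Phi>_def plus_model.rep_eq)
  have mult: "\<Phi> (x * y) = \<Phi> x \<circ> \<Phi> y" for x y
    using \<phi> Rep_model[of x] Rep_model[of y] by (simp add: star_homs_def ring_hom_def \<Phi>_def times_model.rep_eq)
  have one: "\<Phi> 1 = (\<lambda>v i. if i < N then v i else 0)"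
    using \<phi> by (simp add: star_homs_def ring_hom_def \<Phi>_def one_model.rep_eq)
  have scale: "\<Phi> (c *\<^sub>C x) = (\<lambda>v i. c * \<Phi> x v i)" for c x
    using \<phi> Rep_model[of x] by (simp add: star_homs_def \<Phi>_def scaleC_model.rep_eq)
  have star: "\<Phi> (star x) = mat_adj N (\<Phi> x)" for x
    using \<phi> Rep_model[of x] by (simp add: star_homs_def \<Phi>_def star_model.rep_eq)
  define \<psi> where "\<psi> x = \<Phi> x (unit_seq j) j" for x
  have \<psi>_scale: "\<psi> (c *\<^sub>C x) = c * \<psi> x" for c x
    by (simp add: \<psi>_def scale)
  \<comment> \<open>The decomposition of \<open>star_hom_contractive\<close> is repeated by hand, as
    \<open>mat_algebra N\<close> is a carrier and not an instance of \<open>cstar_type\<close>.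
    Evaluated at a unit vector it makes two squared lengths add up to 1.\<close>
  have le1: "cmod (\<psi> x) \<le> 1" if x: "norm x \<le> 1" for x
  proof -
    have "npos (1 - star x * x)"
      by (rule nposI[of _ 1]) (use x in \<open>auto simp: star_diff star_mult norm_star_mult power_le_one\<close>)
    then obtain y where "1 - star x * x = star y * y"
      by (auto simp: npos_iff)
    then have "1 = star x * x + star y * y"
      by (simp add: algebra_simps)
    then have "\<Phi> 1 = \<Phi> (star x * x + star y * y)"
      by (rule arg_cong)
    then have "\<Phi> 1 = (\<lambda>v i. (mat_adj N (\<Phi> x) \<circ> \<Phi> x) v i + (mat_adj N (\<Phi> y) \<circ> \<Phi> y) v i)"
      by (simp only: add mult star)
    then have "inner_seq N (unit_seq j) (\<Phi> 1 (unit_seq j)) =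
        inner_seq N (unit_seq j) ((mat_adj N (\<Phi> x) \<circ> \<Phi> x) (unit_seq j)) +
        inner_seq N (unit_seq j) ((mat_adj N (\<Phi> y) \<circ> \<Phi> y) (unit_seq j))"
      by (simp only: inner_seq_def distrib_left sum.distrib)
    also have "\<dots> = complex_of_real ((l2 N (\<Phi> x (unit_seq j)))\<^sup>2 + (l2 N (\<Phi> y (unit_seq j)))\<^sup>2)"
      by (simp only: l2_square_eq[OF closed, symmetric] of_real_add)
    also have "inner_seq N (unit_seq j) (\<Phi> 1 (unit_seq j)) = inner_seq N (unit_seq j) (unit_seq j)"
      unfolding inner_seq_def by (intro sum.cong) (auto simp: one)
    also have "\<dots> = complex_of_real 1"
      by (simp add: inner_seq_self l2_unit_seq N(3))
    finally have "1 = (l2 N (\<Phi> x (unit_seq j)))\<^sup>2 + (l2 N (\<Phi> y (unit_seq j)))\<^sup>2"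
      by (simp only: of_real_eq_iff)
    then have "(l2 N (\<Phi> x (unit_seq j)))\<^sup>2 \<le> 1"
      using zero_le_power2[of "l2 N (\<Phi> y (unit_seq j))"] by linarith
    then have "l2 N (\<Phi> x (unit_seq j)) \<le> 1"
      by (simp add: abs_square_le_1)
    then show ?thesis
      using cmod_le_l2[OF N(3), of "\<Phi> x (unit_seq j)"] by (simp add: \<psi>_def)
  qed
  have "cmod (\<psi> x) \<le> norm x" for x
  proof (cases "x = 0")
    case True
    then show ?thesis using \<psi>_scale[of 0 0] by simp
  next
    case False
    have "cmod (\<psi> (complex_of_real (1 / norm x) *\<^sub>C x)) \<le> 1"
      by (rule le1) (use False in \<open>simp add: norm_divide\<close>)
    then show ?thesis
      using False by (simp add: \<psi>_scale norm_mult norm_divide divide_le_eq)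
  qed
  moreover have "\<psi> (Abs_model (u g)) = unity_root N (int j * g)" for g
    using N(3) by (simp add: \<psi>_def \<Phi>_def Abs_model_inverse u \<phi>_u diag_op_apply unit_seq_def)
  ultimately show ?thesis
    using \<psi>_scale by (intro exI[of _ \<psi>]) (auto simp: \<psi>_def add)
qed

section \<open>The commutant and the Cartan property in the model\<close>

lemma commutant_cartan_model:
  assumes m: "m \<noteq> 0" and OZ: "is_OZE1 m A u s" and gauge: "gauge_action A u s \<gamma>"
    and A: "A = (model_algebra :: 'a cstar)"
  shows "relative_commutant A (fixed_point_algebra A \<gamma>)
           = closed_span A {spanning_element A u s p l q | p q l. m ^ p = m ^ q}
         \<and> cartan_subalgebra A (relative_commutant A (fixed_point_algebra A \<gamma>))"
proof -
  define U where "U g = Abs_model (u g)" for g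
  define S where "S p = Abs_model (s p)" for p
  define \<Gamma> where "\<Gamma> z x = Abs_model (\<gamma> z (Rep_model x))" for z x
  note rel = OZ[unfolded is_OZE1_def OZE1_relations_def unitary_in_def isometry_in_def restriction_def A]
  have u: "Rep_model (U g) = u g" for g
    using rel by (simp add: U_def Abs_model_inverse)
  have s: "Rep_model (S p) = s p" for p
    using rel by (simp add: S_def Abs_model_inverse)
  interpret bs_relations m U S
    by unfold_locales (use rel in \<open>simp_all add: Rep_model_simps u s flip: Rep_model_inject\<close>)
  have W: "Rep_model (W p g q) = spanning_element A u s p g q" for p g q
    by (simp add: W_def spanning_element_def A Rep_model_simps u s)
  have gen: "cstar_generated A (Rep_model ` (range U \<union> range S)) = carrier A"
    using rel by (simp add: A image_Un image_image u s)
  have hom: "\<gamma> z \<in> star_homs A A" and \<gamma>_span: "\<gamma> z (spanning_element A u s p g q)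
      = (z powi (int p - int q)) \<odot>\<^bsub>A\<^esub> spanning_element A u s p g q" if "cmod z = 1" for z p g q
    using gauge that by (auto simp: gauge_action_def star_autos_def)
  have \<Gamma>: "Rep_model (\<Gamma> z x) = \<gamma> z (Rep_model x)" if "cmod z = 1" for z x
    using hom[OF that] Rep_model[of x]
    by (auto simp: \<Gamma>_def star_homs_def ring_hom_def A intro!: Abs_model_inverse)
  interpret bs_gauge m U S \<Gamma>
  proof
    show "X = UNIV" if "csubspace X" "closed X" "\<And>x y. x \<in> X \<Longrightarrow> y \<in> X \<Longrightarrow> x * y \<in> X"
        "\<And>x. x \<in> X \<Longrightarrow> star x \<in> X" "range U \<subseteq> X" "range S \<subseteq> X" for X
      by (rule cstar_generated_model_least[OF gen[unfolded A] that(1-4)]) (use that in auto)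
    fix z :: complex assume z: "cmod z = 1"
    show "\<Gamma> z (W p g q) = z powi (int p - int q) *\<^sub>C W p g q" for p g q
      by (simp add: \<Gamma> z W \<gamma>_span[OF z] scaleC_model.rep_eq flip: Rep_model_inject A)
    show "\<Gamma> z (x + y) = \<Gamma> z x + \<Gamma> z y" "\<Gamma> z (x * y) = \<Gamma> z x * \<Gamma> z y"
        "\<Gamma> z (c *\<^sub>C x) = c *\<^sub>C \<Gamma> z x" "\<Gamma> z (star x) = star (\<Gamma> z x)" for x y c
      using hom[OF z] Rep_model[of x] Rep_model[of y]
      by (simp_all add: \<Gamma> z Rep_model_simps star_homs_def ring_hom_def A flip: Rep_model_inject)
  qed
  interpret bs_universal m U S \<Gamma>
    by unfold_locales (use m root_functional_model[OF OZ[unfolded A]] in \<open>simp_all add: U_def\<close>)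
  define B where "B = Fix period"
  have B_mult: "x * y \<in> B" if "x \<in> B" "y \<in> B" for x y
    using that by (simp add: B_def Fix_mult)
  have B_star: "star x \<in> B" if "x \<in> B" for x
    using that by (simp add: B_def Fix_star)
  have fixed: "fixed_point_algebra A \<gamma> = Rep_model ` Fix 0"
  proof (intro subset_antisym subsetI)
    fix x assume x: "x \<in> fixed_point_algebra A \<gamma>"
    then have "Rep_model (Abs_model x) = x"
      by (simp add: fixed_point_algebra_def A Abs_model_inverse)
    then show "x \<in> Rep_model ` Fix 0"
      using x by (intro image_eqI[of _ _ "Abs_model x"])
        (auto simp: fixed_point_algebra_def Fix_def \<Gamma> simp flip: Rep_model_inject)
  next
    fix x assume "x \<in> Rep_model ` Fix 0"
    then obtain y where y: "x = Rep_model y" "y \<in> Fix 0" by blast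
    then show "x \<in> fixed_point_algebra A \<gamma>"
      using Rep_model[of y] by (auto simp: fixed_point_algebra_def A Fix_def simp flip: \<Gamma>)
  qed
  have comm: "relative_commutant A (Rep_model ` Y) = Rep_model ` {x. \<forall>f\<in>Y. x * f = f * x}" for Y
  proof (intro subset_antisym subsetI)
    fix x assume x: "x \<in> relative_commutant A (Rep_model ` Y)"
    then have "Rep_model (Abs_model x) = x"
      by (simp add: relative_commutant_def A Abs_model_inverse)
    then show "x \<in> Rep_model ` {x. \<forall>f\<in>Y. x * f = f * x}"
      using x by (intro image_eqI[of _ _ "Abs_model x"])
        (auto simp: relative_commutant_def A times_model.rep_eq simp flip: Rep_model_inject)
  next
    fix x assume "x \<in> Rep_model ` {x. \<forall>f\<in>Y. x * f = f * x}"
    then obtain y where y: "x = Rep_model y" "\<forall>f\<in>Y. y * f = f * y" by blast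
    then show "x \<in> relative_commutant A (Rep_model ` Y)"
      using Rep_model[of y] by (auto simp: relative_commutant_def A simp flip: times_model.rep_eq)
  qed
  have F': "relative_commutant A (fixed_point_algebra A \<gamma>) = Rep_model ` B"
    unfolding fixed comm B_def by (simp only: commutant_Fix_0)
  have span: "closed_span A {spanning_element A u s p l q | p q l. m ^ p = m ^ q} = Rep_model ` B"
  proof -
    let ?G = "{W p l q | p q l. m ^ p = m ^ q}"
    have "{spanning_element A u s p l q | p q l. m ^ p = m ^ q} = Rep_model ` ?G"
      by (auto simp flip: W)
    moreover have "closed_span A (Rep_model ` ?G) = Rep_model ` B"
      unfolding A
    proof (rule closed_span_Rep_image)
      show "csubspace B" "closed B"
        by (simp_all add: B_def csubspace_Fix closed_Fix)
      show "?G \<subseteq> B"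
        by (auto simp: B_def power_eq_iff_period_dvd intro: W_in_Fix)
      show "B \<subseteq> closure X" if "csubspace X" "?G \<subseteq> X" for X
        unfolding B_def by (rule Fix_period_closure) (use that in auto)
    qed
    ultimately show ?thesis by simp
  qed
  have abelian: "abelian_cstar_subalgebra A (Rep_model ` B)"
    unfolding abelian_cstar_subalgebra_def A cstar_subalgebra_Rep_image
    using csubspace_Fix closed_Fix B_mult B_star Fix_period_commute
    by (auto simp: B_def simp flip: times_model.rep_eq)
  have masa: "masa A (Rep_model ` B)"
    unfolding masa_def
  proof (intro conjI allI impI abelian)
    \<comment> \<open>An abelian \<open>C\<close> above \<open>B\<close> contains the fixed point
      algebra, so it commutes with it and lies in the relative commutant, which is
      \<open>B\<close>.\<close>
    fix C assume C: "abelian_cstar_subalgebra A C \<and> Rep_model ` B \<subseteq> C"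
    then have "C \<subseteq> carrier A"
      using M.submoduleE(1) by (auto simp: abelian_cstar_subalgebra_def cstar_subalgebra_def A)
    moreover have "Rep_model ` Fix 0 \<subseteq> C"
      using C Fix_0_subset by (auto simp: B_def)
    ultimately have "C \<subseteq> relative_commutant A (fixed_point_algebra A \<gamma>)"
      using C unfolding fixed relative_commutant_def abelian_cstar_subalgebra_def by blast
    then show "C = Rep_model ` B"
      using C F' by blast
  qed
  have normalizers: "cstar_generated A (normalizer_set A (Rep_model ` B)) = carrier A"
  proof (rule subset_antisym)
    have "cstar_subalgebra A (carrier A)"
      using cstar_subalgebra_Rep_image[of UNIV] by (simp add: A range_Rep_model csubspace_def)
    then show "cstar_generated A (normalizer_set A (Rep_model ` B)) \<subseteq> carrier A"
      unfolding cstar_generated_def by (intro hull_minimal) (auto simp: normalizer_set_def)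
    have norm: "Rep_model x \<in> normalizer_set A (Rep_model ` B)"
      if "\<And>b. b \<in> B \<Longrightarrow> x * b * star x \<in> B \<and> star x * b * x \<in> B" for x
      using that Rep_model[of x]
      by (auto simp: normalizer_set_def A simp flip: times_model.rep_eq star_model.rep_eq)
    have "U g \<in> B" for g
      using W_in_Fix[of period 0 0 g] by (simp add: W_0_0 B_def)
    then have "Rep_model (U g) \<in> normalizer_set A (Rep_model ` B)" for g
      by (intro norm) (simp add: B_mult B_star)
    \<comment> \<open>The unitaries \<open>U g\<close> normalize \<open>B\<close> as members of it;
      conjugation by \<open>S p\<close> preserves degrees and hence \<open>B\<close>. Thus all
      generators are normalizers.\<close>
    moreover have "Rep_model (S p) \<in> normalizer_set A (Rep_model ` B)" for p
      by (intro norm) (simp add: B_def conj_S_in_Fix)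
    ultimately show "carrier A \<subseteq> cstar_generated A (normalizer_set A (Rep_model ` B))"
      unfolding gen[symmetric] cstar_generated_def by (intro hull_mono) auto
  qed
  define E' where "E' x = Rep_model (E period (Abs_model x))" for x
  have E': "E' (Rep_model x) = Rep_model (E period x)" for x
    by (simp add: E'_def Rep_model_inverse)
  have all_carrier: "(\<forall>x\<in>carrier A. P x) \<longleftrightarrow> (\<forall>x. P (Rep_model x))" for P
    by (simp add: A flip: range_Rep_model)
  have "conditional_expectation A (Rep_model ` B) E'"
    unfolding conditional_expectation_def Pi_iff all_carrier
    by (auto simp: A E' E_in_Fix positive_element_Rep_model npos_E norm_E_le E_add E_scaleC B_def E_Fix
        E_mult_left E_mult_right
        simp flip: plus_model.rep_eq scaleC_model.rep_eq norm_model.rep_eq times_model.rep_eq)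
  moreover have "faithful_map A E'"
    unfolding faithful_map_def all_carrier
    by (auto simp: A E' positive_element_Rep_model Rep_model_inject
        simp flip: zero_model.rep_eq intro: E_faithful)
  ultimately have "cartan_subalgebra A (Rep_model ` B)"
    unfolding cartan_subalgebra_def
    using abelian masa normalizers contains_approximate_unit_Rep_image[of B] one_in_Fix
    by (auto simp: B_def A)
  then show ?thesis
    by (simp only: F' span simp_thms)
qed

lemma not_counterexample_model: "\<not> counterexample (model_algebra :: 'a cstar)"
  unfolding counterexample_def using commutant_cartan_model[OF _ _ _ refl] by blast

theorem proposition3p22:
  fixes m :: int
    and A :: "'a cstar"
    and u :: "int \<Rightarrow> 'a"
    and s :: "nat \<Rightarrow> 'a"
    and \<gamma> :: "complex \<Rightarrow> 'a \<Rightarrow> 'a"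
  assumes "m \<noteq> 0"
    and "is_OZE1 m A u s"
    and "gauge_action A u s \<gamma>"
  shows "relative_commutant A (fixed_point_algebra A \<gamma>)
           = closed_span A {spanning_element A u s p l q | p q l. m ^ p = m ^ q}
         \<and> cartan_subalgebra A (relative_commutant A (fixed_point_algebra A \<gamma>))"
proof (rule ccontr)
  assume "\<not> ?thesis"
  with assms have "counterexample A"
    unfolding counterexample_def by blast
  then have "counterexample (model_algebra :: 'a cstar)"
    by (auto simp: model_algebra_def intro: someI)
  then show False
    using not_counterexample_model by blast
qed

end
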